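(* Let $\mathcal{G}$ be a square polynomial system of $n$ polynomials in $\mathbb{C}[x_1,\dots,x_n]$, and let $z^\ast\in\mathbb{C}^n$ be a regular zero of breadth $\kappa$ and order $d$ of $\mathcal{G}$. Then the generalized inflation algorithm (defined in the context) can be carried out on $(\mathcal{G},z^\ast)$, in particular a radius $\varepsilon>0$ as required in its second step exists, and the region $R_+$ it produces contains $z^\ast$ and no other zero of $\mathcal{G}$. Moreover, the multiplicity of $z^\ast$ as a zero of $\mathcal{G}$ is $d^\kappa$.
   Context: A square system is a system of $n$ polynomials in $n$ variables over $\mathbb{C}$, regarded as a column vector of polynomials. The breadth of a system at a zero is the nullity of its Jacobian there. Zeros are counted with multiplicity. Local Hilbert series at the origin: fix a graded local order on monomials, i.e., a total order compatible with multiplication such that $|\alpha|>|\beta|$ implies $x^\alpha<x^\beta$. The initial term of a polynomial is its largest monomial. The standard monomials of an ideal $I$ are the monomials which are not initial terms of elements of $I$; $h(i)$ is the number of standard monomials of total degree $i$, and the Hilbert series is $\sum_{i\ge0}h(i)t^i$. Regular zero: let the origin be an isolated zero of breadth $\kappa$ of a square system. It is a regular zero of breadth $\kappa$ and order $d$ if the local Hilbert series at the origin of the ideal generated by the system is $(1+t+\dots+t^{d-1})^\kappa$. For a zero $z^\ast\neq0$, translate $z^\ast$ to the origin. Pre-inflation procedure with parameters $k,\ell$, applied to a square system $\mathcal{G}$ with a zero $z^\ast$ of breadth $\kappa$: Step 1. Choose an invertible affine map $A:\mathbb{C}^n\to\mathbb{C}^n$ with $A(0)=z^\ast$ such that the kernel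 of the Jacobian at $0$ of $\mathcal{A}=\mathcal{G}\circ A$ is spanned by the standard basis vectors $e_1,\dots,e_\kappa$. Step 2. Choose $B\in GL_n(\mathbb{C})$ such that $\mathcal{B}=B\mathcal{A}=\{b_1,\dots,b_n\}$ satisfies: $b_1,\dots,b_\kappa$ have no linear terms and the linear part of $b_i$ is $x_i$ for $i>\kappa$. Step 3. Choose an invertible $\mathbb{C}[x]$-linear map $C_k\in GL_n(\mathbb{C}[x_1,\dots,x_n])$ such that $\mathcal{C}_k=C_k\mathcal{B}=\{c_1,\dots,c_n\}$ still has the properties of Step 2 and, in addition, every term of $c_1,\dots,c_\kappa$ involving one of $x_{\kappa+1},\dots,x_n$ has degree greater than $k$. Step 4. Choose a change of variables $D_\ell$ of the form $x_i\mapsto x_i$ for $i\le\kappa$ and $x_i\mapsto x_i+q_i(x_1,\dots,x_\kappa)$ for $i>\kappa$, with polynomials $q_i$ having no constant or linear terms, such that in $\mathcal{P}_{k,\ell}=\mathcal{C}_k\circ D_\ell=\{p_1,\dots,p_n\}$ every term of $p_{\kappa+1},\dots,p_n$ involving only $x_1,\dots,x_\kappa$ has degree greater than $\ell$. Output $\mathcal{P}_{k,\ell}$. Inflation operator of order $d$ and breadth $\kappa$: $S_\kappa^d:\mathbb{C}^n\to\mathbb{C}^n$, $S_\kappa^d(x_1,\dots,x_n)=(x_1,\dots,x_\kappa,x_{\kappa+1}^d,\dots,x_n^d)$. Generalized inflation algorithm, applied to $\mathcal{G}$ with a regular zero $z^\ast$ of breadth $\kappa$ and order $d$: 1. Apply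 the pre-inflation procedure with $k=\ell=d$ to obtain $\mathcal{P}_{d,d}$, with maps $A$ and $D_d$. 2. Form $\mathcal{P}_{d,d}\circ S_\kappa^d$ and find $\varepsilon>0$ such that $\mathcal{P}_{d,d}\circ S_\kappa^d$ has exactly $d^n$ zeros, counted with multiplicity, in the closed ball of radius $\varepsilon$ centered at the origin (Hermitian norm). 3. Output $R_+$, the region in the original coordinates corresponding to this ball, i.e. the image of the ball under $A\circ D_d\circ S_\kappa^d$. *)

theory Defs
  imports
    "HOL-Analysis.Analysis"
    "HOL-Library.Poly_Mapping"
    "HOL-Library.Extended_Nat"
    "HOL-Computational_Algebra.Fraction_Field"
    "HOL-Computational_Algebra.Formal_Power_Series"
begin

section \<open>Polynomials and square systems\<close>

text \<open>
  The variables are indexed by a finite linearly ordered type \<open>'n\<close>, so that \<open>n = CARD('n)\<close>.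
  The linear order is used to speak of the first \<open>\<kappa>\<close> variables; it also gives the instance
  \<open>'n mpoly :: idom\<close>, hence the field of rational functions \<open>'n mpoly fract\<close>.
\<close>

type_synonym 'n monomial = "'n \<Rightarrow>\<^sub>0 nat"
type_synonym 'n mpoly = "'n monomial \<Rightarrow>\<^sub>0 complex"
type_synonym 'n system = "('n mpoly) ^ 'n"
type_synonym 'n cvec = "complex ^ 'n"
type_synonym 'n cmat = "complex ^ 'n ^ 'n"
type_synonym 'n pmat = "('n mpoly) ^ 'n ^ 'n"

definition mdeg :: "'n::finite monomial \<Rightarrow> nat" where
  "mdeg \<alpha> = (\<Sum>i\<in>UNIV. Poly_Mapping.lookup \<alpha> i)"

definition mconst :: "complex \<Rightarrow> 'n mpoly" where
  "mconst c = Poly_Mapping.single 0 c"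

definition mvar :: "'n \<Rightarrow> 'n mpoly" where
  "mvar i = Poly_Mapping.single (Poly_Mapping.single i 1) 1"

definition meval :: "'n::finite mpoly \<Rightarrow> 'n cvec \<Rightarrow> complex" where
  "meval f x = (\<Sum>\<alpha>\<in>Poly_Mapping.keys f.
     Poly_Mapping.lookup f \<alpha> * (\<Prod>i\<in>UNIV. (x $ i) ^ Poly_Mapping.lookup \<alpha> i))"

definition msubst :: "'n::finite mpoly \<Rightarrow> 'n system \<Rightarrow> 'n mpoly" where
  "msubst f q = (\<Sum>\<alpha>\<in>Poly_Mapping.keys f.
     mconst (Poly_Mapping.lookup f \<alpha>) * (\<Prod>i\<in>UNIV. (q $ i) ^ Poly_Mapping.lookup \<alpha> i))"

definition mpderiv :: "'n \<Rightarrow> 'n mpoly \<Rightarrow> 'n mpoly" where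
  "mpderiv j f = (\<Sum>\<alpha>\<in>Poly_Mapping.keys f.
     Poly_Mapping.single (\<alpha> - Poly_Mapping.single j 1)
       (of_nat (Poly_Mapping.lookup \<alpha> j) * Poly_Mapping.lookup f \<alpha>))"

text \<open>
  An element of \<open>'n system\<close> serves both as a square system of equations and as a polynomial
  self-map of \<open>\<complex>\<^sup>n\<close>.
\<close>

definition sys_eval :: "'n::finite system \<Rightarrow> 'n cvec \<Rightarrow> 'n cvec" where
  "sys_eval F x = (\<chi> i. meval (F $ i) x)"

definition sys_comp :: "'n::finite system \<Rightarrow> 'n system \<Rightarrow> 'n system" (infixl \<open>\<circ>\<^sub>s\<close> 65) where
  "F \<circ>\<^sub>s Q = (\<chi> i. msubst (F $ i) Q)"

definition zeros :: "'n::finite system \<Rightarrow> ('n cvec) set" where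
  "zeros F = {x. sys_eval F x = 0}"

definition affine_map :: "'n::finite cmat \<Rightarrow> 'n cvec \<Rightarrow> 'n system" where
  "affine_map M a = (\<chi> i. (\<Sum>j\<in>UNIV. mconst (M $ i $ j) * mvar j) + mconst (a $ i))"

definition jacobian :: "'n::finite system \<Rightarrow> 'n cvec \<Rightarrow> 'n cmat" where
  "jacobian F x = (\<chi> i j. meval (mpderiv j (F $ i)) x)"

definition jac_kernel :: "'n::finite system \<Rightarrow> 'n cvec \<Rightarrow> ('n cvec) set" where
  "jac_kernel F x = {v. jacobian F x *v v = 0}"

definition breadth :: "'n::finite system \<Rightarrow> 'n cvec \<Rightarrow> nat" where
  "breadth F x = vec.dim (jac_kernel F x)"

section \<open>Multiplicity\<close>

definition ideal_gen :: "'r::comm_ring_1 set \<Rightarrow> ('n::finite \<Rightarrow> 'r) \<Rightarrow> 'r set" where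
  "ideal_gen R F = {\<Sum>i\<in>UNIV. r i * F i | r. \<forall>i. r i \<in> R}"

definition local_ring :: "'n::{finite,linorder} cvec \<Rightarrow> ('n mpoly fract) set" where
  "local_ring z = {Fract f g | f g. meval g z \<noteq> 0}"

definition lin_indep_mod ::
    "('n::{finite,linorder} mpoly fract) set \<Rightarrow> ('n mpoly fract) set \<Rightarrow> bool" where
  "lin_indep_mod J B \<longleftrightarrow>
     (\<forall>c. (\<Sum>b\<in>B. Fract (mconst (c b)) 1 * b) \<in> J \<longrightarrow> (\<forall>b\<in>B. c b = 0))"

text \<open>
  The multiplicity is the complex dimension of the local ring at \<open>z\<close> modulo the ideal
  generated by the system, i.e. the supremum of the sizes of the finite sets that are linearly
  independent modulo that ideal (so it is \<open>\<infinity>\<close> if the quotient is infinite-dimensional).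
\<close>

definition zero_mult :: "'n::{finite,linorder} system \<Rightarrow> 'n cvec \<Rightarrow> enat" where
  "zero_mult F z =
     (SUP B \<in> {B. finite B \<and> B \<subseteq> local_ring z \<and>
                  lin_indep_mod (ideal_gen (local_ring z) (\<lambda>i. Fract (F $ i) 1)) B}.
        enat (card B))"

definition num_zeros_eq ::
    "'n::{finite,linorder} system \<Rightarrow> ('n cvec) set \<Rightarrow> nat \<Rightarrow> bool" where
  "num_zeros_eq F K N \<longleftrightarrow>
     finite (zeros F \<inter> K) \<and> (\<Sum>z\<in>zeros F \<inter> K. zero_mult F z) = enat N"

section \<open>Local Hilbert series and regular zeros\<close>

definition graded_local_order :: "('n::finite monomial \<Rightarrow> 'n monomial \<Rightarrow> bool) \<Rightarrow> bool" where
  "graded_local_order lt \<longleftrightarrow>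
     irreflp lt \<and> transp lt \<and> totalp lt \<and>
     (\<forall>\<alpha> \<beta> \<gamma>. lt \<alpha> \<beta> \<longrightarrow> lt (\<alpha> + \<gamma>) (\<beta> + \<gamma>)) \<and>
     (\<forall>\<alpha> \<beta>. mdeg \<alpha> > mdeg \<beta> \<longrightarrow> lt \<alpha> \<beta>)"

definition is_initial :: "('n monomial \<Rightarrow> 'n monomial \<Rightarrow> bool) \<Rightarrow> 'n mpoly \<Rightarrow> 'n monomial \<Rightarrow> bool"
  where "is_initial lt f \<alpha> \<longleftrightarrow>
     \<alpha> \<in> Poly_Mapping.keys f \<and> (\<forall>\<beta>\<in>Poly_Mapping.keys f. \<beta> \<noteq> \<alpha> \<longrightarrow> lt \<beta> \<alpha>)"

definition standard_monomials ::
    "('n monomial \<Rightarrow> 'n monomial \<Rightarrow> bool) \<Rightarrow> 'n mpoly set \<Rightarrow> 'n monomial set" where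
  "standard_monomials lt I = {\<alpha>. \<not> (\<exists>f\<in>I. is_initial lt f \<alpha>)}"

definition hilbert_series ::
    "('n::finite monomial \<Rightarrow> 'n monomial \<Rightarrow> bool) \<Rightarrow> 'n mpoly set \<Rightarrow> int fps" where
  "hilbert_series lt I =
     Abs_fps (\<lambda>i. int (card {\<alpha> \<in> standard_monomials lt I. mdeg \<alpha> = i}))"

text \<open>
  The order is required to be positive, since \<open>1 + t + \<dots> + t\<^bsup>d-1\<^esup>\<close> is an empty sum for
  \<open>d = 0\<close> (whose zeroth power would be \<open>1\<close> in breadth \<open>0\<close>).
\<close>

definition regular_zero ::
    "('n::finite monomial \<Rightarrow> 'n monomial \<Rightarrow> bool) \<Rightarrow> 'n system \<Rightarrow> 'n cvec \<Rightarrow> nat \<Rightarrow> nat \<Rightarrow> bool"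
  where
  "regular_zero lt G z \<kappa> d \<longleftrightarrow>
     z isolated_in zeros G \<and> breadth G z = \<kappa> \<and> d \<ge> 1 \<and>
     hilbert_series lt (ideal_gen UNIV (\<lambda>i. (G \<circ>\<^sub>s affine_map (mat 1) z) $ i))
       = (\<Sum>i<d. fps_X ^ i) ^ \<kappa>"

section \<open>Pre-inflation\<close>

definition firsts :: "nat \<Rightarrow> 'n::{finite,linorder} set" where
  "firsts \<kappa> = {i. card {j. j < i} < \<kappa>}"

definition lin_coeff :: "'n mpoly \<Rightarrow> 'n \<Rightarrow> complex" where
  "lin_coeff f j = Poly_Mapping.lookup f (Poly_Mapping.single j 1)"

definition apply_const :: "'n::finite cmat \<Rightarrow> 'n system \<Rightarrow> 'n system" where
  "apply_const B F = (\<chi> i j. mconst (B $ i $ j)) *v F"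

definition step1 :: "nat \<Rightarrow> 'n::{finite,linorder} system \<Rightarrow> 'n cvec \<Rightarrow> 'n system \<Rightarrow> bool" where
  "step1 \<kappa> G z A \<longleftrightarrow>
     (\<exists>M a. invertible M \<and> A = affine_map M a) \<and> sys_eval A 0 = z \<and>
     jac_kernel (G \<circ>\<^sub>s A) 0 = vec.span ((\<lambda>i. axis i 1) ` firsts \<kappa>)"

definition normalized_linear_parts :: "nat \<Rightarrow> 'n::{finite,linorder} system \<Rightarrow> bool" where
  "normalized_linear_parts \<kappa> F \<longleftrightarrow>
     (\<forall>i\<in>firsts \<kappa>. \<forall>j. lin_coeff (F $ i) j = 0) \<and>
     (\<forall>i. i \<notin> firsts \<kappa> \<longrightarrow> (\<forall>j. lin_coeff (F $ i) j = (if j = i then 1 else 0)))"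

definition step2 :: "nat \<Rightarrow> 'n::{finite,linorder} system \<Rightarrow> 'n cmat \<Rightarrow> bool" where
  "step2 \<kappa> F B \<longleftrightarrow> invertible B \<and> normalized_linear_parts \<kappa> (apply_const B F)"

definition step3 :: "nat \<Rightarrow> nat \<Rightarrow> 'n::{finite,linorder} system \<Rightarrow> 'n pmat \<Rightarrow> bool" where
  "step3 \<kappa> k F C \<longleftrightarrow>
     invertible C \<and> normalized_linear_parts \<kappa> (C *v F) \<and>
     (\<forall>i\<in>firsts \<kappa>. \<forall>\<alpha>\<in>Poly_Mapping.keys ((C *v F) $ i).
        \<not> Poly_Mapping.keys \<alpha> \<subseteq> firsts \<kappa> \<longrightarrow> mdeg \<alpha> > k)"

definition step4 :: "nat \<Rightarrow> nat \<Rightarrow> 'n::{finite,linorder} system \<Rightarrow> 'n system \<Rightarrow> bool" where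
  "step4 \<kappa> l F D \<longleftrightarrow>
     (\<exists>q. (\<forall>i. \<forall>\<alpha>\<in>Poly_Mapping.keys (q i).
          Poly_Mapping.keys \<alpha> \<subseteq> firsts \<kappa> \<and> mdeg \<alpha> \<ge> 2) \<and>
          D = (\<chi> i. if i \<in> firsts \<kappa> then mvar i else mvar i + q i)) \<and>
     (\<forall>i. i \<notin> firsts \<kappa> \<longrightarrow>
        (\<forall>\<alpha>\<in>Poly_Mapping.keys ((F \<circ>\<^sub>s D) $ i).
          Poly_Mapping.keys \<alpha> \<subseteq> firsts \<kappa> \<longrightarrow> mdeg \<alpha> > l))"

definition pre_inflation_choices ::
    "nat \<Rightarrow> nat \<Rightarrow> nat \<Rightarrow> 'n::{finite,linorder} system \<Rightarrow> 'n cvec \<Rightarrow>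
     'n system \<Rightarrow> 'n cmat \<Rightarrow> 'n pmat \<Rightarrow> 'n system \<Rightarrow> bool" where
  "pre_inflation_choices \<kappa> k l G z A B C D \<longleftrightarrow>
     step1 \<kappa> G z A \<and>
     step2 \<kappa> (G \<circ>\<^sub>s A) B \<and>
     step3 \<kappa> k (apply_const B (G \<circ>\<^sub>s A)) C \<and>
     step4 \<kappa> l (C *v apply_const B (G \<circ>\<^sub>s A)) D"

definition pre_inflation_output ::
    "'n::finite system \<Rightarrow> 'n system \<Rightarrow> 'n cmat \<Rightarrow> 'n pmat \<Rightarrow> 'n system \<Rightarrow>
     'n system" where
  "pre_inflation_output G A B C D = (C *v apply_const B (G \<circ>\<^sub>s A)) \<circ>\<^sub>s D"

text \<open>
  Every step is applicable whatever choices were made in the preceding steps; in particular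
  some complete sequence of choices exists.
\<close>

definition pre_inflation_executable ::
    "nat \<Rightarrow> nat \<Rightarrow> nat \<Rightarrow> 'n::{finite,linorder} system \<Rightarrow> 'n cvec \<Rightarrow> bool" where
  "pre_inflation_executable \<kappa> k l G z \<longleftrightarrow>
     (\<exists>A. step1 \<kappa> G z A) \<and>
     (\<forall>A. step1 \<kappa> G z A \<longrightarrow> (\<exists>B. step2 \<kappa> (G \<circ>\<^sub>s A) B)) \<and>
     (\<forall>A B. step1 \<kappa> G z A \<and> step2 \<kappa> (G \<circ>\<^sub>s A) B \<longrightarrow>
        (\<exists>C. step3 \<kappa> k (apply_const B (G \<circ>\<^sub>s A)) C)) \<and>
     (\<forall>A B C. step1 \<kappa> G z A \<and> step2 \<kappa> (G \<circ>\<^sub>s A) B \<and> step3 \<kappa> k (apply_const B (G \<circ>\<^sub>s A)) C \<longrightarrow>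
        (\<exists>D. step4 \<kappa> l (C *v apply_const B (G \<circ>\<^sub>s A)) D))"

section \<open>Generalized inflation\<close>

definition inflation :: "nat \<Rightarrow> nat \<Rightarrow> 'n::{finite,linorder} system" where
  "inflation \<kappa> d = (\<chi> i. if i \<in> firsts \<kappa> then mvar i else mvar i ^ d)"

definition inflation_radius ::
    "nat \<Rightarrow> nat \<Rightarrow> 'n::{finite,linorder} system \<Rightarrow> real \<Rightarrow> bool" where
  "inflation_radius \<kappa> d P \<epsilon> \<longleftrightarrow>
     \<epsilon> > 0 \<and> num_zeros_eq (P \<circ>\<^sub>s inflation \<kappa> d) (cball 0 \<epsilon>) (d ^ CARD('n))"

definition region_plus ::
    "nat \<Rightarrow> nat \<Rightarrow> 'n::{finite,linorder} system \<Rightarrow> 'n system \<Rightarrow> real \<Rightarrow> ('n cvec) set" where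
  "region_plus \<kappa> d A D \<epsilon> =
     (sys_eval A \<circ> sys_eval D \<circ> sys_eval (inflation \<kappa> d)) ` cball 0 \<epsilon>"

end

theory Submission
  imports Defs "HOL-Computational_Algebra.Polynomial_FPS"
begin

text \<open>
  Everything is reduced to the dimension of the local algebra at the zero, and no information
  about initial forms of the inflated system is needed. Nakayama's lemma shows that the standard
  monomials, of which the Hilbert series counts \<open>d ^ \<kappa>\<close>, are a basis of the local algebra, so
  that the multiplicity of \<open>z\<close> is \<open>d ^ \<kappa>\<close>. Pre-inflation only changes coordinates by polynomial
  automorphisms and the generators of the ideal by invertible matrices, hence preserves this
  multiplicity. Inflation replaces the coordinate ring by a free extension of rank
  \<open>d ^ (n - \<kappa>)\<close>, hence the origin has multiplicity \<open>d ^ n\<close> as a zero of the inflated system. A ball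
  contains exactly \<open>d ^ n\<close> zeros if and only if it contains no zero but the origin; small balls
  have this property because \<open>z\<close> is isolated and the origin is its only preimage.
\<close>

section \<open>Calculus of multivariate polynomials\<close>

text \<open>The Hilbert series is read off from an ideal of polynomials, whereas the multiplicity is
  defined inside the fraction field. The two meet in \<open>local_ideal\<close>, the polynomials
  that some polynomial not vanishing at the point multiplies into the ideal: apart from the
  comparison with \<open>zero_mult\<close>, every dimension count takes place among polynomials
  modulo this set, without quotient spaces. Reduction by a graded local order pushes degrees up and
  need not stop, so spanning by standard monomials is not a plain division algorithm. Nakayama's
  lemma is there to put all monomials of large degree into \<open>local_ideal\<close>, which leaves
  only finitely many monomials to reduce. Such high-degree monomials also make the free extension
  compatible with localization: a unit at the origin need not be an inflated polynomial, but modulo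
  high degrees a truncated geometric series inverts it. The criterion for the ball holds because the
  origin alone exhausts the count and every other zero would add at least 1.\<close>

lemma sum_keys_add:
  assumes "\<And>\<alpha>. \<phi> \<alpha> 0 = 0" and "\<And>\<alpha> a b. \<phi> \<alpha> (a + b) = \<phi> \<alpha> a + \<phi> \<alpha> b"
  shows "(\<Sum>\<alpha>\<in>Poly_Mapping.keys (f + g). \<phi> \<alpha> (Poly_Mapping.lookup (f + g) \<alpha>)) =
    (\<Sum>\<alpha>\<in>Poly_Mapping.keys f. \<phi> \<alpha> (Poly_Mapping.lookup f \<alpha>)) +
    (\<Sum>\<alpha>\<in>Poly_Mapping.keys g. \<phi> \<alpha> (Poly_Mapping.lookup g \<alpha>))"
  by (rule setsum_keys_plus_distrib) (use assms in auto)

lemma sum_keys_single: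
  assumes "\<phi> \<alpha> 0 = 0"
  shows "(\<Sum>\<beta>\<in>Poly_Mapping.keys (Poly_Mapping.single \<alpha> c).
    \<phi> \<beta> (Poly_Mapping.lookup (Poly_Mapping.single \<alpha> c) \<beta>)) = \<phi> \<alpha> c"
  using assms by (cases "c = 0") auto

lemma poly_mapping_eq_sum_single:
  "f = (\<Sum>\<alpha>\<in>Poly_Mapping.keys f. Poly_Mapping.single \<alpha> (Poly_Mapping.lookup f \<alpha>))"
  by (rule poly_mapping_eqI)
    (auto simp: lookup_sum lookup_single when_def sum.delta in_keys_iff)

text \<open>Additive statements reduce to single terms; the zero polynomial needs no case of its
  own, being a term with coefficient 0.\<close>

lemma poly_mapping_single_induct [case_names single add]:
  fixes f :: "'a \<Rightarrow>\<^sub>0 'b::comm_monoid_add"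
  assumes single: "\<And>\<alpha> c. P (Poly_Mapping.single \<alpha> c)" and add: "\<And>f g. P f \<Longrightarrow> P g \<Longrightarrow> P (f + g)"
  shows "P f"
proof -
  have "P 0" using single[of _ 0] by simp
  then have "P (\<Sum>\<alpha>\<in>A. Poly_Mapping.single \<alpha> (Poly_Mapping.lookup f \<alpha>))" for A
    by (induction A rule: infinite_finite_induct) (auto intro: single add)
  then show ?thesis using poly_mapping_eq_sum_single[of f] by metis
qed

lemma lookup_add_mult_single:
  fixes f :: "'n mpoly"
  shows "Poly_Mapping.lookup (Poly_Mapping.single \<alpha> c * f) (\<alpha> + \<beta>) = c * Poly_Mapping.lookup f \<beta>"
  by (induction f rule: poly_mapping_single_induct)
    (auto simp: mult_single lookup_single when_def lookup_add distrib_left)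

lemma lookup_mconst_mult [simp]:
  "Poly_Mapping.lookup (mconst c * f) \<alpha> = c * Poly_Mapping.lookup f \<alpha>"
  using lookup_add_mult_single[of 0 c f \<alpha>] by (simp add: mconst_def)

lemma mconst_hom [simp]:
  "mconst 0 = 0" "mconst 1 = 1" "mconst (a + b) = mconst a + mconst b"
  "mconst (a * b) = mconst a * mconst b" "mconst (- a) = - mconst a" "mconst (a - b) = mconst a - mconst b"
  by (simp_all add: mconst_def single_add mult_single single_uminus single_diff)

lemma mconst_sum: "mconst (sum f A) = (\<Sum>a\<in>A. mconst (f a))"
  by (induction A rule: infinite_finite_induct) auto

lemma mconst_mult_single: "mconst c * Poly_Mapping.single \<alpha> a = Poly_Mapping.single \<alpha> (c * a)"
  by (simp add: mconst_def mult_single)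

lemma mvar_power: "mvar i ^ k = Poly_Mapping.single (Poly_Mapping.single i k) 1"
  by (induction k) (auto simp: mvar_def mult_single single_add[symmetric])

lemma prod_single: "(\<Prod>i\<in>A. Poly_Mapping.single (\<alpha> i) 1) = Poly_Mapping.single (\<Sum>i\<in>A. \<alpha> i) (1::complex)"
  for \<alpha> :: "'a \<Rightarrow> 'n monomial"
  by (induction A rule: infinite_finite_induct) (auto simp: mult_single)

lemma monomial_eq_sum_single:
  "\<alpha> = (\<Sum>i\<in>UNIV. Poly_Mapping.single i (Poly_Mapping.lookup \<alpha> i))" for \<alpha> :: "'n::finite monomial"
  by (rule poly_mapping_eqI) (simp add: lookup_sum lookup_single when_def)

lemma monomial_eq_prod_mvar:
  "Poly_Mapping.single \<alpha> 1 = (\<Prod>i\<in>UNIV. mvar i ^ Poly_Mapping.lookup \<alpha> i)"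
  for \<alpha> :: "'n::finite monomial"
  unfolding mvar_power prod_single using monomial_eq_sum_single[of \<alpha>] by simp

text \<open>Suited to statements compatible with the ring operations, since a term is its
  coefficient times powers of variables.\<close>

lemma mpoly_induct [case_names const var add mult]:
  fixes f :: "'n::finite mpoly"
  assumes const: "\<And>c. P (mconst c)" and var: "\<And>i. P (mvar i)"
    and add: "\<And>f g. P f \<Longrightarrow> P g \<Longrightarrow> P (f + g)" and mult: "\<And>f g. P f \<Longrightarrow> P g \<Longrightarrow> P (f * g)"
  shows "P f"
proof (induction f rule: poly_mapping_single_induct)
  case (single \<alpha> c)
  have 1: "P 1" using const[of 1] by simp
  have pow: "P (mvar i ^ k)" for i k
    by (induction k) (auto intro: 1 var mult)
  have "P (\<Prod>i\<in>A. mvar i ^ Poly_Mapping.lookup \<alpha> i)" for A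
    by (induction A rule: infinite_finite_induct) (auto intro: 1 pow mult)
  then have "P (Poly_Mapping.single \<alpha> 1)" by (simp add: monomial_eq_prod_mvar)
  from mult[OF const[of c] this] show ?case by (simp add: mconst_mult_single)
qed (rule add)

text \<open>Evaluation (identity on coefficients) and substitution (\<open>mconst\<close> on
  coefficients) are both insertions of ring elements for the variables, so additivity and
  multiplicativity are proved only once.\<close>

locale coeff_hom =
  fixes \<phi> :: "complex \<Rightarrow> 'r::comm_ring_1"
  assumes hom_one: "\<phi> 1 = 1" and hom_add: "\<phi> (a + b) = \<phi> a + \<phi> b" and hom_mult: "\<phi> (a * b) = \<phi> a * \<phi> b"
begin

lemma hom_zero: "\<phi> 0 = 0"
  using hom_add[of 0 0] by simp

definition insertion :: "('n::finite \<Rightarrow> 'r) \<Rightarrow> 'n mpoly \<Rightarrow> 'r" where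
  "insertion v f = (\<Sum>\<alpha>\<in>Poly_Mapping.keys f.
     \<phi> (Poly_Mapping.lookup f \<alpha>) * (\<Prod>i\<in>UNIV. v i ^ Poly_Mapping.lookup \<alpha> i))"

lemma insertion_single:
  "insertion v (Poly_Mapping.single \<alpha> c) = \<phi> c * (\<Prod>i\<in>UNIV. v i ^ Poly_Mapping.lookup \<alpha> i)"
  unfolding insertion_def
  by (rule sum_keys_single[where \<phi> = "\<lambda>\<alpha> c. \<phi> c * (\<Prod>i\<in>UNIV. v i ^ Poly_Mapping.lookup \<alpha> i)"])
    (simp add: hom_zero)

lemma insertion_add: "insertion v (f + g) = insertion v f + insertion v g"
  unfolding insertion_def by (rule sum_keys_add) (auto simp: hom_zero hom_add distrib_right)

lemma insertion_mult: "insertion v (f * g) = insertion v f * insertion v g"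
proof (induction f rule: poly_mapping_single_induct)
  case (single \<alpha> c)
  show ?case
    by (induction g rule: poly_mapping_single_induct)
      (simp_all add: mult_single insertion_single hom_mult insertion_add distrib_left lookup_add
        power_add prod.distrib)
qed (simp add: insertion_add distrib_right)

lemma insertion_mconst: "insertion v (mconst c) = \<phi> c"
  by (simp add: mconst_def insertion_single)

lemma insertion_mvar: "insertion v (mvar i) = v i"
proof -
  have "insertion v (mvar i) = (\<Prod>j\<in>UNIV. v j ^ (if i = j then 1 else 0))"
    unfolding mvar_def insertion_single hom_one lookup_single when_def by simp
  also have "\<dots> = (\<Prod>j\<in>UNIV. if i = j then v j else 1)"
    by (rule prod.cong) auto
  finally show ?thesis by simp
qed

end

interpretation eval: coeff_hom "\<lambda>c. c" by unfold_locales auto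
interpretation subst: coeff_hom mconst by unfold_locales auto

lemma meval_insertion: "meval f x = eval.insertion (($) x) f"
  by (simp add: meval_def eval.insertion_def)

lemma msubst_insertion: "msubst f Q = subst.insertion (($) Q) f"
  by (simp add: msubst_def subst.insertion_def)

lemma meval_hom [simp]:
  "meval (f + g) x = meval f x + meval g x" "meval (f * g) x = meval f x * meval g x"
  "meval (mconst c) x = c" "meval (mvar i) x = x $ i"
  by (simp_all add: meval_insertion eval.insertion_add eval.insertion_mult eval.insertion_mconst
      eval.insertion_mvar)

lemma meval_single: "meval (Poly_Mapping.single \<alpha> c) x = c * (\<Prod>i\<in>UNIV. x $ i ^ Poly_Mapping.lookup \<alpha> i)"
  by (simp add: meval_insertion eval.insertion_single)

lemma meval_0_1 [simp]: "meval 0 x = 0" "meval 1 x = 1"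
  using meval_hom(3)[of 0 x] meval_hom(3)[of 1 x] by simp_all

lemma meval_uminus [simp]: "meval (- f) x = - meval f x"
  using meval_hom(1)[of f "- f" x] by (simp add: add_eq_0_iff)

lemma meval_diff [simp]: "meval (f - g) x = meval f x - meval g x"
  using meval_hom(1)[of f "- g" x] by simp

lemma meval_sum: "meval (sum f A) x = (\<Sum>a\<in>A. meval (f a) x)"
  by (induction A rule: infinite_finite_induct) auto

lemma meval_power [simp]: "meval (f ^ k) x = meval f x ^ k"
  by (induction k) auto

lemma msubst_hom [simp]:
  "msubst (f + g) Q = msubst f Q + msubst g Q" "msubst (f * g) Q = msubst f Q * msubst g Q"
  "msubst (mconst c) Q = mconst c" "msubst (mvar i) Q = Q $ i"
  by (simp_all add: msubst_insertion subst.insertion_add subst.insertion_mult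
      subst.insertion_mconst subst.insertion_mvar)

lemma msubst_single:
  "msubst (Poly_Mapping.single \<alpha> c) Q = mconst c * (\<Prod>i\<in>UNIV. Q $ i ^ Poly_Mapping.lookup \<alpha> i)"
  by (simp add: msubst_insertion subst.insertion_single)

lemma msubst_0_1 [simp]: "msubst 0 Q = 0" "msubst 1 Q = 1"
  using msubst_hom(3)[of 0 Q] msubst_hom(3)[of 1 Q] by simp_all

lemma msubst_uminus [simp]: "msubst (- f) Q = - msubst f Q"
  using msubst_hom(1)[of f "- f" Q] by (simp add: add_eq_0_iff)

lemma msubst_diff [simp]: "msubst (f - g) Q = msubst f Q - msubst g Q"
  using msubst_hom(1)[of f "- g" Q] by simp

lemma msubst_sum: "msubst (sum f A) Q = (\<Sum>a\<in>A. msubst (f a) Q)"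
  by (induction A rule: infinite_finite_induct) auto

lemma meval_msubst [simp]: "meval (msubst f Q) x = meval f (sys_eval Q x)"
  by (induction f rule: mpoly_induct) (auto simp: sys_eval_def)

lemma sys_eval_nth [simp]: "sys_eval F x $ i = meval (F $ i) x"
  by (simp add: sys_eval_def)

lemma sys_comp_nth [simp]: "(F \<circ>\<^sub>s Q) $ i = msubst (F $ i) Q"
  by (simp add: sys_comp_def)

lemma sys_eval_comp: "sys_eval (F \<circ>\<^sub>s Q) x = sys_eval F (sys_eval Q x)"
  by (simp add: vec_eq_iff)

lemma msubst_msubst: "msubst (msubst f Q) R = msubst f (Q \<circ>\<^sub>s R)"
  by (induction f rule: mpoly_induct) (auto simp: sys_comp_def)

lemma msubst_vars [simp]: "msubst f (\<chi> i. mvar i) = f"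
  by (induction f rule: mpoly_induct) auto

lemma sys_comp_assoc: "F \<circ>\<^sub>s Q \<circ>\<^sub>s R = F \<circ>\<^sub>s (Q \<circ>\<^sub>s R)"
  by (simp add: vec_eq_iff msubst_msubst)

lemma sys_comp_vars [simp]: "F \<circ>\<^sub>s (\<chi> i. mvar i) = F"
  by (simp add: sys_comp_def vec_eq_iff)

section \<open>Degrees of monomials and the order filtration at the origin\<close>

lemma mdeg_add [simp]: "mdeg (\<alpha> + \<beta>) = mdeg \<alpha> + mdeg \<beta>"
  by (simp add: mdeg_def lookup_add sum.distrib)

lemma mdeg_0 [simp]: "mdeg 0 = 0"
  by (simp add: mdeg_def)

lemma mdeg_single [simp]: "mdeg (Poly_Mapping.single i k) = k"
  by (simp add: mdeg_def lookup_single when_def)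

lemma mdeg_eq_0_iff [simp]: "mdeg \<alpha> = 0 \<longleftrightarrow> \<alpha> = 0"
  by (auto simp: mdeg_def poly_mapping_eq_iff fun_eq_iff)

lemma lookup_le_mdeg: "Poly_Mapping.lookup \<alpha> i \<le> mdeg \<alpha>"
  unfolding mdeg_def by (rule member_le_sum) auto

lemma monomial_split_var:
  fixes \<alpha> :: "'n monomial"
  assumes "Poly_Mapping.lookup \<alpha> i \<noteq> 0"
  obtains \<beta> where "\<alpha> = Poly_Mapping.single i 1 + \<beta>"
proof
  show "\<alpha> = Poly_Mapping.single i 1 + (\<alpha> - Poly_Mapping.single i 1)"
    by (rule poly_mapping_eqI) (use assms in \<open>auto simp: lookup_add lookup_minus lookup_single when_def\<close>)
qed

lemma mdeg_eq_1E:
  assumes "mdeg \<alpha> = 1"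
  obtains i where "\<alpha> = Poly_Mapping.single i 1"
proof -
  have "\<alpha> \<noteq> 0" using assms mdeg_0 by (metis zero_neq_one)
  then obtain i where "Poly_Mapping.lookup \<alpha> i \<noteq> 0"
    by (metis lookup_zero poly_mapping_eqI)
  then obtain \<beta> where \<beta>: "\<alpha> = Poly_Mapping.single i 1 + \<beta>" by (rule monomial_split_var)
  then have "1 + mdeg \<beta> = 1" using assms by (metis mdeg_add mdeg_single)
  then have "\<beta> = 0" by simp
  with \<beta> have "\<alpha> = Poly_Mapping.single i 1" by (metis add.right_neutral)
  then show ?thesis by (rule that)
qed

lemma finite_monomials_mdeg_le: "finite {\<alpha> :: 'n::finite monomial. mdeg \<alpha> \<le> N}"
proof (rule finite_imageD)
  show "inj_on Poly_Mapping.lookup {\<alpha> :: 'n monomial. mdeg \<alpha> \<le> N}"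
    by (rule inj_onI) (rule poly_mapping_eqI, rule fun_cong)
  have "Poly_Mapping.lookup ` {\<alpha> :: 'n monomial. mdeg \<alpha> \<le> N} \<subseteq> UNIV \<rightarrow>\<^sub>E {..N}"
  proof (rule image_subsetI)
    fix \<alpha> :: "'n monomial" assume "\<alpha> \<in> {\<alpha>. mdeg \<alpha> \<le> N}"
    then have "Poly_Mapping.lookup \<alpha> i \<le> N" for i
      using lookup_le_mdeg[of \<alpha> i] by simp
    then show "Poly_Mapping.lookup \<alpha> \<in> UNIV \<rightarrow>\<^sub>E {..N}" by auto
  qed
  then show "finite (Poly_Mapping.lookup ` {\<alpha> :: 'n monomial. mdeg \<alpha> \<le> N})"
    by (rule finite_subset) (intro finite_PiE, auto)
qed

lemma finite_monomials_mdeg_eq: "finite {\<alpha> :: 'n::finite monomial. mdeg \<alpha> = N}"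
  by (rule finite_subset[OF _ finite_monomials_mdeg_le[of N]]) auto

text \<open>Membership in the \<open>m\<close>-th power of the maximal ideal at the origin,
  expressed on the support; the zero polynomial has every order.\<close>

definition ord_ge :: "nat \<Rightarrow> 'n::finite mpoly \<Rightarrow> bool" where
  "ord_ge m f \<longleftrightarrow> (\<forall>\<alpha>\<in>Poly_Mapping.keys f. m \<le> mdeg \<alpha>)"

lemma ord_geD: "ord_ge m f \<Longrightarrow> mdeg \<alpha> < m \<Longrightarrow> Poly_Mapping.lookup f \<alpha> = 0"
  by (force simp: ord_ge_def in_keys_iff)

lemma ord_ge_iff: "ord_ge m f \<longleftrightarrow> (\<forall>\<alpha>. mdeg \<alpha> < m \<longrightarrow> Poly_Mapping.lookup f \<alpha> = 0)"
  by (force simp: ord_ge_def in_keys_iff)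

lemma ord_ge_0 [simp]: "ord_ge m 0" "ord_ge 0 f"
  by (simp_all add: ord_ge_def)

lemma ord_ge_mono: "ord_ge m f \<Longrightarrow> k \<le> m \<Longrightarrow> ord_ge k f"
  by (force simp: ord_ge_def)

lemma ord_ge_single: "m \<le> mdeg \<alpha> \<Longrightarrow> ord_ge m (Poly_Mapping.single \<alpha> c)"
  by (auto simp: ord_ge_def)

lemma ord_ge_mvar: "ord_ge 1 (mvar i)"
  by (simp add: mvar_def ord_ge_single)

lemma ord_ge_add: "ord_ge m f \<Longrightarrow> ord_ge m g \<Longrightarrow> ord_ge m (f + g)"
  by (auto simp: ord_ge_iff lookup_add)

lemma ord_ge_diff: "ord_ge m f \<Longrightarrow> ord_ge m g \<Longrightarrow> ord_ge m (f - g)"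
  by (auto simp: ord_ge_iff lookup_minus)

lemma ord_ge_uminus: "ord_ge m f \<Longrightarrow> ord_ge m (- f)"
  by (auto simp: ord_ge_iff)

lemma ord_ge_sum: "(\<And>a. a \<in> A \<Longrightarrow> ord_ge m (f a)) \<Longrightarrow> ord_ge m (sum f A)"
  by (induction A rule: infinite_finite_induct) (auto intro: ord_ge_add)

lemma ord_ge_mult: "ord_ge m f \<Longrightarrow> ord_ge k g \<Longrightarrow> ord_ge (m + k) (f * g)"
  using keys_mult[of f g] by (fastforce simp: ord_ge_def intro: add_mono)

lemma ord_ge_mult_left: "ord_ge m g \<Longrightarrow> ord_ge m (f * g)"
  using ord_ge_mult[of 0 f m g] by simp

lemma ord_ge_power: "ord_ge 1 f \<Longrightarrow> ord_ge k (f ^ k)"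
  by (induction k) (auto dest: ord_ge_mult)

lemma meval_at_0: "meval f 0 = Poly_Mapping.lookup f 0" for f :: "'n::finite mpoly"
proof (induction f rule: poly_mapping_single_induct)
  case (single \<alpha> c)
  have "(\<Prod>i\<in>UNIV. (0 :: 'n cvec) $ i ^ Poly_Mapping.lookup \<alpha> i) = (if \<alpha> = 0 then 1 else 0)"
    by (auto simp: poly_mapping_eq_iff fun_eq_iff)
  then show ?case by (simp add: meval_single lookup_single when_def)
qed (simp add: lookup_add)

lemma ord_ge_1_iff: "ord_ge 1 f \<longleftrightarrow> meval f 0 = 0"
  by (auto simp: ord_ge_iff meval_at_0)

lemma ord_ge_2_iff: "ord_ge 2 f \<longleftrightarrow> meval f 0 = 0 \<and> (\<forall>j. lin_coeff f j = 0)"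
proof
  assume "meval f 0 = 0 \<and> (\<forall>j. lin_coeff f j = 0)"
  moreover have "mdeg \<alpha> < 2 \<Longrightarrow> \<alpha> = 0 \<or> (\<exists>j. \<alpha> = Poly_Mapping.single j 1)" for \<alpha> :: "'a monomial"
    by (metis less_2_cases mdeg_eq_0_iff One_nat_def mdeg_eq_1E)
  ultimately show "ord_ge 2 f"
    by (auto simp: ord_ge_iff meval_at_0 lin_coeff_def)
qed (auto simp: ord_ge_iff meval_at_0 lin_coeff_def)

lemma single_eq_single_1_iff:
  "Poly_Mapping.single i (1::nat) = Poly_Mapping.single j 1 \<longleftrightarrow> i = j"
  by (metis lookup_single_eq lookup_single_not_eq zero_neq_one)

lemma lin_coeff_add [simp]: "lin_coeff (f + g) j = lin_coeff f j + lin_coeff g j"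
  by (simp add: lin_coeff_def lookup_add)

lemma lin_coeff_diff [simp]: "lin_coeff (f - g) j = lin_coeff f j - lin_coeff g j"
  by (simp add: lin_coeff_def lookup_minus)

lemma lin_coeff_mconst [simp]: "lin_coeff (mconst c) j = 0" for j :: "'n::finite"
proof -
  have "Poly_Mapping.single j 1 \<noteq> (0 :: 'n monomial)" by (metis mdeg_0 mdeg_single zero_neq_one)
  then show ?thesis by (simp add: lin_coeff_def mconst_def lookup_single when_def)
qed

lemma lin_coeff_mvar [simp]: "lin_coeff (mvar i) j = (if i = j then 1 else 0)"
  unfolding lin_coeff_def mvar_def lookup_single single_eq_single_1_iff when_def ..

lemma lin_coeff_mconst_mult [simp]: "lin_coeff (mconst c * f) j = c * lin_coeff f j"
  by (simp add: lin_coeff_def)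

lemma lin_coeff_sum: "lin_coeff (sum f A) j = (\<Sum>a\<in>A. lin_coeff (f a) j)"
  by (simp add: lin_coeff_def lookup_sum)

text \<open>Leibniz rule at the origin: once the constant terms are subtracted, the product has
  order 2 and hence no linear coefficients.\<close>

lemma lin_coeff_mult: "lin_coeff (f * g) j = meval f 0 * lin_coeff g j + lin_coeff f j * meval g 0"
proof -
  define f' g' where "f' = f - mconst (meval f 0)" and "g' = g - mconst (meval g 0)"
  have "ord_ge 1 f'" "ord_ge 1 g'" unfolding ord_ge_1_iff by (simp_all add: f'_def g'_def)
  then have "ord_ge 2 (f' * g')" using ord_ge_mult[of 1 f' 1 g'] by (simp add: numeral_2_eq_2)
  then have 0: "lin_coeff (f' * g') j = 0" by (simp add: ord_ge_2_iff)
  have "f * g = f' * g' + mconst (meval f 0) * g + mconst (meval g 0) * f - mconst (meval f 0 * meval g 0)"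
    by (simp add: f'_def g'_def algebra_simps)
  then show ?thesis using 0 by simp
qed

section \<open>Multiplicity as the codimension of an ideal of polynomials\<close>

text \<open>Ideals without chosen generators, because contractions of local ideals and the auxiliary
  ideal \<open>K\<close> of the inflation argument are not given by generators.\<close>

definition is_ideal :: "'r::comm_ring_1 set \<Rightarrow> bool" where
  "is_ideal J \<longleftrightarrow> 0 \<in> J \<and> (\<forall>f\<in>J. \<forall>g\<in>J. f + g \<in> J) \<and> (\<forall>h. \<forall>f\<in>J. h * f \<in> J)"

lemma is_idealD:
  assumes "is_ideal J"
  shows "0 \<in> J" "f \<in> J \<Longrightarrow> g \<in> J \<Longrightarrow> f + g \<in> J" "f \<in> J \<Longrightarrow> h * f \<in> J"
    "f \<in> J \<Longrightarrow> - f \<in> J" "f \<in> J \<Longrightarrow> g \<in> J \<Longrightarrow> f - g \<in> J"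
proof -
  show 1: "0 \<in> J" "f \<in> J \<Longrightarrow> g \<in> J \<Longrightarrow> f + g \<in> J" "f \<in> J \<Longrightarrow> h * f \<in> J" for f g h
    using assms by (auto simp: is_ideal_def)
  show 2: "f \<in> J \<Longrightarrow> - f \<in> J" for f
    using 1(3)[of f "- 1"] by simp
  show "f \<in> J \<Longrightarrow> g \<in> J \<Longrightarrow> f - g \<in> J"
    using 1(2)[of f "- g"] 2[of g] by simp
qed

lemma is_ideal_sum:
  assumes "is_ideal J" "\<And>a. a \<in> A \<Longrightarrow> f a \<in> J"
  shows "sum f A \<in> J"
  using assms(2) by (induction A rule: infinite_finite_induct) (auto intro: is_idealD[OF assms(1)])

lemma is_ideal_ideal_gen: "is_ideal (ideal_gen UNIV F)"
  unfolding is_ideal_def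
proof (intro conjI ballI allI)
  show "0 \<in> ideal_gen UNIV F"
    by (auto simp: ideal_gen_def intro!: exI[of _ "\<lambda>_. 0"])
next
  fix f g assume "f \<in> ideal_gen UNIV F" "g \<in> ideal_gen UNIV F"
  then obtain r s where "f = (\<Sum>i\<in>UNIV. r i * F i)" "g = (\<Sum>i\<in>UNIV. s i * F i)"
    by (auto simp: ideal_gen_def)
  then have "f + g = (\<Sum>i\<in>UNIV. (r i + s i) * F i)" by (simp add: distrib_right sum.distrib)
  then show "f + g \<in> ideal_gen UNIV F" by (auto simp: ideal_gen_def)
next
  fix f h assume "f \<in> ideal_gen UNIV F"
  then obtain r where "f = (\<Sum>i\<in>UNIV. r i * F i)" by (auto simp: ideal_gen_def)
  then have "h * f = (\<Sum>i\<in>UNIV. (h * r i) * F i)" by (simp add: sum_distrib_left mult.assoc)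
  then show "h * f \<in> ideal_gen UNIV F" by (auto simp: ideal_gen_def)
qed

lemma generator_in_ideal_gen: "F i \<in> ideal_gen UNIV F"
proof -
  have "F i = (\<Sum>j\<in>UNIV. (if j = i then 1 else 0) * F j)"
    by (simp add: if_distrib[of "\<lambda>a. a * _"] cong: if_cong)
  then show ?thesis
    unfolding ideal_gen_def by (intro CollectI exI[of _ "\<lambda>j. if j = i then 1 else 0"]) auto
qed

text \<open>The contraction to the polynomial ring of the ideal generated by \<open>F\<close> in the local ring at \<open>z\<close>.\<close>

definition local_ideal :: "'n::finite system \<Rightarrow> 'n cvec \<Rightarrow> 'n mpoly set" where
  "local_ideal F z = {f. \<exists>u. meval u z \<noteq> 0 \<and> u * f \<in> ideal_gen UNIV (\<lambda>i. F $ i)}"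

lemma local_idealI: "meval u z \<noteq> 0 \<Longrightarrow> u * f \<in> ideal_gen UNIV (\<lambda>i. F $ i) \<Longrightarrow> f \<in> local_ideal F z"
  by (auto simp: local_ideal_def)

lemma local_idealE:
  assumes "f \<in> local_ideal F z"
  obtains u where "meval u z \<noteq> 0" "u * f \<in> ideal_gen UNIV (\<lambda>i. F $ i)"
  using assms by (auto simp: local_ideal_def)

lemma ideal_gen_subset_local_ideal: "f \<in> ideal_gen UNIV (\<lambda>i. F $ i) \<Longrightarrow> f \<in> local_ideal F z"
  by (rule local_idealI[of 1]) auto

lemma is_ideal_local_ideal: "is_ideal (local_ideal F z)"
  unfolding is_ideal_def
proof (intro conjI ballI allI)
  note I = is_idealD[OF is_ideal_ideal_gen[of "\<lambda>i. F $ i"]]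
  show "0 \<in> local_ideal F z" by (rule ideal_gen_subset_local_ideal[OF I(1)])
  show "f + g \<in> local_ideal F z" if "f \<in> local_ideal F z" "g \<in> local_ideal F z" for f g
  proof -
    obtain u v where u: "meval u z \<noteq> 0" "u * f \<in> ideal_gen UNIV (\<lambda>i. F $ i)"
      and v: "meval v z \<noteq> 0" "v * g \<in> ideal_gen UNIV (\<lambda>i. F $ i)"
      using \<open>f \<in> _\<close> \<open>g \<in> _\<close> by (auto elim!: local_idealE)
    have "(u * v) * (f + g) = v * (u * f) + u * (v * g)" by (simp add: algebra_simps)
    also have "\<dots> \<in> ideal_gen UNIV (\<lambda>i. F $ i)" by (intro I u v)
    finally show ?thesis using u v by (intro local_idealI[of "u * v"]) auto
  qed
  show "h * f \<in> local_ideal F z" if "f \<in> local_ideal F z" for h f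
  proof -
    obtain u where u: "meval u z \<noteq> 0" "u * f \<in> ideal_gen UNIV (\<lambda>i. F $ i)"
      using \<open>f \<in> _\<close> by (rule local_idealE)
    have "u * (h * f) = h * (u * f)" by (simp add: algebra_simps)
    also have "\<dots> \<in> ideal_gen UNIV (\<lambda>i. F $ i)" by (intro I u)
    finally show ?thesis using u by (intro local_idealI[of u]) auto
  qed
qed

text \<open>Lets units at \<open>z\<close> be cancelled without leaving the polynomial ring; in this
  form locality enters Nakayama's lemma and \<open>power_in_local_ideal\<close>.\<close>

lemma local_ideal_unit:
  assumes "meval v z \<noteq> 0" "v * f \<in> local_ideal F z"
  shows "f \<in> local_ideal F z"
proof -
  obtain u where "meval u z \<noteq> 0" "u * (v * f) \<in> ideal_gen UNIV (\<lambda>i. F $ i)"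
    using assms(2) by (rule local_idealE)
  then show ?thesis using assms(1) by (intro local_idealI[of "u * v"]) (auto simp: mult.assoc)
qed

text \<open>The classes of the polynomials \<open>e x\<close> form a basis of the local algebra. The
  indexed form lets substitutions and product index sets act on \<open>e\<close> with no injectivity
  to check; representatives without denominators suffice because finitely many germs have a common
  unit as denominator, which can be cleared.\<close>

definition local_basis :: "'n::finite system \<Rightarrow> 'n cvec \<Rightarrow> 'a set \<Rightarrow> ('a \<Rightarrow> 'n mpoly) \<Rightarrow> bool" where
  "local_basis F z X e \<longleftrightarrow> finite X \<and>
     (\<forall>c. (\<Sum>x\<in>X. mconst (c x) * e x) \<in> local_ideal F z \<longrightarrow> (\<forall>x\<in>X. c x = 0)) \<and>
     (\<forall>f. \<exists>c. f - (\<Sum>x\<in>X. mconst (c x) * e x) \<in> local_ideal F z)"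

interpretation mpoly_vs: vector_space "\<lambda>c (f :: 'n mpoly). mconst c * f"
  by unfold_locales (auto simp: algebra_simps)

text \<open>A dimension bound without a quotient space: each \<open>p b\<close> is replaced by its
  representative in the span of \<open>e\<close>, which differs from it by an element of
  \<open>J\<close>, so independence modulo \<open>J\<close> becomes linear independence of
  polynomials.\<close>

lemma card_le_if_independent_mod:
  fixes J :: "'n::finite mpoly set" and p :: "'b \<Rightarrow> 'n mpoly"
  assumes J: "is_ideal J" and fin: "finite X" "finite B"
    and span: "\<And>b. b \<in> B \<Longrightarrow> p b - (\<Sum>x\<in>X. mconst (a b x) * e x) \<in> J"
    and indep: "\<And>c. (\<Sum>b\<in>B. mconst (c b) * p b) \<in> J \<Longrightarrow> \<forall>b\<in>B. c b = 0"
  shows "card B \<le> card X"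
proof -
  define s where "s b = (\<Sum>x\<in>X. mconst (a b x) * e x)" for b
  have indep': "\<forall>b\<in>B. c b = 0" if c: "(\<Sum>b\<in>B. mconst (c b) * s b) = 0" for c
  proof (rule indep)
    have "(\<Sum>b\<in>B. mconst (c b) * p b) =
        (\<Sum>b\<in>B. mconst (c b) * (p b - s b)) + (\<Sum>b\<in>B. mconst (c b) * s b)"
      by (simp add: sum.distrib[symmetric] algebra_simps)
    also have "\<dots> = (\<Sum>b\<in>B. mconst (c b) * (p b - s b))" by (simp add: c)
    also have "\<dots> \<in> J" using span by (intro is_ideal_sum[OF J] is_idealD(3)[OF J]) (auto simp: s_def)
    finally show "(\<Sum>b\<in>B. mconst (c b) * p b) \<in> J" .
  qed
  have inj: "inj_on s B"
  proof (rule inj_onI, rule ccontr)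
    fix b b' assume b: "b \<in> B" "b' \<in> B" "s b = s b'" "b \<noteq> b'"
    \<comment> \<open>Two indices with the same representative would give a relation with
      coefficients 1 and -1.\<close>
    define c :: "'b \<Rightarrow> complex" where "c x = (if x = b then 1 else 0) - (if x = b' then 1 else 0)" for x
    have "(\<Sum>x\<in>B. mconst (c x) * s x) = (\<Sum>x\<in>B. (if x = b then s x else 0) - (if x = b' then s x else 0))"
      by (rule sum.cong) (auto simp: c_def)
    also have "\<dots> = 0" using b fin by (simp add: sum_subtractf)
    finally have "c b = 0" using indep' b by blast
    then show False using b by (simp add: c_def)
  qed
  have "mpoly_vs.independent (s ` B)"
  proof -
    have "u v = 0" if u: "(\<Sum>v\<in>s ` B. mconst (u v) * v) = 0" and v: "v \<in> s ` B" for u v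
    proof -
      have "(\<Sum>b\<in>B. mconst (u (s b)) * s b) = 0" using u by (simp add: sum.reindex[OF inj])
      from indep'[OF this] v show ?thesis by auto
    qed
    then show ?thesis using fin by (auto simp: mpoly_vs.dependent_finite)
  qed
  moreover have "s ` B \<subseteq> mpoly_vs.span (e ` X)"
    unfolding s_def
    by (intro image_subsetI mpoly_vs.span_sum mpoly_vs.span_scale) (auto intro: mpoly_vs.span_base)
  ultimately have "card (s ` B) \<le> card (e ` X)"
    using mpoly_vs.independent_span_bound[of "e ` X" "s ` B"] fin by auto
  also have "\<dots> \<le> card X" using fin by (simp add: card_image_le)
  finally show ?thesis by (simp add: card_image[OF inj])
qed

section \<open>Comparison with the multiplicity defined in the fraction field\<close>

abbreviation ratf :: "'n::{finite,linorder} mpoly \<Rightarrow> 'n mpoly fract" where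
  "ratf f \<equiv> Fract f 1"

lemma ratf_hom: "ratf (f + g) = ratf f + ratf g" "ratf (f * g) = ratf f * ratf g" "ratf 0 = 0" "ratf 1 = 1"
  by (simp_all add: Zero_fract_def One_fract_def)

lemma ratf_sum: "ratf (sum f A) = (\<Sum>a\<in>A. ratf (f a))"
  by (induction A rule: infinite_finite_induct) (simp_all add: ratf_hom del: add_fract)

lemma ratf_eq_iff: "ratf f = ratf g \<longleftrightarrow> f = g"
  by (simp add: eq_fract)

lemma meval_nonzero_imp: "meval u z \<noteq> 0 \<Longrightarrow> u \<noteq> 0"
  by auto

lemma local_ringI: "meval u z \<noteq> 0 \<Longrightarrow> ratf f / ratf u \<in> local_ring z"
  unfolding local_ring_def by (intro CollectI exI[of _ f] exI[of _ u]) simp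

text \<open>Puts finitely many germs over one denominator that is a unit at \<open>z\<close>, so
  that relations between fractions become relations between polynomials.\<close>

lemma common_denominator:
  assumes "finite B" "B \<subseteq> local_ring z"
  shows "\<exists>u p. meval u z \<noteq> 0 \<and> (\<forall>b\<in>B. b = ratf (p b) / ratf u)"
  using assms
proof (induction B rule: finite_induct)
  case empty
  then show ?case by (intro exI[of _ 1]) auto
next
  case (insert b B)
  then obtain u p where u: "meval u z \<noteq> 0" "\<forall>b\<in>B. b = ratf (p b) / ratf u" by auto
  from insert obtain f g where fg: "meval g z \<noteq> 0" "b = Fract f g" by (auto simp: local_ring_def)
  have nz: "u \<noteq> 0" "g \<noteq> 0" using u fg by (auto dest: meval_nonzero_imp)
  show ?case
  proof (intro exI conjI ballI)
    show "meval (g * u) z \<noteq> 0" using u fg by simp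
    fix x assume "x \<in> insert b B"
    then show "x = ratf (if x = b then f * u else g * p x) / ratf (g * u)"
    proof (cases "x = b")
      case True
      have "Fract f g = Fract (u * f) (u * g)" using mult_fract_cancel[of u f g] nz by simp
      with True fg(2) show ?thesis by (simp add: mult.commute)
    next
      case False
      with \<open>x \<in> insert b B\<close> u(2) have "x = ratf (p x) / ratf u" by auto
      also have "\<dots> = ratf (g * p x) / ratf (g * u)"
        using mult_fract_cancel[of g "p x" u] nz by simp
      finally show ?thesis using False by simp
    qed
  qed
qed

text \<open>Identifies \<open>local_ideal\<close> as the contraction of the ideal used by
  \<open>zero_mult\<close>: a common denominator of the coefficients is the multiplier, and
  conversely division by the multiplier gives the coefficients.\<close>

lemma ratf_in_ideal_gen_iff:
  "ratf f \<in> ideal_gen (local_ring z) (\<lambda>i. ratf (F $ i)) \<longleftrightarrow> f \<in> local_ideal F z"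
proof
  assume "ratf f \<in> ideal_gen (local_ring z) (\<lambda>i. ratf (F $ i))"
  then obtain r where r: "ratf f = (\<Sum>i\<in>UNIV. r i * ratf (F $ i))" "\<And>i. r i \<in> local_ring z"
    by (auto simp: ideal_gen_def)
  have "finite (range r)" "range r \<subseteq> local_ring z" using r(2) by auto
  then obtain u p where u: "meval u z \<noteq> 0" "\<forall>b\<in>range r. b = ratf (p b) / ratf u"
    using common_denominator by blast
  have "ratf u \<noteq> 0"
    using u(1) by (auto simp: ratf_eq_iff dest: meval_nonzero_imp simp flip: ratf_hom(3))
  moreover have "r i = ratf (p (r i)) / ratf u" for i using u(2) by blast
  then have "ratf f = (\<Sum>i\<in>UNIV. ratf (p (r i)) / ratf u * ratf (F $ i))"
    unfolding r(1) by (intro sum.cong refl arg_cong[where f = "\<lambda>y. y * _"])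
  ultimately have "ratf u * ratf f = (\<Sum>i\<in>UNIV. ratf (p (r i)) * ratf (F $ i))"
    by (simp add: sum_distrib_left del: divide_fract mult_fract)
  then have "u * f = (\<Sum>i\<in>UNIV. p (r i) * F $ i)"
    by (simp only: ratf_hom(2)[symmetric] ratf_sum[symmetric] ratf_eq_iff)
  then show "f \<in> local_ideal F z"
    using u(1) by (intro local_idealI[of u]) (auto simp: ideal_gen_def)
next
  assume "f \<in> local_ideal F z"
  then obtain u a where u: "meval u z \<noteq> 0" "u * f = (\<Sum>i\<in>UNIV. a i * F $ i)"
    by (auto simp: ideal_gen_def elim!: local_idealE)
  have "ratf u \<noteq> 0"
    using u(1) by (auto simp: ratf_eq_iff dest: meval_nonzero_imp simp flip: ratf_hom(3))
  moreover have "ratf u * ratf f = (\<Sum>i\<in>UNIV. ratf (a i) * ratf (F $ i))"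
    using arg_cong[OF u(2), of ratf] by (simp only: ratf_hom ratf_sum)
  ultimately have "ratf f = (\<Sum>i\<in>UNIV. ratf (a i) * ratf (F $ i)) / ratf u"
    by (simp add: field_simps del: mult_fract)
  then have "ratf f = (\<Sum>i\<in>UNIV. (ratf (a i) / ratf u) * ratf (F $ i))"
    by (simp add: sum_divide_distrib del: mult_fract divide_fract)
  moreover have "\<forall>i. ratf (a i) / ratf u \<in> local_ring z" using u(1) by (auto intro: local_ringI simp del: divide_fract)
  ultimately show "ratf f \<in> ideal_gen (local_ring z) (\<lambda>i. ratf (F $ i))"
    unfolding ideal_gen_def by (intro CollectI exI[of _ "\<lambda>i. ratf (a i) / ratf u"] conjI)
qed

lemma card_le_zero_mult:
  fixes X :: "'a set"
  assumes "finite X" and indep: "\<And>c. (\<Sum>x\<in>X. mconst (c x) * e x) \<in> local_ideal F z \<Longrightarrow> \<forall>x\<in>X. c x = 0"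
  shows "enat (card X) \<le> zero_mult F z"
proof -
  \<comment> \<open>\<open>zero_mult\<close> is a supremum over sets, so distinct indices must give
    distinct germs; equal germs would violate independence.\<close>
  have inj: "inj_on (\<lambda>x. ratf (e x)) X"
  proof (rule inj_onI, rule ccontr)
    fix x y assume *: "x \<in> X" "y \<in> X" "ratf (e x) = ratf (e y)" "x \<noteq> y"
    define c :: "'a \<Rightarrow> complex" where "c w = (if w = x then 1 else 0) - (if w = y then 1 else 0)" for w
    have "(\<Sum>w\<in>X. mconst (c w) * e w) = (\<Sum>w\<in>X. (if w = x then e w else 0) - (if w = y then e w else 0))"
      by (rule sum.cong) (auto simp: c_def)
    also have "\<dots> = 0" using * assms(1) by (simp add: sum_subtractf ratf_eq_iff)
    also have "\<dots> \<in> local_ideal F z" by (rule is_idealD[OF is_ideal_local_ideal])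
    finally have "c x = 0" using indep * by blast
    then show False using * by (simp add: c_def)
  qed
  let ?B = "(\<lambda>x. ratf (e x)) ` X"
  have "lin_indep_mod (ideal_gen (local_ring z) (\<lambda>i. ratf (F $ i))) ?B"
    unfolding lin_indep_mod_def
  proof (intro allI impI)
    fix c assume "(\<Sum>b\<in>?B. ratf (mconst (c b)) * b) \<in> ideal_gen (local_ring z) (\<lambda>i. ratf (F $ i))"
    then have "ratf (\<Sum>x\<in>X. mconst (c (ratf (e x))) * e x) \<in> ideal_gen (local_ring z) (\<lambda>i. ratf (F $ i))"
      by (simp only: sum.reindex[OF inj] o_def ratf_hom ratf_sum)
    then show "\<forall>b\<in>?B. c b = 0" unfolding ratf_in_ideal_gen_iff using indep[of "\<lambda>x. c (ratf (e x))"] by simp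
  qed
  moreover have "?B \<subseteq> local_ring z"
    using local_ringI[of 1 z] by (force simp: ratf_hom(4) simp del: divide_fract)
  ultimately have "enat (card ?B) \<le> zero_mult F z"
    unfolding zero_mult_def using assms(1) by (intro SUP_upper) auto
  then show ?thesis by (simp add: card_image[OF inj])
qed

text \<open>For the upper bound, multiplying an independent set of germs by a common unit keeps it
  independent, which leaves polynomials independent modulo \<open>local_ideal\<close>, and those
  cannot outnumber a basis.\<close>

theorem zero_mult_eq_card:
  assumes "local_basis F z X e"
  shows "zero_mult F z = enat (card X)"
proof (rule antisym)
  show "enat (card X) \<le> zero_mult F z"
    using assms by (intro card_le_zero_mult[where e = e]) (auto simp: local_basis_def)
  show "zero_mult F z \<le> enat (card X)"
    unfolding zero_mult_def
  proof (rule SUP_least, safe)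
    let ?I = "ideal_gen (local_ring z) (\<lambda>i. ratf (F $ i))"
    fix B assume B: "finite B" "B \<subseteq> local_ring z" and indep: "lin_indep_mod ?I B"
    obtain u p where u: "meval u z \<noteq> 0" "\<forall>b\<in>B. b = ratf (p b) / ratf u"
      using common_denominator[OF B] by auto
    obtain a where a: "\<And>f. f - (\<Sum>x\<in>X. mconst (a f x) * e x) \<in> local_ideal F z"
      using assms unfolding local_basis_def by metis
    have "card B \<le> card X"
    proof (rule card_le_if_independent_mod[OF is_ideal_local_ideal _ B(1) a])
      show "finite X" using assms by (simp add: local_basis_def)
      fix c assume "(\<Sum>b\<in>B. mconst (c b) * p b) \<in> local_ideal F z"
      then have "ratf (\<Sum>b\<in>B. mconst (c b) * p b) \<in> ?I" by (simp add: ratf_in_ideal_gen_iff)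
      then obtain r where r: "\<forall>i. r i \<in> local_ring z"
        "ratf (\<Sum>b\<in>B. mconst (c b) * p b) = (\<Sum>i\<in>UNIV. r i * ratf (F $ i))"
        unfolding ideal_gen_def by auto
      have "(\<Sum>b\<in>B. ratf (mconst (c b)) * b) = (\<Sum>b\<in>B. ratf (mconst (c b)) * (ratf (p b) / ratf u))"
        using u(2) by (intro sum.cong refl arg_cong[where f = "\<lambda>y. _ * y"]) blast
      also have "\<dots> = ratf (\<Sum>b\<in>B. mconst (c b) * p b) / ratf u"
        by (simp only: ratf_sum ratf_hom sum_divide_distrib times_divide_eq_right)
      also have "\<dots> = (\<Sum>i\<in>UNIV. r i / ratf u * ratf (F $ i))"
        unfolding r(2) by (simp only: sum_divide_distrib times_divide_eq_left)
      finally have *: "(\<Sum>b\<in>B. ratf (mconst (c b)) * b) = (\<Sum>i\<in>UNIV. r i / ratf u * ratf (F $ i))" .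
      have "r i / ratf u \<in> local_ring z" for i
      proof -
        obtain f g where fg: "meval g z \<noteq> 0" "r i = Fract f g"
          using r(1) unfolding local_ring_def by blast
        then have "r i / ratf u = Fract f (g * u)" by simp
        then show ?thesis unfolding local_ring_def using fg u by (intro CollectI exI[of _ f] exI[of _ "g * u"]) auto
      qed
      then have "(\<Sum>b\<in>B. ratf (mconst (c b)) * b) \<in> ?I"
        unfolding * ideal_gen_def by (intro CollectI exI[of _ "\<lambda>i. r i / ratf u"]) auto
      with indep show "\<forall>b\<in>B. c b = 0" by (simp add: lin_indep_mod_def)
    qed
    then show "enat (card B) \<le> enat (card X)" by simp
  qed
qed

text \<open>The class of 1 is nonzero, since a multiplier that puts a nonzero constant into the
  ideal would have to vanish at \<open>z\<close>. This bound lets a count of zeros exclude further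
  zeros.\<close>

lemma zero_mult_ge_1:
  assumes "z \<in> zeros F"
  shows "1 \<le> zero_mult F z"
proof -
  have "enat (card {()}) \<le> zero_mult F z"
  proof (rule card_le_zero_mult[where e = "\<lambda>_. 1"])
    fix c assume "(\<Sum>x\<in>{()}. mconst (c x) * 1) \<in> local_ideal F z"
    then obtain u r where u: "meval u z \<noteq> 0" "u * mconst (c ()) = (\<Sum>i\<in>UNIV. r i * F $ i)"
      by (auto simp: ideal_gen_def elim!: local_idealE)
    have "meval (F $ i) z = 0" for i
      using assms by (metis sys_eval_nth zeros_def mem_Collect_eq zero_index)
    then have "meval u z * c () = 0" using arg_cong[OF u(2), of "\<lambda>f. meval f z"] by (simp add: meval_sum)
    then show "\<forall>x\<in>{()}. c x = 0" using u(1) by simp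
  qed simp
  then show ?thesis by (simp add: one_enat_def)
qed

text \<open>A multiplier at the image point pulls back to a multiplier at \<open>w\<close>. As
  \<open>Q\<close> need not be invertible, this also serves the inflation map.\<close>

lemma local_ideal_msubst:
  assumes "f \<in> local_ideal F (sys_eval Q w)"
  shows "msubst f Q \<in> local_ideal (F \<circ>\<^sub>s Q) w"
proof -
  obtain u r where u: "meval u (sys_eval Q w) \<noteq> 0" "u * f = (\<Sum>i\<in>UNIV. r i * F $ i)"
    using assms by (auto simp: ideal_gen_def elim!: local_idealE)
  have "msubst u Q * msubst f Q = (\<Sum>i\<in>UNIV. msubst (r i) Q * (F \<circ>\<^sub>s Q) $ i)"
    using arg_cong[OF u(2), of "\<lambda>f. msubst f Q"] by (simp add: msubst_sum)
  then show ?thesis using u(1) by (intro local_idealI[of "msubst u Q"]) (auto simp: ideal_gen_def)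
qed

lemma local_basis_msubst:
  assumes Q: "Q \<circ>\<^sub>s Q' = (\<chi> i. mvar i)" "Q' \<circ>\<^sub>s Q = (\<chi> i. mvar i)"
    and basis: "local_basis F (sys_eval Q w) X e"
  shows "local_basis (F \<circ>\<^sub>s Q) w X (\<lambda>x. msubst (e x) Q)"
proof -
  have inv: "msubst (msubst f Q) Q' = f" "msubst (msubst f Q') Q = f" for f
    by (simp_all add: msubst_msubst Q)
  have w: "sys_eval Q' (sys_eval Q w) = w"
    by (simp add: sys_eval_comp[symmetric] Q) (simp add: vec_eq_iff)
  \<comment> \<open>Pulling back along \<open>Q\<close> and along its inverse gives the two
    directions.\<close>
  have *: "f \<in> local_ideal (F \<circ>\<^sub>s Q) w \<longleftrightarrow> msubst f Q' \<in> local_ideal F (sys_eval Q w)" for f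
    using local_ideal_msubst[of "msubst f Q'" F Q w]
      local_ideal_msubst[of f "F \<circ>\<^sub>s Q" Q' "sys_eval Q w"]
    by (auto simp: inv w sys_comp_assoc Q)
  show ?thesis
    unfolding local_basis_def
  proof (intro conjI allI impI)
    show "finite X" using basis by (simp add: local_basis_def)
    fix c assume "(\<Sum>x\<in>X. mconst (c x) * msubst (e x) Q) \<in> local_ideal (F \<circ>\<^sub>s Q) w"
    then have "(\<Sum>x\<in>X. mconst (c x) * e x) \<in> local_ideal F (sys_eval Q w)"
      by (simp add: * msubst_sum inv)
    then show "\<forall>x\<in>X. c x = 0" using basis by (simp add: local_basis_def)
  next
    fix f
    obtain c where "msubst f Q' - (\<Sum>x\<in>X. mconst (c x) * e x) \<in> local_ideal F (sys_eval Q w)"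
      using basis unfolding local_basis_def by blast
    then show "\<exists>c. f - (\<Sum>x\<in>X. mconst (c x) * msubst (e x) Q) \<in> local_ideal (F \<circ>\<^sub>s Q) w"
      by (auto simp: * msubst_sum inv)
  qed
qed

lemma ideal_gen_matrix_subset:
  fixes C :: "'r::comm_ring_1 ^ 'n::finite ^ 'n"
  shows "ideal_gen UNIV (\<lambda>i. (C *v F) $ i) \<subseteq> ideal_gen UNIV (\<lambda>i. F $ i)"
proof
  fix f assume "f \<in> ideal_gen UNIV (\<lambda>i. (C *v F) $ i)"
  then obtain r where "f = (\<Sum>i\<in>UNIV. r i * (\<Sum>j\<in>UNIV. C $ i $ j * F $ j))"
    by (auto simp: ideal_gen_def matrix_vector_mult_def)
  also have "\<dots> \<in> ideal_gen UNIV (\<lambda>i. F $ i)"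
    using generator_in_ideal_gen[of "\<lambda>i. F $ i"]
    by (intro is_ideal_sum[OF is_ideal_ideal_gen] is_idealD[OF is_ideal_ideal_gen])
  finally show "f \<in> ideal_gen UNIV (\<lambda>i. F $ i)" .
qed

lemma local_ideal_matrix:
  assumes "invertible C"
  shows "local_ideal (C *v F) z = local_ideal F z"
proof -
  obtain C' where "C' ** C = mat 1" using assms by (auto simp: invertible_def)
  then have "C' *v (C *v F) = F" by (simp add: matrix_vector_mul_assoc)
  then have "ideal_gen UNIV (\<lambda>i. (C *v F) $ i) = ideal_gen UNIV (\<lambda>i. F $ i)"
    using ideal_gen_matrix_subset[of C F] ideal_gen_matrix_subset[of C' "C *v F"] by auto
  then show ?thesis by (simp add: local_ideal_def)
qed

section \<open>Inflation\<close>

text \<open>In a local algebra of dimension \<open>card X\<close> the powers of \<open>t\<close>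
  from 0 to \<open>card X\<close> are dependent. Splitting off the lowest power with a nonzero
  coefficient leaves a unit at \<open>z\<close>, so that power lies in the ideal.\<close>

lemma power_in_local_ideal:
  assumes basis: "local_basis F z X e" and t: "meval t z = 0"
  shows "t ^ card X \<in> local_ideal F z"
proof -
  let ?J = "local_ideal F z"
  note J = is_idealD[OF is_ideal_local_ideal[of F z]]
  obtain a where a: "\<And>f. f - (\<Sum>x\<in>X. mconst (a f x) * e x) \<in> ?J"
    using basis unfolding local_basis_def by metis
  have "\<exists>c. (\<Sum>k\<le>card X. mconst (c k) * t ^ k) \<in> ?J \<and> (\<exists>k\<le>card X. c k \<noteq> 0)"
  proof (rule ccontr)
    assume *: "\<not> ?thesis"
    have "card {..card X} \<le> card X"
    proof (rule card_le_if_independent_mod[OF is_ideal_local_ideal _ _ a])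
      show "finite X" using basis by (simp add: local_basis_def)
      show "\<forall>k\<in>{..card X}. c k = 0" if "(\<Sum>k\<le>card X. mconst (c k) * t ^ k) \<in> ?J" for c
        using * that by blast
    qed auto
    then show False by simp
  qed
  then obtain c k where c: "(\<Sum>k\<le>card X. mconst (c k) * t ^ k) \<in> ?J" and k: "k \<le> card X" "c k \<noteq> 0"
    by blast
  \<comment> \<open>The lowest exponent in the relation; the cofactor \<open>u\<close> of
    \<open>t ^ m\<close> takes the value \<open>c m\<close> at \<open>z\<close>.\<close>
  define m where "m = (LEAST k. c k \<noteq> 0)"
  have m: "c m \<noteq> 0" "m \<le> card X" and less: "\<And>j. j < m \<Longrightarrow> c j = 0"
    using k LeastI[of "\<lambda>k. c k \<noteq> 0" k] Least_le[of "\<lambda>k. c k \<noteq> 0" k] not_less_Least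
    by (auto simp: m_def)
  define u where "u = (\<Sum>j\<in>{m..card X}. mconst (c j) * t ^ (j - m))"
  have "(\<Sum>k\<le>card X. mconst (c k) * t ^ k) = (\<Sum>j\<in>{m..card X}. mconst (c j) * t ^ j)"
    using less by (intro sum.mono_neutral_right) (auto simp: not_le)
  also have "\<dots> = u * t ^ m"
    unfolding u_def sum_distrib_right
    by (intro sum.cong refl) (simp add: mult.assoc flip: power_add)
  finally have "u * t ^ m \<in> ?J" using c by simp
  moreover have "meval u z = (\<Sum>j\<in>{m..card X}. if j = m then c j else 0)"
    unfolding u_def meval_sum by (intro sum.cong refl) (auto simp: t)
  then have "meval u z \<noteq> 0" using m by simp
  ultimately have "t ^ m \<in> ?J" by (rule local_ideal_unit[rotated])
  then have "t ^ (card X - m) * t ^ m \<in> ?J" by (rule J)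
  then show ?thesis using m(2) by (simp flip: power_add)
qed

lemma mvar_dvd_single:
  assumes "k \<le> Poly_Mapping.lookup \<alpha> i"
  obtains \<beta> where "Poly_Mapping.single \<alpha> 1 = Poly_Mapping.single \<beta> 1 * mvar i ^ k"
proof
  have "\<alpha> = (\<alpha> - Poly_Mapping.single i k) + Poly_Mapping.single i k"
    by (rule poly_mapping_eqI) (use assms in \<open>auto simp: lookup_add lookup_minus lookup_single when_def\<close>)
  then show "Poly_Mapping.single \<alpha> 1 =
      Poly_Mapping.single (\<alpha> - Poly_Mapping.single i k) 1 * mvar i ^ k"
    by (simp add: mvar_power mult_single)
qed

text \<open>By the pigeonhole principle some variable has exponent at least \<open>card X\<close>,
  and that power of the variable is already in the ideal.\<close>

lemma monomial_in_local_ideal: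
  fixes F :: "'n::finite system"
  assumes basis: "local_basis F 0 X e" and \<alpha>: "CARD('n) * card X \<le> mdeg \<alpha>"
  shows "Poly_Mapping.single \<alpha> 1 \<in> local_ideal F 0"
proof -
  have "\<exists>i. card X \<le> Poly_Mapping.lookup \<alpha> i"
  proof (rule ccontr)
    assume "\<not> ?thesis"
    then have "mdeg \<alpha> < (\<Sum>i\<in>(UNIV :: 'n set). card X)"
      unfolding mdeg_def by (intro sum_strict_mono) (auto simp: not_le)
    then show False using \<alpha> by simp
  qed
  then obtain i where i: "card X \<le> Poly_Mapping.lookup \<alpha> i" ..
  then obtain \<beta> where "Poly_Mapping.single \<alpha> 1 = Poly_Mapping.single \<beta> 1 * mvar i ^ card X"
    by (rule mvar_dvd_single)
  moreover have "mvar i ^ card X \<in> local_ideal F 0"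
    by (rule power_in_local_ideal[OF basis]) simp
  ultimately show ?thesis by (simp add: is_idealD[OF is_ideal_local_ideal])
qed

section \<open>Division with remainder by \<open>d\<close> of the exponents outside
  \<open>U\<close>\<close>

definition dilate :: "'n::finite set \<Rightarrow> nat \<Rightarrow> 'n monomial \<Rightarrow> 'n monomial" where
  "dilate U d \<alpha> = Abs_poly_mapping (\<lambda>i. if i \<in> U then Poly_Mapping.lookup \<alpha> i else d * Poly_Mapping.lookup \<alpha> i)"

definition quo :: "'n::finite set \<Rightarrow> nat \<Rightarrow> 'n monomial \<Rightarrow> 'n monomial" where
  "quo U d \<alpha> = Abs_poly_mapping (\<lambda>i. if i \<in> U then Poly_Mapping.lookup \<alpha> i else Poly_Mapping.lookup \<alpha> i div d)"

definition remn :: "'n::finite set \<Rightarrow> nat \<Rightarrow> 'n monomial \<Rightarrow> 'n monomial" where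
  "remn U d \<alpha> = Abs_poly_mapping (\<lambda>i. if i \<in> U then 0 else Poly_Mapping.lookup \<alpha> i mod d)"

definition remainders :: "'n::finite set \<Rightarrow> nat \<Rightarrow> 'n monomial set" where
  "remainders U d = {\<beta>. \<forall>i. if i \<in> U then Poly_Mapping.lookup \<beta> i = 0 else Poly_Mapping.lookup \<beta> i < d}"

lemma lookup_Abs_finite: "Poly_Mapping.lookup (Abs_poly_mapping f) i = f i" for i :: "'n::finite"
  by (subst lookup_Abs_poly_mapping) auto

lemmas lookup_division =
  dilate_def[THEN arg_cong[where f = Poly_Mapping.lookup], THEN fun_cong, unfolded lookup_Abs_finite]
  quo_def[THEN arg_cong[where f = Poly_Mapping.lookup], THEN fun_cong, unfolded lookup_Abs_finite]
  remn_def[THEN arg_cong[where f = Poly_Mapping.lookup], THEN fun_cong, unfolded lookup_Abs_finite]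

lemma division_monomial: "remn U d \<gamma> + dilate U d (quo U d \<gamma>) = \<gamma>"
  by (rule poly_mapping_eqI) (simp add: lookup_add lookup_division)

lemma quo_dilate_add: "d > 0 \<Longrightarrow> quo U d (dilate U d \<alpha> + \<gamma>) = \<alpha> + quo U d \<gamma>"
  by (rule poly_mapping_eqI) (simp add: lookup_add lookup_division)

lemma remn_dilate_add: "remn U d (dilate U d \<alpha> + \<gamma>) = remn U d \<gamma>"
  by (rule poly_mapping_eqI) (simp add: lookup_add lookup_division)

lemma remn_in_remainders: "d > 0 \<Longrightarrow> remn U d \<gamma> \<in> remainders U d"
  by (simp add: remainders_def lookup_division)

lemma remainders_self:
  assumes "\<beta> \<in> remainders U d"
  shows "remn U d \<beta> = \<beta>" "quo U d \<beta> = 0"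
  using assms
  by (auto simp: remainders_def lookup_division intro!: poly_mapping_eqI split: if_splits)

text \<open>A crude bound to be read backwards: large degree forces a quotient of large degree. It
  holds exponent by exponent, also for the undivided ones in \<open>U\<close>.\<close>

lemma mdeg_le_quo:
  fixes \<gamma> :: "'n::finite monomial"
  assumes "d > 0"
  shows "mdeg \<gamma> \<le> CARD('n) * d + d * mdeg (quo U d \<gamma>)"
proof -
  have "Poly_Mapping.lookup \<gamma> i \<le> d + d * Poly_Mapping.lookup (quo U d \<gamma>) i" for i
  proof -
    have "Poly_Mapping.lookup \<gamma> i \<le> d * Poly_Mapping.lookup \<gamma> i" using assms by simp
    moreover have "Poly_Mapping.lookup \<gamma> i mod d \<le> d" using assms by (simp add: less_imp_le)
    then have "Poly_Mapping.lookup \<gamma> i \<le> d + d * (Poly_Mapping.lookup \<gamma> i div d)"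
      by (metis add_le_mono1 mod_mult_div_eq)
    ultimately show ?thesis unfolding lookup_division by (auto intro: trans_le_add2)
  qed
  then have "mdeg \<gamma> \<le> (\<Sum>i\<in>(UNIV :: 'n set). d + d * Poly_Mapping.lookup (quo U d \<gamma>) i)"
    unfolding mdeg_def by (intro sum_mono) auto
  then show ?thesis by (simp add: mdeg_def sum.distrib sum_distrib_left)
qed

lemma finite_remainders: "finite (remainders U d)"
  and card_remainders: "card (remainders U d) = d ^ card (- U)"
proof -
  let ?P = "(- U) \<rightarrow>\<^sub>E {..<d}"
  have "bij_betw (\<lambda>\<beta>. restrict (Poly_Mapping.lookup \<beta>) (- U)) (remainders U d) ?P"
  proof (rule bij_betw_byWitness[where f' = "\<lambda>g. Abs_poly_mapping (\<lambda>i. if i \<in> U then 0 else g i)"])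
    show "\<forall>\<beta>\<in>remainders U d.
        Abs_poly_mapping (\<lambda>i. if i \<in> U then 0 else restrict (Poly_Mapping.lookup \<beta>) (- U) i) = \<beta>"
    proof
      fix \<beta> assume \<beta>: "\<beta> \<in> remainders U d"
      show "Abs_poly_mapping (\<lambda>i. if i \<in> U then 0 else restrict (Poly_Mapping.lookup \<beta>) (- U) i) = \<beta>"
        by (rule poly_mapping_eqI, subst lookup_Abs_finite)
          (use \<beta> in \<open>auto simp: remainders_def split: if_splits\<close>)
    qed
    show "\<forall>g\<in>?P. restrict (Poly_Mapping.lookup (Abs_poly_mapping (\<lambda>i. if i \<in> U then 0 else g i))) (- U) = g"
    proof
      fix g assume g: "g \<in> ?P"
      show "restrict (Poly_Mapping.lookup (Abs_poly_mapping (\<lambda>i. if i \<in> U then 0 else g i))) (- U) = g"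
        by (rule PiE_ext[OF _ g]) (use g in \<open>auto simp: lookup_Abs_finite\<close>)
    qed
    show "(\<lambda>\<beta>. restrict (Poly_Mapping.lookup \<beta>) (- U)) ` remainders U d \<subseteq> ?P"
      by (auto simp: remainders_def split: if_splits)
    show "(\<lambda>g. Abs_poly_mapping (\<lambda>i. if i \<in> U then 0 else g i)) ` ?P \<subseteq> remainders U d"
      by (auto simp: remainders_def lookup_Abs_finite)
  qed
  then show "finite (remainders U d)" "card (remainders U d) = d ^ card (- U)"
    using bij_betw_finite bij_betw_same_card by (fastforce simp: card_PiE intro: finite_PiE)+
qed

text \<open>The coordinate of \<open>f\<close> at the basis monomial \<open>\<beta>\<close> of the
  free extension, written as a polynomial in the variables before inflation.\<close>

definition component :: "'n::finite set \<Rightarrow> nat \<Rightarrow> 'n monomial \<Rightarrow> 'n mpoly \<Rightarrow> 'n mpoly" where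
  "component U d \<beta> f = (\<Sum>\<gamma>\<in>Poly_Mapping.keys f.
     if remn U d \<gamma> = \<beta> then Poly_Mapping.single (quo U d \<gamma>) (Poly_Mapping.lookup f \<gamma>) else 0)"

lemma component_single:
  "component U d \<beta> (Poly_Mapping.single \<gamma> c) =
    (if remn U d \<gamma> = \<beta> then Poly_Mapping.single (quo U d \<gamma>) c else 0)"
  unfolding component_def
  by (rule sum_keys_single[where \<phi> = "\<lambda>\<gamma> c. if remn U d \<gamma> = \<beta> then Poly_Mapping.single (quo U d \<gamma>) c else 0"]) simp

lemma component_add: "component U d \<beta> (f + g) = component U d \<beta> f + component U d \<beta> g"
  unfolding component_def by (rule sum_keys_add) (auto simp: single_add)

lemma component_0 [simp]: "component U d \<beta> 0 = 0"
  by (simp add: component_def)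

lemma component_sum: "component U d \<beta> (sum f A) = (\<Sum>a\<in>A. component U d \<beta> (f a))"
  by (induction A rule: infinite_finite_induct) (auto simp: component_add)

text \<open>Inflation for an arbitrary set of fixed variables; \<open>inflation \<kappa> d\<close>
  is the case \<open>U = firsts \<kappa>\<close>.\<close>

definition partial_power :: "'n::finite set \<Rightarrow> nat \<Rightarrow> 'n system" where
  "partial_power U d = (\<chi> i. if i \<in> U then mvar i else mvar i ^ d)"

lemma msubst_partial_power_single:
  "msubst (Poly_Mapping.single \<alpha> c) (partial_power U d) = Poly_Mapping.single (dilate U d \<alpha>) c"
proof -
  have "(\<Prod>i\<in>UNIV. partial_power U d $ i ^ Poly_Mapping.lookup \<alpha> i) =
      (\<Prod>i\<in>UNIV. mvar i ^ Poly_Mapping.lookup (dilate U d \<alpha>) i)"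
    by (rule prod.cong) (auto simp: partial_power_def lookup_division power_mult)
  then show ?thesis
    by (simp add: msubst_single monomial_eq_prod_mvar[symmetric] mconst_mult_single)
qed

text \<open>Coordinates are linear over the subring of inflated polynomials, because multiplication
  by a dilated monomial shifts quotients and keeps remainders.\<close>

lemma component_msubst_mult:
  assumes "d > 0"
  shows "component U d \<beta> (msubst g (partial_power U d) * h) = g * component U d \<beta> h"
proof (induction g rule: poly_mapping_single_induct)
  case (single \<alpha> c)
  show ?case
    by (induction h rule: poly_mapping_single_induct)
      (simp_all add: msubst_partial_power_single mult_single component_single component_add
        distrib_left remn_dilate_add quo_dilate_add[OF assms])
qed (simp add: component_add distrib_right)

text \<open>Generation half of freeness: each monomial contributes only to the summand of its own
  remainder.\<close>

lemma sum_components: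
  assumes "d > 0"
  shows "(\<Sum>\<beta>\<in>remainders U d. Poly_Mapping.single \<beta> 1 * msubst (component U d \<beta> f) (partial_power U d)) = f"
proof (induction f rule: poly_mapping_single_induct)
  case (single \<gamma> c)
  have "(\<Sum>\<beta>\<in>remainders U d. Poly_Mapping.single \<beta> 1 *
      msubst (component U d \<beta> (Poly_Mapping.single \<gamma> c)) (partial_power U d)) =
    (\<Sum>\<beta>\<in>remainders U d. if remn U d \<gamma> = \<beta> then
       Poly_Mapping.single (\<beta> + dilate U d (quo U d \<gamma>)) c else 0)"
    by (rule sum.cong) (auto simp: component_single msubst_partial_power_single mult_single)
  also have "\<dots> = Poly_Mapping.single \<gamma> c"
    using remn_in_remainders[OF assms, of U \<gamma>] by (simp add: finite_remainders division_monomial)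
  finally show ?case .
qed (simp add: component_add distrib_left sum.distrib)

text \<open>Uniqueness half of freeness: a monomial in \<open>remainders U d\<close> is its own
  remainder and has quotient 0.\<close>

lemma component_of_sum:
  assumes "d > 0" "\<beta> \<in> remainders U d"
  shows "component U d \<beta> (\<Sum>\<beta>'\<in>remainders U d. Poly_Mapping.single \<beta>' 1 * msubst (g \<beta>') (partial_power U d)) = g \<beta>"
proof -
  have "component U d \<beta> (\<Sum>\<beta>'\<in>remainders U d. Poly_Mapping.single \<beta>' 1 * msubst (g \<beta>') (partial_power U d)) =
    (\<Sum>\<beta>'\<in>remainders U d. g \<beta>' * component U d \<beta> (Poly_Mapping.single \<beta>' 1))"
    unfolding component_sum
    by (intro sum.cong refl) (simp add: mult.commute[of "Poly_Mapping.single _ 1"] component_msubst_mult[OF assms(1)])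
  also have "\<dots> = (\<Sum>\<beta>'\<in>remainders U d. if \<beta>' = \<beta> then g \<beta>' else 0)"
    by (intro sum.cong refl) (simp add: component_single remainders_self remainders_self[OF assms(2)])
  also have "\<dots> = g \<beta>" using assms by (simp add: finite_remainders)
  finally show ?thesis .
qed

text \<open>
  Writing \<open>S\<close> for \<open>partial_power U d\<close>, the polynomial ring is free over its subring
  \<open>{msubst g S | g}\<close> with the monomials in \<open>remainders U d\<close> as a basis. The point is that
  this survives localization at the origin: the polynomials all of whose components lie in
  the local ideal of \<open>P\<close> form an ideal which contains all monomials of large degree, and modulo
  such an ideal a polynomial with nonzero constant term is invertible.
\<close>

lemma component_in_local_ideal:
  fixes P :: "'n::finite system"
  assumes d: "d > 0" and basis: "local_basis P 0 X e"
    and f: "f \<in> local_ideal (P \<circ>\<^sub>s partial_power U d) 0"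
  shows "component U d \<beta> f \<in> local_ideal P 0"
proof -
  let ?J = "local_ideal P 0"
  note J = is_idealD[OF is_ideal_local_ideal[of P 0]]
  have J_right: "f * h \<in> ?J" if "f \<in> ?J" for f h
    using J(3)[OF that, of h] by (simp add: mult.commute)
  define K where "K = {f. \<forall>\<beta>. component U d \<beta> f \<in> ?J}"
  \<comment> \<open>The coordinates of \<open>h * f\<close> are combinations of those of
    \<open>f\<close>, with coordinates of \<open>h\<close> times basis monomials as coefficients; so
    \<open>K\<close> absorbs arbitrary factors and not only inflated ones.\<close>
  have K_mult: "h * f \<in> K" if "f \<in> K" for f h
    unfolding K_def
  proof safe
    fix \<beta>
    have "h * f = h * (\<Sum>\<beta>'\<in>remainders U d. Poly_Mapping.single \<beta>' 1 * msubst (component U d \<beta>' f) (partial_power U d))"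
      by (simp add: sum_components[OF d])
    also have "\<dots> = (\<Sum>\<beta>'\<in>remainders U d. msubst (component U d \<beta>' f) (partial_power U d) * (h * Poly_Mapping.single \<beta>' 1))"
      unfolding sum_distrib_left by (intro sum.cong refl) (simp add: mult_ac)
    finally have "component U d \<beta> (h * f) =
        (\<Sum>\<beta>'\<in>remainders U d. component U d \<beta>' f * component U d \<beta> (h * Poly_Mapping.single \<beta>' 1))"
      by (simp add: component_sum component_msubst_mult[OF d])
    also have "\<dots> \<in> ?J"
      using that by (intro is_ideal_sum[OF is_ideal_local_ideal]) (auto simp: K_def intro: J_right)
    finally show "component U d \<beta> (h * f) \<in> ?J" .
  qed
  have K_ideal: "is_ideal K"
    unfolding is_ideal_def using K_mult by (auto simp: K_def component_add intro: J)
  obtain u r where u: "meval u 0 \<noteq> 0" "u * f = (\<Sum>i\<in>UNIV. r i * (P \<circ>\<^sub>s partial_power U d) $ i)"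
    using f by (auto simp: ideal_gen_def elim!: local_idealE)
  have uf: "u * f \<in> K"
  proof -
    have "component U d \<beta> (u * f) = (\<Sum>i\<in>UNIV. P $ i * component U d \<beta> (r i))" for \<beta>
      unfolding u(2) component_sum
      by (intro sum.cong refl) (simp add: mult.commute[of "r _"] component_msubst_mult[OF d])
    also have "\<dots> \<beta> \<in> ?J" for \<beta>
      using generator_in_ideal_gen[of "\<lambda>i. P $ i"]
      by (intro is_ideal_sum[OF is_ideal_local_ideal])
        (auto intro: J_right ideal_gen_subset_local_ideal)
    finally show ?thesis by (simp add: K_def)
  qed
  \<comment> \<open>By \<open>mdeg_le_quo\<close>, degree \<open>N\<close> forces the quotient to
    have degree at least \<open>CARD('n) * card X\<close>, the threshold of
    \<open>monomial_in_local_ideal\<close>.\<close>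
  define N where "N = CARD('n) * d + d * (CARD('n) * card X)"
  have monomial: "Poly_Mapping.single \<gamma> c \<in> K" if "N \<le> mdeg \<gamma>" for \<gamma> c
  proof -
    have "d * (CARD('n) * card X) \<le> d * mdeg (quo U d \<gamma>)"
      using that mdeg_le_quo[OF d, of \<gamma> U] unfolding N_def by linarith
    then have "CARD('n) * card X \<le> mdeg (quo U d \<gamma>)" using d by simp
    then have "mconst c * Poly_Mapping.single (quo U d \<gamma>) 1 \<in> ?J"
      by (intro J monomial_in_local_ideal[OF basis])
    then show ?thesis using J(1) by (simp add: K_def component_single mconst_mult_single)
  qed
  \<comment> \<open>Normalizes the unit \<open>u\<close> to \<open>1 - t\<close> with
    \<open>t\<close> vanishing at the origin. As \<open>t ^ N\<close> has order \<open>N\<close> it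
    lies in \<open>K\<close>, so the geometric series cut off at \<open>N\<close> inverts
    \<open>1 - t\<close> modulo \<open>K\<close>.\<close>
  define t where "t = 1 - mconst (inverse (meval u 0)) * u"
  have "meval t 0 = 0" using u(1) by (simp add: t_def)
  then have "ord_ge N (t ^ N)" by (intro ord_ge_power) (simp only: ord_ge_1_iff)
  then have tN: "t ^ N \<in> K"
    unfolding ord_ge_def
    by (subst poly_mapping_eq_sum_single[of "t ^ N"]) (intro is_ideal_sum[OF K_ideal] monomial, auto)
  have "f = (1 - t ^ N) * f + f * t ^ N" by (simp add: algebra_simps)
  also have "1 - t ^ N = (1 - t) * (\<Sum>i<N. t ^ i)" by (rule one_diff_power_eq)
  also have "1 - t = mconst (inverse (meval u 0)) * u" by (simp add: t_def)
  also have "mconst (inverse (meval u 0)) * u * (\<Sum>i<N. t ^ i) * f =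
      (mconst (inverse (meval u 0)) * (\<Sum>i<N. t ^ i)) * (u * f)" by (simp add: mult_ac)
  finally have "f = (mconst (inverse (meval u 0)) * (\<Sum>i<N. t ^ i)) * (u * f) + f * t ^ N" .
  moreover have "(mconst (inverse (meval u 0)) * (\<Sum>i<N. t ^ i)) * (u * f) + f * t ^ N \<in> K"
    by (intro is_idealD(2,3)[OF K_ideal] uf tN)
  ultimately have "f \<in> K" by simp
  then show ?thesis by (simp add: K_def)
qed

text \<open>The product basis of a tower. Independence is read off from the coordinates of a
  relation, each of which lies in the local ideal of \<open>P\<close>; spanning reduces each
  coordinate modulo that ideal and substitutes back.\<close>

lemma local_basis_partial_power:
  fixes P :: "'n::finite system"
  assumes d: "d > 0" and basis: "local_basis P 0 X e"
  shows "local_basis (P \<circ>\<^sub>s partial_power U d) 0 (remainders U d \<times> X)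
    (\<lambda>(\<beta>, x). Poly_Mapping.single \<beta> 1 * msubst (e x) (partial_power U d))"
proof -
  let ?S = "partial_power U d" and ?R = "remainders U d"
  let ?J = "local_ideal (P \<circ>\<^sub>s ?S) 0"
  have eq: "(\<Sum>y\<in>?R \<times> X. mconst (c y) * (case y of (\<beta>, x) \<Rightarrow> Poly_Mapping.single \<beta> 1 * msubst (e x) ?S)) =
      (\<Sum>\<beta>\<in>?R. Poly_Mapping.single \<beta> 1 * msubst (\<Sum>x\<in>X. mconst (c (\<beta>, x)) * e x) ?S)" for c
  proof -
    have "(\<Sum>y\<in>?R \<times> X. mconst (c y) * (case y of (\<beta>, x) \<Rightarrow> Poly_Mapping.single \<beta> 1 * msubst (e x) ?S)) =
        (\<Sum>\<beta>\<in>?R. \<Sum>x\<in>X. mconst (c (\<beta>, x)) * (Poly_Mapping.single \<beta> 1 * msubst (e x) ?S))"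
      by (subst sum.cartesian_product) (auto intro: sum.cong)
    also have "\<dots> = (\<Sum>\<beta>\<in>?R. Poly_Mapping.single \<beta> 1 * msubst (\<Sum>x\<in>X. mconst (c (\<beta>, x)) * e x) ?S)"
      by (simp add: msubst_sum sum_distrib_left mult.left_commute)
    finally show ?thesis .
  qed
  have S0: "sys_eval ?S 0 = 0" using d by (simp add: vec_eq_iff partial_power_def)
  show ?thesis
    unfolding local_basis_def eq
  proof (intro conjI allI impI)
    show "finite (?R \<times> X)" using basis by (simp add: local_basis_def finite_remainders)
    fix c assume c: "(\<Sum>\<beta>\<in>?R. Poly_Mapping.single \<beta> 1 * msubst (\<Sum>x\<in>X. mconst (c (\<beta>, x)) * e x) ?S) \<in> ?J"
    have "(\<Sum>x\<in>X. mconst (c (\<beta>, x)) * e x) \<in> local_ideal P 0" if "\<beta> \<in> ?R" for \<beta>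
      using component_in_local_ideal[OF d basis c, of \<beta>]
      by (simp add: component_of_sum[OF d that, where g = "\<lambda>\<beta>. \<Sum>x\<in>X. mconst (c (\<beta>, x)) * e x"])
    then have "\<forall>x\<in>X. c (\<beta>, x) = 0" if "\<beta> \<in> ?R" for \<beta>
      using that basis unfolding local_basis_def by (elim conjE allE[of _ "\<lambda>x. c (\<beta>, x)"]) auto
    then show "\<forall>y\<in>?R \<times> X. c y = 0" by auto
  next
    fix f
    obtain a where a: "\<And>f. f - (\<Sum>x\<in>X. mconst (a f x) * e x) \<in> local_ideal P 0"
      using basis unfolding local_basis_def by metis
    define c where "c = (\<lambda>(\<beta>, x). a (component U d \<beta> f) x)"
    have "f - (\<Sum>\<beta>\<in>?R. Poly_Mapping.single \<beta> 1 * msubst (\<Sum>x\<in>X. mconst (c (\<beta>, x)) * e x) ?S) =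
      (\<Sum>\<beta>\<in>?R. Poly_Mapping.single \<beta> 1 * msubst (component U d \<beta> f) ?S) -
      (\<Sum>\<beta>\<in>?R. Poly_Mapping.single \<beta> 1 * msubst (\<Sum>x\<in>X. mconst (c (\<beta>, x)) * e x) ?S)"
      by (simp only: sum_components[OF d])
    also have "\<dots> = (\<Sum>\<beta>\<in>?R. Poly_Mapping.single \<beta> 1 *
        msubst (component U d \<beta> f - (\<Sum>x\<in>X. mconst (a (component U d \<beta> f) x) * e x)) ?S)"
      by (simp only: sum_subtractf[symmetric] right_diff_distrib[symmetric] msubst_diff[symmetric] c_def split)
    also have "\<dots> \<in> ?J"
      by (intro is_ideal_sum[OF is_ideal_local_ideal] is_idealD(3)[OF is_ideal_local_ideal]
          local_ideal_msubst) (simp add: S0 a)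
    finally show "\<exists>c. f - (\<Sum>\<beta>\<in>?R. Poly_Mapping.single \<beta> 1 *
        msubst (\<Sum>x\<in>X. mconst (c (\<beta>, x)) * e x) ?S) \<in> ?J" by blast
  qed
qed

section \<open>Standard monomials\<close>

text \<open>Generators are eliminated one at a time instead of by a determinant: in the relation for
  \<open>a\<close> the coefficient \<open>1 - m a\<close> is a unit at \<open>z\<close>. A finite
  set and an ideal closed under cancelling units replace modules over the local ring.\<close>

lemma nakayama:
  fixes J A :: "'n::finite mpoly set"
  assumes "finite A" and J: "is_ideal J"
    and unit: "\<And>u f. meval u z \<noteq> 0 \<Longrightarrow> u * f \<in> J \<Longrightarrow> f \<in> J"
    and "\<And>a. a \<in> A \<Longrightarrow> \<exists>m. (\<forall>b. meval (m b) z = 0) \<and> a - (\<Sum>b\<in>A. m b * b) \<in> J"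
  shows "A \<subseteq> J"
  using assms(1,4)
proof (induction A rule: finite_induct)
  case (insert a A)
  obtain m where m: "\<And>b. meval (m b) z = 0" "a - (\<Sum>b\<in>insert a A. m b * b) \<in> J"
    using insert.prems[of a] by auto
  define j where "j = (1 - m a) * a - (\<Sum>b\<in>A. m b * b)"
  have j: "j \<in> J" using m(2) insert.hyps by (simp add: j_def algebra_simps)
  have "A \<subseteq> J"
  proof (rule insert.IH)
    fix b assume b: "b \<in> A"
    then obtain m' where m': "\<And>c. meval (m' c) z = 0" "b - (\<Sum>c\<in>insert a A. m' c * c) \<in> J"
      using insert.prems[of b] by auto
    \<comment> \<open>The relation for \<open>b\<close> times \<open>1 - m a\<close>, with
      \<open>a\<close> eliminated by \<open>j\<close>. The extra \<open>m a\<close> at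
      \<open>c = b\<close> restores the coefficient of the leading \<open>b\<close> to 1; all
      coefficients still vanish at \<open>z\<close>.\<close>
    define n where "n c = (1 - m a) * m' c + m' a * m c + (if c = b then m a else 0)" for c
    have "(\<Sum>c\<in>A. (if c = b then m a else 0) * c) = (\<Sum>c\<in>A. if c = b then m a * b else 0)"
      by (rule sum.cong) auto
    also have "\<dots> = m a * b" using b insert.hyps by simp
    finally have "(\<Sum>c\<in>A. n c * c) =
        (1 - m a) * (\<Sum>c\<in>A. m' c * c) + m' a * (\<Sum>c\<in>A. m c * c) + m a * b"
      by (simp add: n_def distrib_right sum.distrib sum_distrib_left mult.assoc)
    then have "b - (\<Sum>c\<in>A. n c * c) = (1 - m a) * (b - (\<Sum>c\<in>insert a A. m' c * c)) + m' a * j"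
      using insert.hyps by (simp add: j_def algebra_simps)
    also have "\<dots> \<in> J" by (intro is_idealD(2,3)[OF J] m' j)
    finally have "b - (\<Sum>c\<in>A. n c * c) \<in> J" .
    moreover have "\<forall>c. meval (n c) z = 0" by (simp add: n_def m m')
    ultimately show "\<exists>n. (\<forall>c. meval (n c) z = 0) \<and> b - (\<Sum>c\<in>A. n c * c) \<in> J" by blast
  qed
  then have "(\<Sum>b\<in>A. m b * b) \<in> J" by (intro is_ideal_sum[OF J] is_idealD[OF J]) auto
  then have "j + (\<Sum>b\<in>A. m b * b) \<in> J" by (intro is_idealD(2)[OF J] j)
  then have "(1 - m a) * a \<in> J" by (simp add: j_def)
  then have "a \<in> J" by (rule unit[rotated]) (simp add: m)
  with \<open>A \<subseteq> J\<close> show ?case by auto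
qed auto

section \<open>Initial monomials and reduction under a graded local order\<close>

lemma graded_local_orderD:
  assumes "graded_local_order lt"
  shows "\<not> lt \<alpha> \<alpha>" "lt \<alpha> \<beta> \<Longrightarrow> lt \<beta> \<gamma> \<Longrightarrow> lt \<alpha> \<gamma>" "\<alpha> \<noteq> \<beta> \<Longrightarrow> lt \<alpha> \<beta> \<or> lt \<beta> \<alpha>"
    "lt \<alpha> \<beta> \<Longrightarrow> lt (\<alpha> + \<gamma>) (\<beta> + \<gamma>)" "mdeg \<alpha> > mdeg \<beta> \<Longrightarrow> lt \<alpha> \<beta>"
proof -
  have "irreflp lt" "transp lt" "totalp lt"
    and *: "\<forall>\<alpha> \<beta> \<gamma>. lt \<alpha> \<beta> \<longrightarrow> lt (\<alpha> + \<gamma>) (\<beta> + \<gamma>)" "\<forall>\<alpha> \<beta>. mdeg \<alpha> > mdeg \<beta> \<longrightarrow> lt \<alpha> \<beta>"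
    using assms by (simp_all add: graded_local_order_def)
  then show "\<not> lt \<alpha> \<alpha>" "lt \<alpha> \<beta> \<Longrightarrow> lt \<beta> \<gamma> \<Longrightarrow> lt \<alpha> \<gamma>" "\<alpha> \<noteq> \<beta> \<Longrightarrow> lt \<alpha> \<beta> \<or> lt \<beta> \<alpha>"
    by (simp add: irreflpD, metis transpD, metis totalpD)
  show "lt \<alpha> \<beta> \<Longrightarrow> lt (\<alpha> + \<gamma>) (\<beta> + \<gamma>)" "mdeg \<alpha> > mdeg \<beta> \<Longrightarrow> lt \<alpha> \<beta>"
    using * by blast+
qed

lemma initial_exists:
  assumes lt: "graded_local_order lt" and "f \<noteq> 0"
  obtains \<alpha> where "is_initial lt f \<alpha>"
proof -
  have "\<exists>\<alpha>\<in>A. \<forall>\<beta>\<in>A. \<beta> \<noteq> \<alpha> \<longrightarrow> lt \<beta> \<alpha>" if "finite A" "A \<noteq> {}" for A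
    using that
  proof (induction A rule: finite_ne_induct)
    case (insert x A)
    then obtain \<alpha> where \<alpha>: "\<alpha> \<in> A" "\<forall>\<beta>\<in>A. \<beta> \<noteq> \<alpha> \<longrightarrow> lt \<beta> \<alpha>" by auto
    show ?case
    proof (cases "lt x \<alpha>")
      case True
      with \<alpha> show ?thesis by auto
    next
      case False
      with \<alpha> insert.hyps have "lt \<alpha> x" using graded_local_orderD(3)[OF lt, of x \<alpha>] by auto
      have "lt \<beta> x" if "\<beta> \<in> A" for \<beta>
        using that \<alpha>(2) \<open>lt \<alpha> x\<close> graded_local_orderD(2)[OF lt, of \<beta> \<alpha> x] by (cases "\<beta> = \<alpha>") auto
      then have "\<forall>\<beta>\<in>insert x A. \<beta> \<noteq> x \<longrightarrow> lt \<beta> x" by auto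
      then show ?thesis by auto
    qed
  qed auto
  from this[of "Poly_Mapping.keys f"] assms(2) obtain \<alpha> where "is_initial lt f \<alpha>"
    by (auto simp: is_initial_def)
  then show ?thesis by (rule that)
qed

text \<open>The nonconstant part of \<open>u\<close> raises degrees and so yields only smaller
  monomials. Hence initial monomials of the ideal also control polynomials that enter it only after
  multiplication by a unit.\<close>

lemma initial_unit_mult:
  fixes f u :: "'n::finite mpoly"
  assumes lt: "graded_local_order lt" and u: "meval u 0 \<noteq> 0" and f: "is_initial lt f \<alpha>"
  shows "is_initial lt (u * f) \<alpha>"
proof -
  note L = graded_local_orderD[OF lt]
  define v where "v = u - mconst (meval u 0)"
  have v: "ord_ge 1 v" unfolding ord_ge_1_iff by (simp add: v_def)
  have vf: "lt \<gamma> \<alpha>" if \<gamma>: "\<gamma> \<in> Poly_Mapping.keys (v * f)" for \<gamma>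
  proof -
    obtain \<beta> \<delta> where *: "\<gamma> = \<beta> + \<delta>" "\<beta> \<in> Poly_Mapping.keys v" "\<delta> \<in> Poly_Mapping.keys f"
      using \<gamma> keys_mult[of v f] by blast
    have "1 \<le> mdeg \<beta>" using v *(2) unfolding ord_ge_def by blast
    then have "mdeg \<beta> > mdeg (0 :: 'n monomial)" unfolding mdeg_0 by linarith
    then have "lt (\<beta> + \<delta>) (0 + \<delta>)" by (intro L(4) L(5))
    moreover have "\<delta> = \<alpha> \<or> lt \<delta> \<alpha>" using f *(3) by (auto simp: is_initial_def)
    ultimately show ?thesis using *(1) L(2)[of "\<beta> + \<delta>" \<delta> \<alpha>] by auto
  qed
  have uf: "u * f = mconst (meval u 0) * f + v * f" by (simp add: v_def algebra_simps)
  have "\<alpha> \<in> Poly_Mapping.keys (u * f)"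
  proof -
    have "\<alpha> \<notin> Poly_Mapping.keys (v * f)" using vf L(1) by blast
    then show ?thesis using u f by (simp add: uf in_keys_iff lookup_add is_initial_def)
  qed
  moreover have "lt \<gamma> \<alpha>" if \<gamma>: "\<gamma> \<in> Poly_Mapping.keys (u * f)" "\<gamma> \<noteq> \<alpha>" for \<gamma>
  proof (cases "\<gamma> \<in> Poly_Mapping.keys (v * f)")
    case False
    then have "\<gamma> \<in> Poly_Mapping.keys f" using \<gamma>(1) by (auto simp: uf in_keys_iff lookup_add)
    then show ?thesis using f \<gamma>(2) by (auto simp: is_initial_def)
  qed (rule vf)
  ultimately show ?thesis by (auto simp: is_initial_def)
qed

text \<open>Trading a monomial for the tail of an element of \<open>M\<close> with that initial
  monomial never lowers the degree, so the bound \<open>L\<close> persists. Monomials beyond degree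
  \<open>K\<close> are in \<open>M\<close> already, and only finitely many others remain.\<close>

lemma reduce_to_subspace:
  fixes M :: "'n::finite mpoly set"
  assumes lt: "graded_local_order lt" and M: "mpoly_vs.subspace M"
    and high: "\<And>\<alpha>. K < mdeg \<alpha> \<Longrightarrow> Poly_Mapping.single \<alpha> 1 \<in> M"
    and low: "\<And>\<alpha>. L \<le> mdeg \<alpha> \<Longrightarrow> mdeg \<alpha> \<le> K \<Longrightarrow> Poly_Mapping.single \<alpha> 1 \<in> M \<or> (\<exists>f\<in>M. is_initial lt f \<alpha>)"
    and "L \<le> mdeg \<alpha>"
  shows "Poly_Mapping.single \<alpha> 1 \<in> M"
  using \<open>L \<le> mdeg \<alpha>\<close>
\<comment> \<open>The order \<open>lt\<close> is not well-founded; the number of smaller monomials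
  of degree at most \<open>K\<close> serves as measure instead.\<close>
proof (induction "card {\<beta>. mdeg \<beta> \<le> K \<and> lt \<beta> \<alpha>}" arbitrary: \<alpha> rule: less_induct)
  case less
  note lto = graded_local_orderD[OF lt]
  show ?case
  proof (cases "mdeg \<alpha> \<le> K \<and> Poly_Mapping.single \<alpha> 1 \<notin> M")
    case True
    then obtain f where f: "f \<in> M" "is_initial lt f \<alpha>" using low less.prems by blast
    have smaller: "Poly_Mapping.single \<beta> 1 \<in> M" if \<beta>: "\<beta> \<in> Poly_Mapping.keys f - {\<alpha>}" for \<beta>
    proof -
      have lt\<beta>: "lt \<beta> \<alpha>" using f(2) \<beta> by (auto simp: is_initial_def)
      then have "\<not> mdeg \<beta> < mdeg \<alpha>" using lto(1,2,5) by blast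
      then have deg: "L \<le> mdeg \<beta>" using less.prems by simp
      show ?thesis
      proof (cases "mdeg \<beta> \<le> K")
        case True
        have "{\<gamma>. mdeg \<gamma> \<le> K \<and> lt \<gamma> \<beta>} \<subset> {\<gamma>. mdeg \<gamma> \<le> K \<and> lt \<gamma> \<alpha>}"
          using True lt\<beta> lto(1,2) by blast
        then have "card {\<gamma>. mdeg \<gamma> \<le> K \<and> lt \<gamma> \<beta>} < card {\<gamma>. mdeg \<gamma> \<le> K \<and> lt \<gamma> \<alpha>}"
          by (rule psubset_card_mono[rotated]) (rule finite_subset[OF _ finite_monomials_mdeg_le[of K]], auto)
        then show ?thesis using deg by (rule less.hyps)
      qed (use high in auto)
    qed
    have c: "Poly_Mapping.lookup f \<alpha> \<noteq> 0" and \<alpha>: "\<alpha> \<in> Poly_Mapping.keys f"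
      using f(2) by (auto simp: is_initial_def in_keys_iff)
    define g where "g = (\<Sum>\<beta>\<in>Poly_Mapping.keys f - {\<alpha>}.
      mconst (Poly_Mapping.lookup f \<beta>) * Poly_Mapping.single \<beta> 1)"
    have g: "g \<in> M"
      unfolding g_def using smaller by (intro mpoly_vs.subspace_sum mpoly_vs.subspace_scale M)
    have "f = Poly_Mapping.single \<alpha> (Poly_Mapping.lookup f \<alpha>) + g"
      unfolding g_def using \<alpha>
      by (subst poly_mapping_eq_sum_single[of f]) (simp add: sum.remove mconst_mult_single)
    then have "Poly_Mapping.single \<alpha> 1 = mconst (inverse (Poly_Mapping.lookup f \<alpha>)) * (f - g)"
      using c by (metis add_diff_cancel_right' mconst_mult_single left_inverse)
    also have "\<dots> \<in> M" by (intro mpoly_vs.subspace_scale mpoly_vs.subspace_diff M f g)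
    finally show ?thesis .
  qed (use high in force)
qed

lemma monomial_split_degree:
  assumes "N \<le> mdeg \<alpha>"
  obtains \<beta> \<gamma> where "\<alpha> = \<beta> + \<gamma>" "mdeg \<gamma> = N"
proof -
  have "\<exists>\<beta> \<gamma>. \<alpha> = \<beta> + \<gamma> \<and> mdeg \<gamma> = N" using assms
  proof (induction N)
    case 0
    show ?case by (intro exI[of _ \<alpha>] exI[of _ 0]) simp
  next
    case (Suc N)
    then obtain \<beta> \<gamma> where *: "\<alpha> = \<beta> + \<gamma>" "mdeg \<gamma> = N" by auto
    with Suc.prems have "mdeg \<beta> \<noteq> 0" by (simp del: mdeg_eq_0_iff)
    then have "\<beta> \<noteq> 0" by auto
    then obtain i where "Poly_Mapping.lookup \<beta> i \<noteq> 0" by (metis lookup_zero poly_mapping_eqI)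
    then obtain \<delta> where "\<beta> = Poly_Mapping.single i 1 + \<delta>" by (rule monomial_split_var)
    with * show ?case
      by (intro exI[of _ \<delta>] exI[of _ "Poly_Mapping.single i 1 + \<gamma>"]) (simp add: ac_simps)
  qed
  then show ?thesis using that by blast
qed

text \<open>Modulo degree-\<open>N\<close> monomials multiplied by polynomials vanishing at the
  origin, everything of degree above \<open>N\<close> disappears, so reduction of the
  degree-\<open>N\<close> monomials terminates. Nakayama's lemma removes this extra modulus.\<close>

lemma monomials_in_local_ideal_if_initial:
  fixes F :: "'n::finite system"
  assumes lt: "graded_local_order lt"
    and N: "\<And>\<alpha>. mdeg \<alpha> = N \<Longrightarrow> \<exists>f\<in>ideal_gen UNIV (\<lambda>i. F $ i). is_initial lt f \<alpha>"
    and "N \<le> mdeg \<alpha>"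
  shows "Poly_Mapping.single \<alpha> 1 \<in> local_ideal F 0"
proof -
  let ?J = "local_ideal F 0"
  note J = is_idealD[OF is_ideal_local_ideal[of F 0]]
  define A :: "'n mpoly set" where "A = (\<lambda>\<alpha>. Poly_Mapping.single \<alpha> 1) ` {\<alpha>. mdeg \<alpha> = N}"
  have finA: "finite A" unfolding A_def by (intro finite_imageI finite_monomials_mdeg_eq)
  \<comment> \<open>The sum of \<open>?J\<close> and the maximal ideal at the origin times the ideal
    generated by \<open>A\<close>; Nakayama's lemma asks that it contain \<open>A\<close>.\<close>
  define M where "M = {f. \<exists>m. (\<forall>b. meval (m b) 0 = 0) \<and> f - (\<Sum>b\<in>A. m b * b) \<in> ?J}"
  have J_sub_M: "f \<in> M" if "f \<in> ?J" for f
    unfolding M_def using that by (intro CollectI exI[of _ "\<lambda>_. 0"]) simp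
  have M: "mpoly_vs.subspace M"
  proof (rule mpoly_vs.subspaceI)
    show "0 \<in> M" by (intro J_sub_M J)
  next
    fix f g assume "f \<in> M" "g \<in> M"
    then obtain m n where m: "\<And>b. meval (m b) 0 = 0" "f - (\<Sum>b\<in>A. m b * b) \<in> ?J"
      and n: "\<And>b. meval (n b) 0 = 0" "g - (\<Sum>b\<in>A. n b * b) \<in> ?J" by (auto simp: M_def)
    have "f + g - (\<Sum>b\<in>A. (m b + n b) * b) = (f - (\<Sum>b\<in>A. m b * b)) + (g - (\<Sum>b\<in>A. n b * b))"
      by (simp add: distrib_right sum.distrib)
    also have "\<dots> \<in> ?J" by (intro J m n)
    finally show "f + g \<in> M"
      unfolding M_def by (intro CollectI exI[of _ "\<lambda>b. m b + n b"]) (simp add: m n)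
  next
    fix c f assume "f \<in> M"
    then obtain m where m: "\<And>b. meval (m b) 0 = 0" "f - (\<Sum>b\<in>A. m b * b) \<in> ?J"
      by (auto simp: M_def)
    have "mconst c * f - (\<Sum>b\<in>A. (mconst c * m b) * b) = mconst c * (f - (\<Sum>b\<in>A. m b * b))"
      by (simp add: right_diff_distrib sum_distrib_left mult.assoc)
    also have "\<dots> \<in> ?J" by (intro J m)
    finally show "mconst c * f \<in> M"
      unfolding M_def by (intro CollectI exI[of _ "\<lambda>b. mconst c * m b"]) (simp add: m)
  qed
  have single_M: "Poly_Mapping.single \<alpha> 1 \<in> M" if "N \<le> mdeg \<alpha>" for \<alpha>
  \<comment> \<open>With \<open>K = L = N\<close> the reduction stays in degree \<open>N\<close>: a
    monomial of larger degree is a nonconstant monomial times an element of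
    \<open>A\<close>.\<close>
  proof (rule reduce_to_subspace[OF lt M, where K = N and L = N])
    fix \<alpha> :: "'n monomial" assume "N < mdeg \<alpha>"
    then obtain \<beta> \<gamma> where *: "\<alpha> = \<beta> + \<gamma>" "mdeg \<gamma> = N" using monomial_split_degree[of N \<alpha>] by auto
    have \<beta>: "\<beta> \<noteq> 0" using \<open>N < mdeg \<alpha>\<close> * by auto
    define m :: "'n mpoly \<Rightarrow> 'n mpoly"
      where "m b = (if b = Poly_Mapping.single \<gamma> 1 then Poly_Mapping.single \<beta> 1 else 0)" for b
    have "(\<Sum>b\<in>A. m b * b) = (\<Sum>b\<in>A. if b = Poly_Mapping.single \<gamma> 1 then Poly_Mapping.single \<alpha> 1 else 0)"
      by (rule sum.cong) (auto simp: m_def * mult_single)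
    also have "\<dots> = Poly_Mapping.single \<alpha> 1" using finA *(2) by (auto simp: A_def)
    finally show "Poly_Mapping.single \<alpha> 1 \<in> M"
      unfolding M_def using \<beta> J(1)
      by (intro CollectI exI[of _ m]) (auto simp: m_def meval_at_0 lookup_single when_def)
  next
    fix \<alpha> :: "'n monomial" assume "N \<le> mdeg \<alpha>" "mdeg \<alpha> \<le> N"
    then show "Poly_Mapping.single \<alpha> 1 \<in> M \<or> (\<exists>f\<in>M. is_initial lt f \<alpha>)"
      using N[of \<alpha>] by (auto intro: J_sub_M ideal_gen_subset_local_ideal)
  qed fact
  have "A \<subseteq> ?J"
  proof (rule nakayama[OF finA is_ideal_local_ideal local_ideal_unit])
    fix a assume "a \<in> A"
    then have "a \<in> M" using single_M by (auto simp: A_def)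
    then show "\<exists>m. (\<forall>b. meval (m b) 0 = 0) \<and> a - (\<Sum>b\<in>A. m b * b) \<in> ?J" by (simp add: M_def)
  qed auto
  moreover obtain \<beta> \<gamma> where *: "\<alpha> = \<beta> + \<gamma>" "mdeg \<gamma> = N"
    using \<open>N \<le> mdeg \<alpha>\<close> by (rule monomial_split_degree)
  ultimately have "Poly_Mapping.single \<gamma> 1 \<in> ?J" by (auto simp: A_def)
  then have "Poly_Mapping.single \<beta> 1 * Poly_Mapping.single \<gamma> 1 \<in> ?J" by (rule J)
  then show ?thesis by (simp add: mult_single *)
qed

text \<open>Independence: a nontrivial relation in the local ideal would have a standard initial
  monomial, which multiplication by a unit preserves. Spanning: reduction stops because all
  monomials of degree at least \<open>N\<close> are in the local ideal.\<close>

lemma local_basis_standard_monomials: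
  fixes F :: "'n::finite system"
  defines "Std \<equiv> \<lambda>lt. standard_monomials lt (ideal_gen UNIV (\<lambda>i. F $ i))"
  assumes lt: "graded_local_order lt" and N: "\<And>\<alpha>. N \<le> mdeg \<alpha> \<Longrightarrow> \<alpha> \<notin> Std lt"
  shows "local_basis F 0 (Std lt) (\<lambda>\<alpha>. Poly_Mapping.single \<alpha> 1)"
proof -
  let ?I = "ideal_gen UNIV (\<lambda>i. F $ i)" and ?J = "local_ideal F 0"
  let ?e = "\<lambda>\<alpha> :: 'n monomial. Poly_Mapping.single \<alpha> (1 :: complex)"
  note J = is_idealD[OF is_ideal_local_ideal[of F 0]]
  have fin: "finite (Std lt)"
    by (rule finite_subset[OF _ finite_monomials_mdeg_le[of N]]) (use N nat_le_linear in blast)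
  show ?thesis
    unfolding local_basis_def
  proof (intro conjI allI impI fin)
    fix c assume c: "(\<Sum>\<alpha>\<in>Std lt. mconst (c \<alpha>) * ?e \<alpha>) \<in> ?J"
    define f where "f = (\<Sum>\<alpha>\<in>Std lt. mconst (c \<alpha>) * ?e \<alpha>)"
    have lookup_f: "Poly_Mapping.lookup f \<alpha> = (if \<alpha> \<in> Std lt then c \<alpha> else 0)" for \<alpha>
      using fin by (simp add: f_def lookup_sum lookup_single when_def if_distrib[of "(*) _"] cong: if_cong)
    have "f = 0"
    proof (rule ccontr)
      assume "f \<noteq> 0"
      then obtain \<alpha> where \<alpha>: "is_initial lt f \<alpha>" by (rule initial_exists[OF lt])
      obtain u where "meval u 0 \<noteq> 0" "u * f \<in> ?I" using c by (auto simp: f_def elim: local_idealE)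
      then have "\<alpha> \<notin> Std lt" using initial_unit_mult[OF lt _ \<alpha>] by (auto simp: Std_def standard_monomials_def)
      then have "Poly_Mapping.lookup f \<alpha> = 0" by (simp add: lookup_f)
      then show False using \<alpha> by (simp add: is_initial_def in_keys_iff)
    qed
    then show "\<forall>\<alpha>\<in>Std lt. c \<alpha> = 0" using lookup_f by (metis lookup_zero)
  next
    fix f
    define M where "M = {f. \<exists>c. f - (\<Sum>\<alpha>\<in>Std lt. mconst (c \<alpha>) * ?e \<alpha>) \<in> ?J}"
    have M: "mpoly_vs.subspace M"
    proof (rule mpoly_vs.subspaceI)
      show "0 \<in> M" unfolding M_def using J(1) by (intro CollectI exI[of _ "\<lambda>_. 0"]) simp
    next
      fix f g assume "f \<in> M" "g \<in> M"
      then obtain c c' where c: "f - (\<Sum>\<alpha>\<in>Std lt. mconst (c \<alpha>) * ?e \<alpha>) \<in> ?J"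
        "g - (\<Sum>\<alpha>\<in>Std lt. mconst (c' \<alpha>) * ?e \<alpha>) \<in> ?J" by (auto simp: M_def)
      have "f + g - (\<Sum>\<alpha>\<in>Std lt. mconst (c \<alpha> + c' \<alpha>) * ?e \<alpha>) =
          (f - (\<Sum>\<alpha>\<in>Std lt. mconst (c \<alpha>) * ?e \<alpha>)) + (g - (\<Sum>\<alpha>\<in>Std lt. mconst (c' \<alpha>) * ?e \<alpha>))"
        by (simp only: mconst_hom distrib_right sum.distrib add_diff_add)
      also have "\<dots> \<in> ?J" by (intro J c)
      finally show "f + g \<in> M" unfolding M_def by (intro CollectI exI[of _ "\<lambda>\<alpha>. c \<alpha> + c' \<alpha>"])
    next
      fix a f assume "f \<in> M"
      then obtain c where c: "f - (\<Sum>\<alpha>\<in>Std lt. mconst (c \<alpha>) * ?e \<alpha>) \<in> ?J" by (auto simp: M_def)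
      have "mconst a * f - (\<Sum>\<alpha>\<in>Std lt. mconst (a * c \<alpha>) * ?e \<alpha>) =
          mconst a * (f - (\<Sum>\<alpha>\<in>Std lt. mconst (c \<alpha>) * ?e \<alpha>))"
        by (simp only: mconst_hom right_diff_distrib sum_distrib_left mult.assoc)
      also have "\<dots> \<in> ?J" by (intro J c)
      finally show "mconst a * f \<in> M" unfolding M_def by (intro CollectI exI[of _ "\<lambda>\<alpha>. a * c \<alpha>"])
    qed
    have J_sub_M: "f \<in> M" if "f \<in> ?J" for f
      unfolding M_def using that by (intro CollectI exI[of _ "\<lambda>_. 0"]) simp
    have initial: "\<exists>f\<in>?I. is_initial lt f \<alpha>" if "\<alpha> \<notin> Std lt" for \<alpha>
      using that by (auto simp: Std_def standard_monomials_def)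
    have "?e \<alpha> \<in> M" for \<alpha>
    proof (rule reduce_to_subspace[OF lt M, where K = N and L = 0])
      fix \<alpha> :: "'n monomial" assume "N < mdeg \<alpha>"
      then show "?e \<alpha> \<in> M"
        by (intro J_sub_M monomials_in_local_ideal_if_initial[OF lt, of N] initial N) auto
    next
      fix \<alpha> :: "'n monomial"
      show "?e \<alpha> \<in> M \<or> (\<exists>f\<in>M. is_initial lt f \<alpha>)"
      proof (cases "\<alpha> \<in> Std lt")
        case True
        have "(\<Sum>\<beta>\<in>Std lt. mconst (if \<beta> = \<alpha> then 1 else 0) * ?e \<beta>) = (\<Sum>\<beta>\<in>Std lt. if \<beta> = \<alpha> then ?e \<alpha> else 0)"
          by (rule sum.cong) auto
        then have "?e \<alpha> - (\<Sum>\<beta>\<in>Std lt. mconst (if \<beta> = \<alpha> then 1 else 0) * ?e \<beta>) = 0"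
          using True fin by simp
        then have "?e \<alpha> \<in> M" unfolding M_def using J(1) by (intro CollectI exI[of _ "\<lambda>\<beta>. if \<beta> = \<alpha> then 1 else 0"]) simp
        then show ?thesis ..
      next
        case False
        then show ?thesis using initial J_sub_M ideal_gen_subset_local_ideal by blast
      qed
    qed simp
    then have "(\<Sum>\<alpha>\<in>Poly_Mapping.keys f. mconst (Poly_Mapping.lookup f \<alpha>) * ?e \<alpha>) \<in> M"
      by (intro mpoly_vs.subspace_sum mpoly_vs.subspace_scale M)
    then have "f \<in> M" by (simp add: mconst_mult_single poly_mapping_eq_sum_single[symmetric])
    then show "\<exists>c. f - (\<Sum>\<alpha>\<in>Std lt. mconst (c \<alpha>) * ?e \<alpha>) \<in> ?J" by (simp add: M_def)
  qed
qed

text \<open>The prescribed series is a polynomial, so standard monomials have bounded degree, and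
  its value at 1 is their number.\<close>

lemma standard_monomials_hilbert:
  fixes I :: "'n::finite mpoly set"
  assumes H: "hilbert_series lt I = (\<Sum>i<d. fps_X ^ i) ^ \<kappa>"
  obtains N where "\<And>\<alpha>. N \<le> mdeg \<alpha> \<Longrightarrow> \<alpha> \<notin> standard_monomials lt I"
    and "card (standard_monomials lt I) = d ^ \<kappa>"
proof -
  let ?S = "standard_monomials lt I"
  define p :: "int poly" where "p = (\<Sum>i<d. monom 1 i) ^ \<kappa>"
  define h where "h i = {\<alpha> \<in> ?S. mdeg \<alpha> = i}" for i
  \<comment> \<open>\<open>card\<close> is 0 on infinite sets too; finiteness in each degree makes a
    vanishing coefficient mean that no standard monomial exists there.\<close>
  have fin: "finite (h i)" for i
    by (rule finite_subset[OF _ finite_monomials_mdeg_eq[of i]]) (auto simp: h_def)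
  have H': "hilbert_series lt I = fps_of_poly p"
    by (simp add: H p_def fps_of_poly_power fps_of_poly_sum fps_of_poly_monom')
  have coeff: "int (card (h i)) = coeff p i" for i
    using arg_cong[OF H', of "\<lambda>f. fps_nth f i"] by (simp add: hilbert_series_def h_def)
  have empty: "h i = {}" if "degree p < i" for i
    using coeff[of i] coeff_eq_0[OF that] fin by simp
  have S: "?S = (\<Union>i\<le>degree p. h i)"
  proof -
    have "mdeg \<alpha> \<le> degree p" if "\<alpha> \<in> ?S" for \<alpha>
      using empty[of "mdeg \<alpha>"] that by (auto simp: h_def not_less[symmetric])
    then show ?thesis by (auto simp: h_def)
  qed
  have "card ?S = (\<Sum>i\<le>degree p. card (h i))"
    unfolding S by (rule card_UN_disjoint) (use fin in \<open>auto simp: h_def\<close>)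
  then have "int (card ?S) = poly p 1" by (simp add: coeff poly_altdef)
  also have "\<dots> = int (d ^ \<kappa>)" by (simp add: p_def poly_power poly_sum poly_monom)
  finally have card: "card ?S = d ^ \<kappa>" by linarith
  show ?thesis
  proof
    show "\<alpha> \<notin> ?S" if "Suc (degree p) \<le> mdeg \<alpha>" for \<alpha>
      using empty[of "mdeg \<alpha>"] that by (auto simp: h_def)
  qed (rule card)
qed

section \<open>Existence of the choices made in pre-inflation\<close>

lemma bij_betw_card_less: "bij_betw (\<lambda>i. card {j. j < i}) (UNIV :: 'n::{finite,linorder} set) {..<CARD('n)}"
proof -
  let ?r = "\<lambda>i :: 'n. card {j. j < i}"
  have mono: "?r i < ?r j" if "i < j" for i j
    by (rule psubset_card_mono) (use that in auto)
  have inj: "inj ?r"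
    by (rule injI) (metis linorder_neqE mono less_irrefl)
  have "?r i < CARD('n)" for i
    by (rule psubset_card_mono) auto
  then have "range ?r \<subseteq> {..<CARD('n)}" by auto
  moreover have "card (range ?r) = CARD('n)" using inj by (rule card_image)
  ultimately have "range ?r = {..<CARD('n)}" by (intro card_subset_eq) auto
  with inj show ?thesis by (simp add: bij_betw_def)
qed

text \<open>The number of smaller elements ranks the variables from 0 to
  \<open>CARD('n) - 1\<close>; beyond the bound, \<open>firsts \<kappa>\<close> would just be all
  variables.\<close>

lemma card_firsts:
  assumes "\<kappa> \<le> CARD('n::{finite,linorder})"
  shows "card (firsts \<kappa> :: 'n set) = \<kappa>"
proof -
  let ?r = "\<lambda>i :: 'n. card {j. j < i}"
  note bij = bij_betw_card_less[where 'n = 'n]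
  have "?r ` firsts \<kappa> = {..<\<kappa>}"
  proof
    show "{..<\<kappa>} \<subseteq> ?r ` firsts \<kappa>"
    proof
      fix m assume m: "m \<in> {..<\<kappa>}"
      then have "m \<in> range ?r" using bij assms by (auto simp: bij_betw_def)
      then obtain i where "m = ?r i" by auto
      with m show "m \<in> ?r ` firsts \<kappa>" by (auto simp: firsts_def)
    qed
  qed (auto simp: firsts_def)
  moreover have "inj_on ?r (firsts \<kappa>)" using bij by (auto simp: bij_betw_def intro: inj_on_subset)
  ultimately show ?thesis by (metis card_image card_lessThan)
qed

lemma breadth_le: "breadth F x \<le> CARD('n)" for F :: "'n::finite system"
  unfolding breadth_def using vec.dim_subset_UNIV[of "jac_kernel F x"]
  by (simp add: vec.dimension_def card_cart_basis)

lemma matrix_vector_mult_axis: "A *v axis j 1 = column j A" for A :: "'a::comm_ring_1 ^ 'n::finite ^ 'm"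
  by (simp add: vec_eq_iff matrix_vector_mult_def column_def axis_def if_distrib[of "(*) _"] cong: if_cong)

text \<open>The columns outside \<open>S\<close> are filled with the rest of a basis extending the
  given family. This provides the coordinate change of step 1 and, inverted, the matrix of step
  2.\<close>

lemma complete_to_invertible:
  fixes v :: "'n::finite \<Rightarrow> complex ^ 'n"
  assumes inj: "inj_on v S" and indep: "vec.independent (v ` S)"
  obtains M :: "complex ^ 'n ^ 'n" where "invertible M" "\<And>j. j \<in> S \<Longrightarrow> M *v axis j 1 = v j"
proof -
  define B where "B = vec.extend_basis (v ` S)"
  have B: "v ` S \<subseteq> B" "vec.independent B" "vec.span B = UNIV"
    using vec.extend_basis_superset[OF indep] vec.independent_extend_basis[OF indep]
      vec.span_extend_basis[OF indep] by (auto simp: B_def)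
  have finB: "finite B" using B(2) by (rule vec.finiteI_independent)
  have "card B = CARD('n)"
    using vec.dim_eq_card[of B UNIV] B by (simp add: card_cart_basis)
  then have "card (B - v ` S) = card (- S)"
    using card_Diff_subset[of "v ` S" B] B(1) card_image[OF inj] by (simp add: Compl_eq_Diff_UNIV card_Diff_subset)
  then obtain h where h: "bij_betw h (- S) (B - v ` S)"
    using finB by (metis finite finite_Diff finite_same_card_bij)
  define w where "w j = (if j \<in> S then v j else h j)" for j
  have "bij_betw w S (v ` S)"
    using inj by (simp add: bij_betw_def w_def inj_on_def)
  moreover have "bij_betw w (- S) (B - v ` S)"
    using h by (rule bij_betw_cong[THEN iffD1, rotated]) (simp add: w_def)
  ultimately have "bij_betw w (S \<union> - S) (v ` S \<union> (B - v ` S))"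
    by (rule bij_betw_combine) auto
  then have indep_w: "inj w" "vec.independent (range w)"
    using B(1,2) by (simp_all add: bij_betw_def Un_absorb1)
  define M :: "complex ^ 'n ^ 'n" where "M = (\<chi> i j. w j $ i)"
  have col: "column j M = w j" for j by (simp add: column_def M_def vec_eq_iff)
  have ker: "x = 0" if "M *v x = 0" for x
  proof -
    have "(\<Sum>j\<in>UNIV. x $ j *s w j) = 0" using that by (simp add: matrix_mult_sum col)
    then have "(\<Sum>y\<in>range w. x $ (inv w y) *s y) = 0"
      using indep_w(1) by (simp add: sum.reindex)
    then have "\<forall>y\<in>range w. x $ (inv w y) = 0"
      using indep_w(2) by (auto simp: vec.dependent_finite)
    then show ?thesis using indep_w(1) by (simp add: vec_eq_iff)
  qed
  show ?thesis
  proof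
    show "invertible M"
      unfolding invertible_left_inverse matrix_left_invertible_ker using ker by blast
    show "M *v axis j 1 = v j" if "j \<in> S" for j
      using that by (simp add: matrix_vector_mult_axis col w_def)
  qed
qed

lemma span_axis: "vec.span ((\<lambda>i. axis i 1) ` S) = {x :: complex ^ 'n::finite. \<forall>i. i \<notin> S \<longrightarrow> x $ i = 0}"
proof
  show "vec.span ((\<lambda>i. axis i 1) ` S) \<subseteq> {x :: complex ^ 'n. \<forall>i. i \<notin> S \<longrightarrow> x $ i = 0}"
    by (rule vec.span_minimal) (auto simp: vec.subspace_def axis_def)
  show "{x :: complex ^ 'n. \<forall>i. i \<notin> S \<longrightarrow> x $ i = 0} \<subseteq> vec.span ((\<lambda>i. axis i 1) ` S)"
  proof safe
    fix x :: "complex ^ 'n" assume x: "\<forall>i. i \<notin> S \<longrightarrow> x $ i = 0"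
    have "x = (\<Sum>i\<in>S. x $ i *s axis i 1)"
      using x by (auto simp: vec_eq_iff axis_def sum_component if_distrib[of "(*) _"] cong: if_cong)
    also have "\<dots> \<in> vec.span ((\<lambda>i. axis i 1) ` S)"
      by (intro vec.span_sum vec.span_scale vec.span_base) auto
    finally show "x \<in> vec.span ((\<lambda>i. axis i 1) ` S)" .
  qed
qed

section \<open>Formal derivatives and the chain rule at the origin\<close>

lemma mpderiv_single:
  "mpderiv j (Poly_Mapping.single \<alpha> c) =
    Poly_Mapping.single (\<alpha> - Poly_Mapping.single j 1) (of_nat (Poly_Mapping.lookup \<alpha> j) * c)"
  unfolding mpderiv_def
  by (rule sum_keys_single[where \<phi> = "\<lambda>\<alpha> c. Poly_Mapping.single (\<alpha> - Poly_Mapping.single j 1)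
       (of_nat (Poly_Mapping.lookup \<alpha> j) * c)"]) simp

lemma mpderiv_add: "mpderiv j (f + g) = mpderiv j f + mpderiv j g"
  unfolding mpderiv_def by (rule sum_keys_add) (auto simp: distrib_left single_add)

lemma mpderiv_mconst: "mpderiv j (mconst c) = 0"
  by (simp add: mconst_def mpderiv_single)

lemma mpderiv_mvar: "mpderiv j (mvar i) = (if i = j then 1 else 0)"
  by (simp add: mvar_def mpderiv_single lookup_single when_def)

lemma mpderiv_mult_single:
  "mpderiv j (Poly_Mapping.single \<alpha> a * Poly_Mapping.single \<beta> b) =
    Poly_Mapping.single \<alpha> a * mpderiv j (Poly_Mapping.single \<beta> b) +
    mpderiv j (Poly_Mapping.single \<alpha> a) * Poly_Mapping.single \<beta> b"
proof -
  \<comment> \<open>Truncated subtraction of exponents may fail to commute with addition when the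
    variable \<open>j\<close> is absent from \<open>\<beta>\<close>, but then the coefficient is
    0.\<close>
  have *: "Poly_Mapping.single (\<alpha> + (\<beta> - Poly_Mapping.single j 1)) (of_nat (Poly_Mapping.lookup \<beta> j) * (a * b)) =
      Poly_Mapping.single (\<alpha> + \<beta> - Poly_Mapping.single j 1) (of_nat (Poly_Mapping.lookup \<beta> j) * (a * b))"
    for \<alpha> \<beta> :: "'a monomial" and a b :: complex
  proof (cases "Poly_Mapping.lookup \<beta> j = 0")
    case False
    then have "\<alpha> + (\<beta> - Poly_Mapping.single j 1) = \<alpha> + \<beta> - Poly_Mapping.single j 1"
      by (intro poly_mapping_eqI) (auto simp: lookup_add lookup_minus lookup_single when_def)
    then show ?thesis by simp
  qed simp
  have "mpderiv j (Poly_Mapping.single \<alpha> a * Poly_Mapping.single \<beta> b) =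
      Poly_Mapping.single (\<alpha> + \<beta> - Poly_Mapping.single j 1) (of_nat (Poly_Mapping.lookup \<beta> j) * (a * b)) +
      Poly_Mapping.single (\<beta> + \<alpha> - Poly_Mapping.single j 1) (of_nat (Poly_Mapping.lookup \<alpha> j) * (b * a))"
    unfolding mult_single mpderiv_single
    by (simp add: lookup_add add.commute algebra_simps single_add[symmetric])
  also have "\<dots> = Poly_Mapping.single \<alpha> a * mpderiv j (Poly_Mapping.single \<beta> b) +
    mpderiv j (Poly_Mapping.single \<alpha> a) * Poly_Mapping.single \<beta> b"
    unfolding *[symmetric] mult_single mpderiv_single by (simp add: ac_simps)
  finally show ?thesis .
qed

lemma mpderiv_mult: "mpderiv j (f * g) = f * mpderiv j g + mpderiv j f * g"
proof (induction f rule: poly_mapping_single_induct)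
  case (single \<alpha> a)
  show ?case
    by (induction g rule: poly_mapping_single_induct)
      (simp_all only: mpderiv_mult_single mpderiv_add distrib_left, simp add: algebra_simps)
qed (simp add: mpderiv_add distrib_right)

text \<open>Chain rule at the origin, by induction over the ring operations: both sides obey the
  same product rule.\<close>

lemma lin_coeff_msubst:
  "lin_coeff (msubst f A) j = (\<Sum>i\<in>UNIV. meval (mpderiv i f) (sys_eval A 0) * lin_coeff (A $ i) j)"
proof (induction f rule: mpoly_induct)
  case (var i)
  have "(\<Sum>k\<in>UNIV. meval (mpderiv k (mvar i)) (sys_eval A 0) * lin_coeff (A $ k) j) =
      (\<Sum>k\<in>UNIV. if i = k then lin_coeff (A $ k) j else 0)"
    by (rule sum.cong) (auto simp: mpderiv_mvar)
  then show ?case by simp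
qed (simp_all add: mpderiv_mconst mpderiv_add mpderiv_mult lin_coeff_mult distrib_right distrib_left sum.distrib
    sum_distrib_left mult_ac)

text \<open>The chain rule for the identity substitution.\<close>

lemma jacobian_at_0: "jacobian F 0 $ i $ j = lin_coeff (F $ i) j"
proof -
  have "sys_eval (\<chi> i. mvar i) (0 :: 'a cvec) = 0" by (simp add: vec_eq_iff)
  then have "lin_coeff (F $ i) j = (\<Sum>k\<in>UNIV. meval (mpderiv k (F $ i)) 0 * (if k = j then 1 else 0))"
    using lin_coeff_msubst[of "F $ i" "\<chi> i. mvar i" j] by simp
  also have "\<dots> = meval (mpderiv j (F $ i)) 0"
    by (simp add: if_distrib[of "(*) _"] cong: if_cong)
  finally show ?thesis by (simp add: jacobian_def)
qed

lemma affine_map_nth: "affine_map M a $ i = (\<Sum>j\<in>UNIV. mconst (M $ i $ j) * mvar j) + mconst (a $ i)"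
  by (simp add: affine_map_def)

lemma sys_eval_affine_map: "sys_eval (affine_map M a) x = M *v x + a"
  by (simp add: vec_eq_iff affine_map_nth meval_sum matrix_vector_mult_def)

lemma lin_coeff_affine_map: "lin_coeff (affine_map M a $ i) j = M $ i $ j"
  by (simp add: affine_map_nth lin_coeff_sum if_distrib[of "(*) _"] cong: if_cong)

lemma jacobian_affine: "jacobian (G \<circ>\<^sub>s affine_map M a) 0 = jacobian G a ** M"
  by (simp add: vec_eq_iff jacobian_at_0 lin_coeff_msubst lin_coeff_affine_map sys_eval_affine_map
      matrix_matrix_mult_def) (simp add: jacobian_def)

text \<open>\<open>M\<close> sends the first \<kappa> axes to a basis of the kernel; by the chain
  rule the kernel in the new coordinates is the preimage of the old one under
  \<open>M\<close>.\<close>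

lemma step1_exists:
  fixes G :: "'n::{finite,linorder} system"
  assumes "breadth G z = \<kappa>"
  shows "\<exists>A. step1 \<kappa> G z A"
proof -
  let ?K = "jac_kernel G z" and ?U = "firsts \<kappa> :: 'n set"
  have K: "vec.subspace ?K"
    by (auto simp: jac_kernel_def vec.subspace_def matrix_vector_right_distrib
        matrix_vector_mult_scaleR vec.scale_right_distrib) (simp add: vec.scale vector_scalar_commute[symmetric])
  have dim: "vec.dim ?K = \<kappa>" using assms by (simp add: breadth_def)
  obtain B where B: "B \<subseteq> ?K" "vec.independent B" "?K \<subseteq> vec.span B" "card B = \<kappa>"
    using vec.basis_exists[of ?K] dim by metis
  have KB: "?K = vec.span B" using B K by (metis vec.span_minimal subset_antisym)
  have "finite B" using B(2) by (rule vec.finiteI_independent)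
  moreover have "card ?U = \<kappa>" using breadth_le[of G z] assms by (intro card_firsts) simp
  ultimately obtain v where v: "bij_betw v ?U B" using B(4) by (metis finite finite_same_card_bij)
  then have "inj_on v ?U" "v ` ?U = B" by (auto simp: bij_betw_def)
  then obtain M where M: "invertible M" "\<And>j. j \<in> ?U \<Longrightarrow> M *v axis j 1 = v j"
    using complete_to_invertible[of v ?U] B(2) by metis
  have inj: "inj ((*v) M)"
    using M(1) by (metis invertible_left_inverse matrix_left_invertible_injective)
  have lin: "Vector_Spaces.linear (*s) (*s) ((*v) M)" by (rule matrix_vector_mul_linear_gen)
  have "B = (*v) M ` (\<lambda>i. axis i 1) ` ?U" using \<open>v ` ?U = B\<close> M(2) by (auto simp: image_image)
  then have "?K = (*v) M ` vec.span ((\<lambda>i. axis i 1) ` ?U)"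
    using KB vec.linear_span_image[OF lin] by simp
  moreover have "jac_kernel (G \<circ>\<^sub>s affine_map M z) 0 = {x. M *v x \<in> ?K}"
    by (simp add: jac_kernel_def jacobian_affine matrix_vector_mul_assoc)
  ultimately have "jac_kernel (G \<circ>\<^sub>s affine_map M z) 0 = vec.span ((\<lambda>i. axis i 1) ` ?U)"
    using inj by (auto dest: injD)
  then have "step1 \<kappa> G z (affine_map M z)"
    unfolding step1_def using M(1) by (auto simp: sys_eval_affine_map)
  then show ?thesis ..
qed

lemma apply_const_nth: "apply_const B F $ i = (\<Sum>j\<in>UNIV. mconst (B $ i $ j) * F $ j)"
  by (simp add: apply_const_def matrix_vector_mult_def)

text \<open>The span of the axes outside \<open>firsts \<kappa>\<close> meets the kernel only in 0,
  so the corresponding columns of the Jacobian are independent and an invertible matrix moves them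
  back to those axes.\<close>

lemma step2_exists:
  fixes F :: "'n::{finite,linorder} system"
  assumes ker: "jac_kernel F 0 = vec.span ((\<lambda>i. axis i 1) ` firsts \<kappa>)"
  shows "\<exists>B. step2 \<kappa> F B"
proof -
  let ?U = "firsts \<kappa> :: 'n set"
  let ?J = "jacobian F 0"
  have lin: "Vector_Spaces.linear (*s) (*s) ((*v) ?J)" by (rule matrix_vector_mul_linear_gen)
  have inj: "inj_on ((*v) ?J) (vec.span ((\<lambda>i. axis i 1) ` (- ?U)))"
  proof (rule inj_onI)
    fix x y assume x: "x \<in> vec.span ((\<lambda>i. axis i 1) ` (- ?U))" and y: "y \<in> vec.span ((\<lambda>i. axis i 1) ` (- ?U))"
      and eq: "?J *v x = ?J *v y"
    have "x - y \<in> jac_kernel F 0" using eq by (simp add: jac_kernel_def matrix_vector_mult_diff_distrib)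
    then have "\<forall>i. i \<notin> ?U \<longrightarrow> (x - y) $ i = 0" unfolding ker span_axis by simp
    moreover have "\<forall>i. i \<in> ?U \<longrightarrow> (x - y) $ i = 0" using x y unfolding span_axis by simp
    ultimately have "x - y = 0" by (metis vec_eq_iff zero_index)
    then show "x = y" by simp
  qed
  have indep_axis: "vec.independent ((\<lambda>i. axis i (1::complex)) ` (- ?U))"
    by (rule vec.independent_mono[OF independent_cart_basis]) (auto simp: cart_basis_def)
  have "vec.independent ((*v) ?J ` (\<lambda>i. axis i 1) ` (- ?U))"
    by (rule vec.linear_independent_injective_image[OF lin indep_axis inj])
  moreover have "inj_on (\<lambda>j. ?J *v axis j 1) (- ?U)"
  proof (rule inj_onI)
    fix i j assume ij: "i \<in> - ?U" "j \<in> - ?U" and eq: "?J *v axis i 1 = ?J *v axis j 1"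
    have "axis i (1::complex) = axis j 1"
      by (rule inj_onD[OF inj eq]) (use ij in \<open>auto intro: vec.span_base\<close>)
    then show "i = j" by (simp add: axis_eq_axis)
  qed
  ultimately obtain M where M: "invertible M" "\<And>j. j \<in> - ?U \<Longrightarrow> M *v axis j 1 = ?J *v axis j 1"
    using complete_to_invertible[of "\<lambda>j. ?J *v axis j 1" "- ?U"] by (auto simp: image_image)
  then obtain B where B: "B ** M = mat 1" "M ** B = mat 1" by (auto simp: invertible_def)
  have "lin_coeff (apply_const B F $ i) j = (if j \<in> ?U then 0 else if j = i then 1 else 0)" for i j
  proof -
    have "lin_coeff (apply_const B F $ i) j = (B *v (?J *v axis j 1)) $ i"
      by (simp add: apply_const_nth lin_coeff_sum matrix_vector_mult_axis column_def
          matrix_vector_mult_def[of B] jacobian_at_0)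
    also have "\<dots> = (if j \<in> ?U then 0 else axis j 1 $ i)"
    proof (cases "j \<in> ?U")
      case True
      then have "axis j 1 \<in> jac_kernel F 0" unfolding ker by (intro vec.span_base) auto
      then show ?thesis using True by (simp add: jac_kernel_def)
    next
      case False
      then have "B *v (?J *v axis j 1) = axis j 1"
        using M(2)[of j] B(1) by (metis ComplI matrix_vector_mul_assoc matrix_vector_mul_lid)
      then show ?thesis using False by simp
    qed
    finally show ?thesis by (auto simp: axis_def)
  qed
  then have "normalized_linear_parts \<kappa> (apply_const B F)"
    by (auto simp: normalized_linear_parts_def)
  moreover have "invertible B" using B by (auto simp: invertible_def)
  ultimately show ?thesis unfolding step2_def by blast
qed

section \<open>Step 3: clearing mixed terms of low degree\<close>

definition pure :: "'n set \<Rightarrow> 'n mpoly \<Rightarrow> bool" where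
  "pure U f \<longleftrightarrow> (\<forall>\<alpha>\<in>Poly_Mapping.keys f. Poly_Mapping.keys \<alpha> \<subseteq> U)"

definition mixed_terms_above :: "'n set \<Rightarrow> nat \<Rightarrow> 'n::finite mpoly \<Rightarrow> bool" where
  "mixed_terms_above U k f \<longleftrightarrow>
     (\<forall>\<alpha>\<in>Poly_Mapping.keys f. \<not> Poly_Mapping.keys \<alpha> \<subseteq> U \<longrightarrow> k < mdeg \<alpha>)"

lemma mixed_terms_above_iff:
  "mixed_terms_above U k f \<longleftrightarrow>
    (\<forall>\<alpha>. mdeg \<alpha> \<le> k \<longrightarrow> \<not> Poly_Mapping.keys \<alpha> \<subseteq> U \<longrightarrow> Poly_Mapping.lookup f \<alpha> = 0)"
  unfolding mixed_terms_above_def Ball_def in_keys_iff linorder_not_le[symmetric] by blast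

text \<open>Since \<open>b i\<close> is \<open>mvar i\<close> up to order 2, a mixed monomial is
  congruent modulo \<open>b i\<close> to terms of strictly higher degree; repetition moves all mixed
  terms beyond \<open>k\<close>. The multipliers have no constant term because \<open>f\<close> has
  order 2, which protects the linear parts in step 3.\<close>

lemma remove_mixed_terms:
  fixes b :: "'n::finite \<Rightarrow> 'n mpoly"
  assumes b: "\<And>j. j \<notin> U \<Longrightarrow> ord_ge 2 (b j - mvar j)" and f: "ord_ge 2 f"
  shows "\<exists>r. (\<forall>j. ord_ge 1 (r j)) \<and> mixed_terms_above U k (f - (\<Sum>j\<in>- U. r j * b j))"
proof -
  define M where "M = {f. \<exists>r. (\<forall>j. ord_ge 1 (r j)) \<and> mixed_terms_above U k (f - (\<Sum>j\<in>- U. r j * b j))}"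
  have base: "f \<in> M" if "mixed_terms_above U k f" for f
    unfolding M_def using that by (intro CollectI exI[of _ "\<lambda>_. 0"]) simp
  have M: "mpoly_vs.subspace M"
  proof (rule mpoly_vs.subspaceI)
    show "0 \<in> M" by (rule base) (simp add: mixed_terms_above_def)
  next
    fix f g assume "f \<in> M" "g \<in> M"
    then obtain r s where r: "\<And>j. ord_ge 1 (r j)" "mixed_terms_above U k (f - (\<Sum>j\<in>- U. r j * b j))"
      and s: "\<And>j. ord_ge 1 (s j)" "mixed_terms_above U k (g - (\<Sum>j\<in>- U. s j * b j))"
      unfolding M_def by blast
    have eq: "f + g - (\<Sum>j\<in>- U. (r j + s j) * b j) =
        (f - (\<Sum>j\<in>- U. r j * b j)) + (g - (\<Sum>j\<in>- U. s j * b j))"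
      by (simp only: distrib_right sum.distrib add_diff_add)
    have "mixed_terms_above U k (f + g - (\<Sum>j\<in>- U. (r j + s j) * b j))"
      unfolding eq using r(2) s(2) unfolding mixed_terms_above_iff lookup_add by auto
    moreover have "\<forall>j. ord_ge 1 (r j + s j)" using r(1) s(1) by (blast intro: ord_ge_add)
    ultimately show "f + g \<in> M" unfolding M_def by (intro CollectI exI[of _ "\<lambda>j. r j + s j"] conjI)
  next
    fix c f assume "f \<in> M"
    then obtain r where r: "\<And>j. ord_ge 1 (r j)" "mixed_terms_above U k (f - (\<Sum>j\<in>- U. r j * b j))"
      unfolding M_def by blast
    have eq: "mconst c * f - (\<Sum>j\<in>- U. (mconst c * r j) * b j) = mconst c * (f - (\<Sum>j\<in>- U. r j * b j))"
      by (simp only: right_diff_distrib sum_distrib_left mult.assoc)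
    have "mixed_terms_above U k (mconst c * f - (\<Sum>j\<in>- U. (mconst c * r j) * b j))"
      unfolding eq using r(2) unfolding mixed_terms_above_iff lookup_mconst_mult by auto
    moreover have "\<forall>j. ord_ge 1 (mconst c * r j)" using r(1) by (blast intro: ord_ge_mult_left)
    ultimately show "mconst c * f \<in> M" unfolding M_def by (intro CollectI exI[of _ "\<lambda>j. mconst c * r j"] conjI)
  qed
  have combination: "f \<in> M" if "\<And>\<alpha>. \<alpha> \<in> Poly_Mapping.keys f \<Longrightarrow> Poly_Mapping.single \<alpha> 1 \<in> M" for f
  proof -
    have "(\<Sum>\<alpha>\<in>Poly_Mapping.keys f. mconst (Poly_Mapping.lookup f \<alpha>) * Poly_Mapping.single \<alpha> 1) \<in> M"
      using that by (intro mpoly_vs.subspace_sum mpoly_vs.subspace_scale M)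
    then show ?thesis by (simp add: mconst_mult_single poly_mapping_eq_sum_single[symmetric])
  qed
  have single: "Poly_Mapping.single \<alpha> 1 \<in> M" if "2 \<le> mdeg \<alpha>" for \<alpha>
    using that
  \<comment> \<open>Degrees increase, so the distance to \<open>Suc k\<close> is the measure; it is
    positive exactly while the degree is at most \<open>k\<close>.\<close>
  proof (induction "Suc k - mdeg \<alpha>" arbitrary: \<alpha> rule: less_induct)
    case less
    show ?case
    proof (cases "k < mdeg \<alpha> \<or> Poly_Mapping.keys \<alpha> \<subseteq> U")
      case True
      then show ?thesis by (intro base) (auto simp: mixed_terms_above_def)
    next
      case False
      then obtain i where i: "i \<notin> U" "Poly_Mapping.lookup \<alpha> i \<noteq> 0" by (auto simp: in_keys_iff)
      from i(2) obtain \<beta> where \<beta>: "\<alpha> = Poly_Mapping.single i 1 + \<beta>" by (rule monomial_split_var)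
      then have deg: "mdeg \<alpha> = Suc (mdeg \<beta>)" by simp
      define x where "x = Poly_Mapping.single \<beta> (1 :: complex)"
      have x: "ord_ge (mdeg \<beta>) x" by (simp add: x_def ord_ge_single)
      have "ord_ge (mdeg \<beta> + 2) (x * (b i - mvar i))" by (rule ord_ge_mult[OF x b[OF i(1)]])
      then have *: "Suc (mdeg \<alpha>) \<le> mdeg \<gamma>" if "\<gamma> \<in> Poly_Mapping.keys (x * (b i - mvar i))" for \<gamma>
        using that deg unfolding ord_ge_def by fastforce
      have "x * (b i - mvar i) \<in> M"
      proof (rule combination, rule less.hyps)
        fix \<gamma> assume "\<gamma> \<in> Poly_Mapping.keys (x * (b i - mvar i))"
        then show "Suc k - mdeg \<gamma> < Suc k - mdeg \<alpha>" "2 \<le> mdeg \<gamma>"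
          using *[of \<gamma>] False less.prems by linarith+
      qed
      moreover have "x * b i \<in> M"
      proof -
        have "(\<Sum>j\<in>- U. (if j = i then x else 0) * b j) = (\<Sum>j\<in>- U. if j = i then x * b i else 0)"
          by (rule sum.cong) auto
        also have "\<dots> = x * b i" using i(1) by simp
        finally have "x * b i - (\<Sum>j\<in>- U. (if j = i then x else 0) * b j) = 0" by (simp only: diff_self)
        then have "mixed_terms_above U k (x * b i - (\<Sum>j\<in>- U. (if j = i then x else 0) * b j))"
          by (simp only: mixed_terms_above_def keys_zero) simp
        moreover have "ord_ge 1 x" using deg less.prems by (intro ord_ge_mono[OF x]) linarith
        then have "\<forall>j. ord_ge 1 (if j = i then x else 0)" by (simp only: ord_ge_0 split: if_split) simp
        ultimately show ?thesis
          unfolding M_def by (intro CollectI exI[of _ "\<lambda>j. if j = i then x else 0"] conjI)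
      qed
      ultimately have "x * b i - x * (b i - mvar i) \<in> M" by (intro mpoly_vs.subspace_diff M)
      moreover have "x * b i - x * (b i - mvar i) = Poly_Mapping.single \<alpha> 1"
        by (simp add: right_diff_distrib x_def mvar_def mult_single \<beta> add.commute)
      ultimately show ?thesis by simp
    qed
  qed
  have "f \<in> M" by (rule combination, rule single) (use f in \<open>simp add: ord_ge_def\<close>)
  then show ?thesis by (simp add: M_def)
qed

definition shear :: "'n set \<Rightarrow> ('n \<Rightarrow> 'n \<Rightarrow> 'n mpoly) \<Rightarrow> 'n::finite pmat" where
  "shear U r = mat 1 + (\<chi> i j. if i \<in> U \<and> j \<notin> U then r i j else 0)"

lemma matrix_add_rdistrib: "(A + B) ** C = A ** C + B ** C"
  by (simp add: vec_eq_iff matrix_matrix_mult_def distrib_right sum.distrib)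

text \<open>The off-diagonal block has rows in \<open>U\<close> and columns outside
  \<open>U\<close>, hence square 0, so negating it inverts the matrix.\<close>

lemma shear_mult_uminus: "shear U r ** shear U (\<lambda>i j. - r i j) = mat 1"
proof -
  define N where "N r = (\<chi> i j. if i \<in> U \<and> j \<notin> U then r i j else 0)" for r :: "'a \<Rightarrow> 'a \<Rightarrow> 'a mpoly"
  have prod: "N r ** N s = 0" for r s
  proof -
    have "(\<Sum>k\<in>UNIV. N r $ i $ k * N s $ k $ j) = 0" for i j
      by (rule sum.neutral) (auto simp: N_def)
    then show ?thesis by (simp add: vec_eq_iff matrix_matrix_mult_def)
  qed
  have "N r + N (\<lambda>i j. - r i j) = 0" by (simp add: vec_eq_iff N_def)
  then show ?thesis
    by (simp add: shear_def N_def[symmetric] matrix_add_ldistrib matrix_add_rdistrib prod)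
qed

lemma invertible_shear: "invertible (shear U r)"
  using shear_mult_uminus[of U r] shear_mult_uminus[of U "\<lambda>i j. - r i j"]
  by (auto simp: invertible_def)

lemma shear_apply:
  "(shear U r *v F) $ i = F $ i + (if i \<in> U then \<Sum>j\<in>- U. r i j * F $ j else 0)"
proof -
  have eq: "(\<Sum>j\<in>UNIV. (if i \<in> U \<and> j \<notin> U then r i j else 0) * F $ j) =
      (if i \<in> U then \<Sum>j\<in>- U. r i j * F $ j else 0)"
    by (auto simp: Compl_eq intro!: sum.mono_neutral_cong_right)
  have "(shear U r *v F) $ i = F $ i + (\<Sum>j\<in>UNIV. (if i \<in> U \<and> j \<notin> U then r i j else 0) * F $ j)"
    unfolding shear_def matrix_vector_mult_add_rdistrib matrix_vector_mul_lid
    unfolding matrix_vector_mult_def by simp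
  then show ?thesis by (simp only: eq)
qed

lemma normalized_ord_ge:
  assumes "normalized_linear_parts \<kappa> F" and "sys_eval F 0 = 0"
  shows "i \<in> firsts \<kappa> \<Longrightarrow> ord_ge 2 (F $ i)" "i \<notin> firsts \<kappa> \<Longrightarrow> ord_ge 2 (F $ i - mvar i)"
proof -
  have "meval (F $ i) 0 = 0" using assms(2) by (metis sys_eval_nth zero_index)
  then show "i \<in> firsts \<kappa> \<Longrightarrow> ord_ge 2 (F $ i)" "i \<notin> firsts \<kappa> \<Longrightarrow> ord_ge 2 (F $ i - mvar i)"
    using assms(1) unfolding normalized_linear_parts_def ord_ge_2_iff by auto
qed

text \<open>Multiples of rows outside \<open>firsts \<kappa>\<close> are subtracted from rows
  inside, which is a shear. Multipliers and rows both vanish at the origin, so the corrections have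
  order 2 and leave the linear parts alone.\<close>

lemma step3_exists:
  fixes F :: "'n::{finite,linorder} system"
  assumes norm: "normalized_linear_parts \<kappa> F" and F0: "sys_eval F 0 = 0"
  shows "\<exists>C. step3 \<kappa> k F C"
proof -
  let ?U = "firsts \<kappa> :: 'n set"
  note ord = normalized_ord_ge[OF norm F0]
  have F1: "ord_ge 1 (F $ i)" for i
    unfolding ord_ge_1_iff using F0 by (metis sys_eval_nth zero_index)
  have "\<forall>i. \<exists>r. i \<in> ?U \<longrightarrow> (\<forall>j. ord_ge 1 (r j)) \<and> mixed_terms_above ?U k (F $ i - (\<Sum>j\<in>- ?U. r j * F $ j))"
    using remove_mixed_terms[of ?U "\<lambda>j. F $ j"] ord by blast
  then obtain r where r: "\<And>i j. i \<in> ?U \<Longrightarrow> ord_ge 1 (r i j)"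
    "\<And>i. i \<in> ?U \<Longrightarrow> mixed_terms_above ?U k (F $ i - (\<Sum>j\<in>- ?U. r i j * F $ j))" by metis
  define C where "C = shear ?U (\<lambda>i j. - r i j)"
  have C: "(C *v F) $ i = (if i \<in> ?U then F $ i - (\<Sum>j\<in>- ?U. r i j * F $ j) else F $ i)" for i
    by (simp add: C_def shear_apply sum_negf)
  have "ord_ge 2 ((C *v F) $ i)" if "i \<in> ?U" for i
  proof -
    have "ord_ge 2 (r i j * F $ j)" for j using ord_ge_mult[OF r(1)[OF that, of j] F1[of j]] by (simp add: numeral_2_eq_2)
    then show ?thesis using that ord by (auto simp: C intro!: ord_ge_diff ord_ge_sum)
  qed
  then have "normalized_linear_parts \<kappa> (C *v F)"
    using norm unfolding normalized_linear_parts_def ord_ge_2_iff by (auto simp: C)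
  moreover have "invertible C" by (simp add: C_def invertible_shear)
  moreover have "k < mdeg \<alpha>" if "i \<in> ?U" "\<alpha> \<in> Poly_Mapping.keys ((C *v F) $ i)"
    "\<not> Poly_Mapping.keys \<alpha> \<subseteq> ?U" for i \<alpha>
    using r(2)[OF that(1)] that by (simp add: C mixed_terms_above_def)
  ultimately show ?thesis unfolding step3_def by blast
qed

section \<open>Step 4: solving for the remaining variables up to a given order\<close>

lemma ord_ge_prod: "(\<And>i. i \<in> A \<Longrightarrow> ord_ge (k i) (f i)) \<Longrightarrow> ord_ge (\<Sum>i\<in>A. k i) (\<Prod>i\<in>A. f i)"
  by (induction A rule: infinite_finite_induct) (auto intro: ord_ge_mult)

lemma ord_ge_msubst:
  assumes Q: "\<And>i. ord_ge 1 (Q $ i)" and f: "ord_ge m f"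
  shows "ord_ge m (msubst f Q)"
proof -
  have "ord_ge m (mconst (Poly_Mapping.lookup f \<alpha>) * (\<Prod>i\<in>UNIV. Q $ i ^ Poly_Mapping.lookup \<alpha> i))"
    if "\<alpha> \<in> Poly_Mapping.keys f" for \<alpha>
  proof (rule ord_ge_mult_left, rule ord_ge_mono)
    show "ord_ge (mdeg \<alpha>) (\<Prod>i\<in>UNIV. Q $ i ^ Poly_Mapping.lookup \<alpha> i)"
      unfolding mdeg_def by (intro ord_ge_prod ord_ge_power Q)
    show "m \<le> mdeg \<alpha>" using f that by (auto simp: ord_ge_def)
  qed
  then show ?thesis unfolding msubst_def by (rule ord_ge_sum)
qed

text \<open>
  Substitution into a polynomial of order at least 2 is a contraction for the order filtration;
  this drives the Picard iteration for step 4.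
\<close>

lemma ord_ge_msubst_diff:
  assumes Q: "\<And>i. ord_ge 1 (Q $ i)" and R: "\<And>i. ord_ge 1 (R $ i)"
    and QR: "\<And>i. ord_ge (Suc l) (Q $ i - R $ i)" and g: "ord_ge 2 g"
  shows "ord_ge (Suc (Suc l)) (msubst g Q - msubst g R)"
proof -
  let ?m = "\<lambda>\<alpha>. Poly_Mapping.single \<alpha> (1 :: complex)"
  \<comment> \<open>Every factor has order 1, and replacing one factor of \<open>Q\<close> by its
    counterpart in \<open>R\<close> leaves a difference of order \<open>l + 1\<close>; the induction
    telescopes these replacements.\<close>
  have single: "ord_ge (l + mdeg \<alpha>) (msubst (?m \<alpha>) Q - msubst (?m \<alpha>) R)" for \<alpha>
  proof (induction "mdeg \<alpha>" arbitrary: \<alpha>)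
    case 0
    then have "\<alpha> = 0" by (metis mdeg_eq_0_iff)
    then show ?case by simp
  next
    case (Suc n)
    then have "\<alpha> \<noteq> 0" by auto
    then obtain i where "Poly_Mapping.lookup \<alpha> i \<noteq> 0" by (metis lookup_zero poly_mapping_eqI)
    then obtain \<beta> where \<beta>: "\<alpha> = Poly_Mapping.single i 1 + \<beta>" by (rule monomial_split_var)
    then have deg: "n = mdeg \<beta>" using Suc.hyps(2) by simp
    have "?m \<alpha> = mvar i * ?m \<beta>" by (simp add: \<beta> mvar_def mult_single)
    then have "msubst (?m \<alpha>) Q - msubst (?m \<alpha>) R =
        Q $ i * (msubst (?m \<beta>) Q - msubst (?m \<beta>) R) + (Q $ i - R $ i) * msubst (?m \<beta>) R"
      by (simp add: algebra_simps)
    moreover have "ord_ge (1 + (l + mdeg \<beta>)) (Q $ i * (msubst (?m \<beta>) Q - msubst (?m \<beta>) R))"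
      by (intro ord_ge_mult Q Suc.hyps(1) deg)
    moreover have "ord_ge (Suc l + mdeg \<beta>) ((Q $ i - R $ i) * msubst (?m \<beta>) R)"
      by (intro ord_ge_mult QR ord_ge_msubst R ord_ge_single) simp
    ultimately show ?case using \<beta> by (simp add: ord_ge_add)
  qed
  have "msubst g Q - msubst g R = (\<Sum>\<alpha>\<in>Poly_Mapping.keys g.
      mconst (Poly_Mapping.lookup g \<alpha>) * (msubst (?m \<alpha>) Q - msubst (?m \<alpha>) R))"
    by (simp add: msubst_def[of g] msubst_single sum_subtractf right_diff_distrib)
  also have "ord_ge (Suc (Suc l)) \<dots>"
  proof (rule ord_ge_sum, rule ord_ge_mult_left)
    fix \<alpha> assume "\<alpha> \<in> Poly_Mapping.keys g"
    then have "2 \<le> mdeg \<alpha>" using g by (auto simp: ord_ge_def)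
    then show "ord_ge (Suc (Suc l)) (msubst (?m \<alpha>) Q - msubst (?m \<alpha>) R)"
      by (intro ord_ge_mono[OF single[of \<alpha>]]) simp
  qed
  finally show ?thesis .
qed

lemma pure_hom:
  "pure U (mconst c)" "i \<in> U \<Longrightarrow> pure U (mvar i)" "pure U f \<Longrightarrow> pure U g \<Longrightarrow> pure U (f + g)"
  "pure U f \<Longrightarrow> pure U g \<Longrightarrow> pure U (f * g)" "pure U f \<Longrightarrow> pure U (- f)" "pure U 0"
proof -
  show "pure U (mconst c)" by (auto simp: pure_def mconst_def)
  show "i \<in> U \<Longrightarrow> pure U (mvar i)" by (auto simp: pure_def mvar_def)
  show "pure U f \<Longrightarrow> pure U g \<Longrightarrow> pure U (f + g)" using keys_add[of f g] by (auto simp: pure_def)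
  show "pure U f \<Longrightarrow> pure U g \<Longrightarrow> pure U (f * g)"
    unfolding pure_def
  proof
    fix \<gamma> assume *: "\<forall>\<alpha>\<in>Poly_Mapping.keys f. Poly_Mapping.keys \<alpha> \<subseteq> U"
      "\<forall>\<alpha>\<in>Poly_Mapping.keys g. Poly_Mapping.keys \<alpha> \<subseteq> U" "\<gamma> \<in> Poly_Mapping.keys (f * g)"
    then obtain \<alpha> \<beta> where "\<gamma> = \<alpha> + \<beta>" "\<alpha> \<in> Poly_Mapping.keys f" "\<beta> \<in> Poly_Mapping.keys g"
      using keys_mult[of f g] by blast
    then show "Poly_Mapping.keys \<gamma> \<subseteq> U" using * keys_add[of \<alpha> \<beta>] by blast
  qed
  show "pure U f \<Longrightarrow> pure U (- f)" by (simp add: pure_def in_keys_iff)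
  show "pure U 0" by (simp add: pure_def)
qed

lemma pure_msubst:
  assumes "\<And>i. pure U (Q $ i)"
  shows "pure U (msubst f Q)"
  by (induction f rule: mpoly_induct) (auto intro: pure_hom assms)

text \<open>Setting the variables outside \<open>U\<close> to 0 isolates the terms in the variables
  of \<open>U\<close> alone, which turns the condition of step 4 into a statement on orders.\<close>

definition pure_proj :: "'n::finite set \<Rightarrow> 'n system" where
  "pure_proj U = (\<chi> i. if i \<in> U then mvar i else 0)"

lemma msubst_pure_proj_single:
  "msubst (Poly_Mapping.single \<beta> c) (pure_proj U) =
    (if Poly_Mapping.keys \<beta> \<subseteq> U then Poly_Mapping.single \<beta> c else 0)"
proof (cases "Poly_Mapping.keys \<beta> \<subseteq> U")
  case True
  have "Poly_Mapping.lookup \<beta> i = 0" if "i \<notin> U" for i using True that by (auto simp: in_keys_iff)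
  then have "(\<Prod>i\<in>UNIV. pure_proj U $ i ^ Poly_Mapping.lookup \<beta> i) = (\<Prod>i\<in>UNIV. mvar i ^ Poly_Mapping.lookup \<beta> i)"
    by (intro prod.cong) (auto simp: pure_proj_def power_0_left)
  then show ?thesis
    using True by (simp add: msubst_single monomial_eq_prod_mvar[symmetric] mconst_mult_single)
next
  case False
  then obtain i where "i \<notin> U" "Poly_Mapping.lookup \<beta> i \<noteq> 0" by (auto simp: in_keys_iff)
  then have "\<exists>i\<in>UNIV. pure_proj U $ i ^ Poly_Mapping.lookup \<beta> i = 0"
    by (intro bexI[of _ i]) (auto simp: pure_proj_def power_0_left)
  then have "(\<Prod>i\<in>UNIV. pure_proj U $ i ^ Poly_Mapping.lookup \<beta> i) = 0"
    by (meson finite prod_zero)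
  then show ?thesis using False by (simp add: msubst_single)
qed

lemma lookup_msubst_pure_proj:
  assumes "Poly_Mapping.keys \<alpha> \<subseteq> U"
  shows "Poly_Mapping.lookup (msubst f (pure_proj U)) \<alpha> = Poly_Mapping.lookup f \<alpha>"
  by (induction f rule: poly_mapping_single_induct)
    (use assms in \<open>auto simp: msubst_pure_proj_single lookup_single when_def lookup_add\<close>)

lemma msubst_pure_proj_pure:
  assumes "pure U f"
  shows "msubst f (pure_proj U) = f"
proof -
  have "msubst f (pure_proj U) = (\<Sum>\<alpha>\<in>Poly_Mapping.keys f. msubst (Poly_Mapping.single \<alpha> (Poly_Mapping.lookup f \<alpha>)) (pure_proj U))"
    by (subst poly_mapping_eq_sum_single[of f]) (rule msubst_sum)
  also have "\<dots> = (\<Sum>\<alpha>\<in>Poly_Mapping.keys f. Poly_Mapping.single \<alpha> (Poly_Mapping.lookup f \<alpha>))"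
    using assms by (intro sum.cong) (auto simp: msubst_pure_proj_single pure_def)
  finally show ?thesis by (simp only: poly_mapping_eq_sum_single[symmetric])
qed

text \<open>Outside \<open>firsts \<kappa>\<close> the equations read \<open>mvar i + g i\<close>
  with \<open>g i\<close> of order 2 and are solved for the remaining variables as in the implicit
  function theorem. The iterate number \<open>l\<close> is accurate enough, as its residual is a
  difference of successive iterates.\<close>

lemma step4_exists:
  fixes F :: "'n::{finite,linorder} system"
  assumes norm: "normalized_linear_parts \<kappa> F" and F0: "sys_eval F 0 = 0"
  shows "\<exists>D. step4 \<kappa> l F D"
proof -
  let ?U = "firsts \<kappa> :: 'n set"
  define g where "g i = F $ i - mvar i" for i
  have g: "ord_ge 2 (g i)" if "i \<notin> ?U" for i
    using normalized_ord_ge(2)[OF norm F0 that] by (simp add: g_def)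
  define graph :: "('n \<Rightarrow> 'n mpoly) \<Rightarrow> 'n system"
    where "graph q = (\<chi> i. if i \<in> ?U then mvar i else q i)" for q
  \<comment> \<open>Fixed-point iteration for minus \<open>g i\<close> on the graph of
    \<open>q\<close>, started at 0; the value 0 on \<open>?U\<close> makes the order estimates hold
    for all indices.\<close>
  define q where "q m = ((\<lambda>q i. if i \<in> ?U then 0 else - msubst (g i) (graph q)) ^^ m) (\<lambda>_. 0)" for m
  have q_0: "q 0 i = 0" and q_Suc: "q (Suc m) i = (if i \<in> ?U then 0 else - msubst (g i) (graph (q m)))" for m i
    by (simp_all add: q_def)
  have pure_q: "pure ?U (q m i)" for m i
  proof (induction m arbitrary: i)
    case (Suc m)
    then have "pure ?U (graph (q m) $ i)" for i by (auto simp: graph_def intro: pure_hom)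
    then show ?case by (auto simp: q_Suc intro: pure_hom pure_msubst)
  qed (simp add: q_0 pure_hom)
  have graph_ord: "ord_ge 1 (graph r $ i)" if "\<And>i. ord_ge 2 (r i)" for r i
    using that[of i] ord_ge_mvar[of i] by (auto simp: graph_def intro: ord_ge_mono)
  have ord_q: "ord_ge 2 (q m i)" for m i
  proof (induction m arbitrary: i)
    case (Suc m)
    then show ?case
      by (auto simp del: One_nat_def simp: q_Suc intro!: ord_ge_uminus ord_ge_msubst graph_ord g)
  qed (simp add: q_0)
  \<comment> \<open>The contraction property gains one order per iteration, starting from the order
    2 of the first iterate.\<close>
  have step: "ord_ge (Suc (Suc m)) (q (Suc m) i - q m i)" for m i
  proof (induction m arbitrary: i)
    case 0
    show ?case using ord_q[of 1 i] by (simp add: q_0 numeral_2_eq_2)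
  next
    case (Suc m)
    show ?case
    proof (cases "i \<in> ?U")
      case False
      have "ord_ge (Suc (Suc m)) (graph (q (Suc m)) $ i - graph (q m) $ i)" for i
        using Suc.IH[of i] by (simp add: graph_def)
      then have "ord_ge (Suc (Suc (Suc m))) (msubst (g i) (graph (q (Suc m))) - msubst (g i) (graph (q m)))"
        by (intro ord_ge_msubst_diff graph_ord ord_q g False)
      then have "ord_ge (Suc (Suc (Suc m))) (- (msubst (g i) (graph (q (Suc m))) - msubst (g i) (graph (q m))))"
        by (rule ord_ge_uminus)
      then show ?thesis using False by (simp add: q_Suc[of "Suc m"] q_Suc[of m])
    qed (simp add: q_Suc[of "Suc m"] q_Suc[of m])
  qed
  define D where "D = (\<chi> i. if i \<in> ?U then mvar i else mvar i + q l i)"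
  have D_proj: "D \<circ>\<^sub>s pure_proj ?U = graph (q l)"
    by (simp add: vec_eq_iff D_def graph_def msubst_pure_proj_pure[OF pure_q]) (simp add: pure_proj_def)
  have high: "l < mdeg \<alpha>" if i: "i \<notin> ?U" and \<alpha>: "\<alpha> \<in> Poly_Mapping.keys ((F \<circ>\<^sub>s D) $ i)" "Poly_Mapping.keys \<alpha> \<subseteq> ?U" for i \<alpha>
  proof (rule ccontr)
    assume "\<not> l < mdeg \<alpha>"
    \<comment> \<open>Restricted to the first variables, \<open>D\<close> is the graph of
      \<open>q l\<close>, and component \<open>i\<close> becomes \<open>q l i - q (Suc l) i\<close>,
      of order at least \<open>l + 2\<close>.\<close>
    have "msubst ((F \<circ>\<^sub>s D) $ i) (pure_proj ?U) = msubst (mvar i + g i) (graph (q l))"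
      by (simp add: msubst_msubst D_proj g_def)
    also have "\<dots> = - (q (Suc l) i - q l i)" using i by (simp add: graph_def[of "q l"] q_Suc)
    finally have "ord_ge (Suc (Suc l)) (msubst ((F \<circ>\<^sub>s D) $ i) (pure_proj ?U))"
      using ord_ge_uminus[OF step[of l i]] by simp
    then have "Poly_Mapping.lookup (msubst ((F \<circ>\<^sub>s D) $ i) (pure_proj ?U)) \<alpha> = 0"
      using \<open>\<not> l < mdeg \<alpha>\<close> by (intro ord_geD) auto
    then show False using \<alpha> by (simp only: lookup_msubst_pure_proj in_keys_iff)
  qed
  show ?thesis
    unfolding step4_def
  proof (intro exI[of _ D] conjI allI impI ballI exI[of _ "q l"])
    show "Poly_Mapping.keys \<alpha> \<subseteq> ?U" "2 \<le> mdeg \<alpha>" if "\<alpha> \<in> Poly_Mapping.keys (q l i)" for i \<alpha>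
      using pure_q[of l i] ord_q[of l i] that by (auto simp: pure_def ord_ge_def)
    show "D = (\<chi> i. if i \<in> ?U then mvar i else mvar i + q l i)" by (rule D_def)
  qed (rule high)
qed

lemma pre_inflation_systems_at_0:
  assumes "step1 \<kappa> G z A" and z: "z \<in> zeros G"
  shows "sys_eval (apply_const B (G \<circ>\<^sub>s A)) 0 = 0"
    and "sys_eval (C *v apply_const B (G \<circ>\<^sub>s A)) 0 = 0"
proof -
  have "sys_eval (G \<circ>\<^sub>s A) 0 = 0" using assms by (simp add: sys_eval_comp step1_def zeros_def)
  then have "meval ((G \<circ>\<^sub>s A) $ i) 0 = 0" for i by (metis sys_eval_nth zero_index)
  then show *: "sys_eval (apply_const B (G \<circ>\<^sub>s A)) 0 = 0"
    by (simp add: vec_eq_iff apply_const_nth meval_sum del: sys_comp_nth)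
  then have "meval (apply_const B (G \<circ>\<^sub>s A) $ i) 0 = 0" for i by (metis sys_eval_nth zero_index)
  then show "sys_eval (C *v apply_const B (G \<circ>\<^sub>s A)) 0 = 0"
    by (simp add: vec_eq_iff matrix_vector_mult_def meval_sum)
qed

text \<open>Each step uses only what the preceding one guarantees, together with vanishing at the
  origin, so no earlier choice can block a later one.\<close>

theorem pre_inflation_executable:
  assumes "breadth G z = \<kappa>" and z: "z \<in> zeros G"
  shows "pre_inflation_executable \<kappa> k l G z"
  unfolding pre_inflation_executable_def
proof (intro conjI allI impI; (elim conjE)?)
  show "\<exists>A. step1 \<kappa> G z A" by (rule step1_exists) fact
next
  fix A assume "step1 \<kappa> G z A"
  then show "\<exists>B. step2 \<kappa> (G \<circ>\<^sub>s A) B" by (intro step2_exists) (simp add: step1_def)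
next
  fix A B assume "step1 \<kappa> G z A" "step2 \<kappa> (G \<circ>\<^sub>s A) B"
  then show "\<exists>C. step3 \<kappa> k (apply_const B (G \<circ>\<^sub>s A)) C"
    by (intro step3_exists pre_inflation_systems_at_0[OF _ z]) (auto simp: step2_def)
next
  fix A B C assume "step1 \<kappa> G z A" "step3 \<kappa> k (apply_const B (G \<circ>\<^sub>s A)) C"
  then show "\<exists>D. step4 \<kappa> l (C *v apply_const B (G \<circ>\<^sub>s A)) D"
    by (intro step4_exists pre_inflation_systems_at_0[OF _ z]) (auto simp: step3_def)
qed

section \<open>Invariance of the multiplicity under pre-inflation\<close>

lemma affine_map_comp: "affine_map M a \<circ>\<^sub>s affine_map N b = affine_map (M ** N) (M *v b + a)"
proof -
  have "(\<Sum>j\<in>UNIV. mconst (M $ i $ j) * ((\<Sum>k\<in>UNIV. mconst (N $ j $ k) * mvar k) + mconst (b $ j))) + mconst (a $ i) =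
      (\<Sum>k\<in>UNIV. mconst (\<Sum>j\<in>UNIV. M $ i $ j * N $ j $ k) * mvar k) +
        mconst ((\<Sum>j\<in>UNIV. M $ i $ j * b $ j) + a $ i)" for i
  proof -
    have "(\<Sum>j\<in>UNIV. mconst (M $ i $ j) * (\<Sum>k\<in>UNIV. mconst (N $ j $ k) * mvar k)) =
        (\<Sum>k\<in>UNIV. \<Sum>j\<in>UNIV. mconst (M $ i $ j) * (mconst (N $ j $ k) * mvar k))"
      unfolding sum_distrib_left by (rule sum.swap)
    also have "\<dots> = (\<Sum>k\<in>UNIV. mconst (\<Sum>j\<in>UNIV. M $ i $ j * N $ j $ k) * mvar k)"
      by (simp only: mconst_sum mconst_hom(4) sum_distrib_right mult.assoc)
    finally have linear: "(\<Sum>j\<in>UNIV. mconst (M $ i $ j) * (\<Sum>k\<in>UNIV. mconst (N $ j $ k) * mvar k)) = \<dots>" .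
    have const: "(\<Sum>j\<in>UNIV. mconst (M $ i $ j) * mconst (b $ j)) = mconst (\<Sum>j\<in>UNIV. M $ i $ j * b $ j)"
      by (simp only: mconst_sum mconst_hom)
    show ?thesis by (simp only: distrib_left sum.distrib linear const mconst_hom(3) add.assoc)
  qed
  then show ?thesis
    by (simp add: vec_eq_iff affine_map_nth msubst_sum matrix_matrix_mult_def matrix_vector_mult_def)
qed

lemma affine_map_id: "affine_map (mat 1) 0 = (\<chi> i. mvar i)"
proof -
  have "(\<Sum>j\<in>UNIV. mconst (mat 1 $ i $ j) * mvar j) = mvar i" for i :: 'a
  proof -
    have "(\<Sum>j\<in>UNIV. mconst (mat 1 $ i $ j) * mvar j) = (\<Sum>j\<in>UNIV. if i = j then mvar j else 0)"
      by (rule sum.cong) (auto simp: mat_def)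
    then show ?thesis by simp
  qed
  then show ?thesis by (simp add: vec_eq_iff affine_map_nth)
qed

lemma affine_map_inverse:
  assumes "invertible M"
  obtains Q where "affine_map M a \<circ>\<^sub>s Q = (\<chi> i. mvar i)" "Q \<circ>\<^sub>s affine_map M a = (\<chi> i. mvar i)"
proof -
  obtain N where N: "M ** N = mat 1" "N ** M = mat 1" using assms by (auto simp: invertible_def)
  have "M *v (- (N *v a)) + a = 0"
    using matrix_vector_mult_diff_distrib[of M 0 "N *v a"] by (simp add: matrix_vector_mul_assoc N)
  then show ?thesis
    by (intro that[of "affine_map N (- (N *v a))"]) (simp_all add: affine_map_comp N affine_map_id)
qed

lemma msubst_pure_fixed:
  assumes f: "pure U f" and Q: "\<And>i. i \<in> U \<Longrightarrow> Q $ i = mvar i"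
  shows "msubst f Q = f"
proof -
  have "pure_proj U \<circ>\<^sub>s Q = pure_proj U" using Q by (auto simp: vec_eq_iff pure_proj_def)
  then show ?thesis using msubst_msubst[of f "pure_proj U" Q] by (simp add: msubst_pure_proj_pure[OF f])
qed

text \<open>The polynomials \<open>q i\<close> involve only variables that \<open>D\<close> fixes,
  so subtracting them undoes adding them.\<close>

lemma step4_inverse:
  fixes F :: "'n::{finite,linorder} system"
  assumes "step4 \<kappa> l F D"
  obtains D' where "D \<circ>\<^sub>s D' = (\<chi> i. mvar i)" "D' \<circ>\<^sub>s D = (\<chi> i. mvar i)" "sys_eval D 0 = 0"
proof -
  let ?U = "firsts \<kappa> :: 'n set"
  obtain q where q: "\<forall>i. \<forall>\<alpha>\<in>Poly_Mapping.keys (q i). Poly_Mapping.keys \<alpha> \<subseteq> ?U \<and> mdeg \<alpha> \<ge> 2"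
    and D: "D = (\<chi> i. if i \<in> ?U then mvar i else mvar i + q i)"
    using assms unfolding step4_def by blast
  define D' where "D' = (\<chi> i. if i \<in> ?U then mvar i else mvar i - q i)"
  have pure: "pure ?U (q i)" for i using q by (simp add: pure_def)
  have fix_D: "msubst (q i) D = q i" "msubst (q i) D' = q i" for i
    by (rule msubst_pure_fixed[OF pure]; simp add: D D'_def)+
  have "ord_ge 2 (q i)" for i using q by (simp add: ord_ge_def)
  then have "meval (q i) 0 = 0" for i by (simp add: ord_ge_2_iff)
  then have "sys_eval D 0 = 0" by (simp add: vec_eq_iff D)
  moreover have "D \<circ>\<^sub>s D' = (\<chi> i. mvar i)" using fix_D(2) by (simp add: vec_eq_iff D) (simp add: D'_def)
  moreover have "D' \<circ>\<^sub>s D = (\<chi> i. mvar i)" using fix_D(1) by (simp add: vec_eq_iff D'_def) (simp add: D)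
  ultimately show ?thesis using that by blast
qed

text \<open>Regards \<open>B\<close> as a matrix over the polynomial ring, so that steps 2 and 3
  fall under the same invariance lemmas.\<close>

lemma invertible_mconst_matrix:
  fixes B :: "'n::finite cmat"
  assumes "invertible B"
  shows "invertible ((\<chi> i j. mconst (B $ i $ j)) :: 'n pmat)"
proof -
  have prod: "(\<chi> i j. mconst (X $ i $ j)) ** (\<chi> i j. mconst (Y $ i $ j)) = (mat 1 :: 'n pmat)"
    if "X ** Y = mat 1" for X Y :: "'n cmat"
  proof -
    have "(\<Sum>k\<in>UNIV. mconst (X $ i $ k) * mconst (Y $ k $ j)) = (if i = j then 1 else 0 :: 'n mpoly)" for i j
    proof -
      have "(\<Sum>k\<in>UNIV. mconst (X $ i $ k) * mconst (Y $ k $ j)) = (mconst ((X ** Y) $ i $ j) :: 'n mpoly)"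
        by (simp add: matrix_matrix_mult_def mconst_sum)
      also have "\<dots> = (if i = j then 1 else 0)" by (simp add: that mat_def)
      finally show ?thesis .
    qed
    then show ?thesis unfolding vec_eq_iff matrix_matrix_mult_def mat_def by simp
  qed
  obtain B' where "B ** B' = mat 1" "B' ** B = mat 1" using assms by (auto simp: invertible_def)
  from this[THEN prod] show ?thesis unfolding invertible_def by blast
qed

lemma zeros_matrix:
  fixes F :: "'n::finite system"
  assumes "invertible C"
  shows "zeros (C *v F) = zeros F"
proof -
  have sub: "zeros H \<subseteq> zeros (X *v H)" for X :: "'n pmat" and H :: "'n system"
  proof
    fix x assume "x \<in> zeros H"
    then have "meval (H $ j) x = 0" for j by (metis mem_Collect_eq sys_eval_nth zero_index zeros_def)
    then show "x \<in> zeros (X *v H)" by (simp add: zeros_def vec_eq_iff matrix_vector_mult_def meval_sum)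
  qed
  obtain C' where "C' ** C = mat 1" using assms by (auto simp: invertible_def)
  then have "C' *v (C *v F) = F" by (simp add: matrix_vector_mul_assoc)
  then show ?thesis using sub[of F C] sub[of "C *v F" C'] by auto
qed

lemma zeros_comp: "x \<in> zeros (F \<circ>\<^sub>s Q) \<longleftrightarrow> sys_eval Q x \<in> zeros F"
  by (simp add: zeros_def sys_eval_comp)

lemma local_basis_cong: "local_ideal F z = local_ideal F' z \<Longrightarrow> local_basis F z X e \<Longrightarrow> local_basis F' z X e"
  by (simp add: local_basis_def)

lemma sys_eval_inverse:
  assumes "Q' \<circ>\<^sub>s Q = (\<chi> i. mvar i)"
  shows "sys_eval Q' (sys_eval Q x) = x"
  by (simp add: sys_eval_comp[symmetric] assms) (simp add: vec_eq_iff)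

text \<open>The Hilbert series describes the translated system at the origin; the inverse
  translation carries its standard monomials back to \<open>z\<close>.\<close>

lemma regular_zero_local_basis:
  fixes G :: "'n::{finite,linorder} system"
  assumes lt: "graded_local_order lt" and reg: "regular_zero lt G z \<kappa> d"
  obtains X :: "'n monomial set" and e where "local_basis G z X e" "card X = d ^ \<kappa>"
proof -
  let ?T = "affine_map (mat 1) z" and ?T' = "affine_map (mat 1) (- z)"
  let ?I = "ideal_gen UNIV (\<lambda>i. (G \<circ>\<^sub>s ?T) $ i)"
  have TT': "?T \<circ>\<^sub>s ?T' = (\<chi> i. mvar i)" "?T' \<circ>\<^sub>s ?T = (\<chi> i. mvar i)"
    by (simp_all add: affine_map_comp affine_map_id)
  obtain N where N: "\<And>\<alpha>. N \<le> mdeg \<alpha> \<Longrightarrow> \<alpha> \<notin> standard_monomials lt ?I"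
    and card: "card (standard_monomials lt ?I) = d ^ \<kappa>"
    using standard_monomials_hilbert[of lt ?I d \<kappa>] reg unfolding regular_zero_def by metis
  have "local_basis (G \<circ>\<^sub>s ?T) 0 (standard_monomials lt ?I) (\<lambda>\<alpha>. Poly_Mapping.single \<alpha> 1)"
    by (rule local_basis_standard_monomials[OF lt N])
  moreover have "sys_eval ?T' z = 0" by (simp add: sys_eval_affine_map)
  ultimately have "local_basis (G \<circ>\<^sub>s ?T \<circ>\<^sub>s ?T') z (standard_monomials lt ?I)
      (\<lambda>\<alpha>. msubst (Poly_Mapping.single \<alpha> 1) ?T')"
    by (intro local_basis_msubst[OF TT'(2,1)]) simp
  then show ?thesis using card by (intro that) (simp_all only: sys_comp_assoc TT' sys_comp_vars)
qed

section \<open>The inflated system: multiplicity at the origin and correspondence of zeros\<close>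

lemma continuous_on_sys_eval: "continuous_on S (sys_eval F)"
proof -
  have "continuous_on S (\<lambda>x. meval f x)" for f
    by (induction f rule: mpoly_induct) (auto intro!: continuous_intros)
  then show ?thesis unfolding sys_eval_def by (rule continuous_on_vec_lambda)
qed

theorem pre_inflation_regular:
  fixes G :: "'n::{finite,linorder} system"
  assumes lt: "graded_local_order lt" and reg: "regular_zero lt G z \<kappa> d"
    and choices: "pre_inflation_choices \<kappa> k l G z A B C D"
  defines "H \<equiv> pre_inflation_output G A B C D \<circ>\<^sub>s inflation \<kappa> d"
    and "\<phi> \<equiv> sys_eval A \<circ> sys_eval D \<circ> sys_eval (inflation \<kappa> d)"
  shows "zero_mult H 0 = enat (d ^ CARD('n))"
    and "y \<in> zeros H \<longleftrightarrow> \<phi> y \<in> zeros G"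
    and "\<phi> y = z \<longleftrightarrow> y = 0"
proof -
  let ?S = "inflation \<kappa> d :: 'n system" and ?B = "(\<chi> i j. mconst (B $ i $ j)) :: 'n pmat"
  have d: "d > 0" and \<kappa>: "breadth G z = \<kappa>" using reg by (auto simp: regular_zero_def)
  have S: "?S = partial_power (firsts \<kappa>) d" by (simp add: inflation_def partial_power_def)
  have steps: "step1 \<kappa> G z A" "invertible B" "invertible C" "step4 \<kappa> l (C *v apply_const B (G \<circ>\<^sub>s A)) D"
    using choices by (auto simp: pre_inflation_choices_def step2_def step3_def)
  obtain M a where M: "invertible M" "A = affine_map M a" using steps(1) by (auto simp: step1_def)
  then obtain A' where A': "A \<circ>\<^sub>s A' = (\<chi> i. mvar i)" "A' \<circ>\<^sub>s A = (\<chi> i. mvar i)"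
    using affine_map_inverse by metis
  have A0: "sys_eval A 0 = z" using steps(1) by (simp add: step1_def)
  obtain D' where D': "D \<circ>\<^sub>s D' = (\<chi> i. mvar i)" "D' \<circ>\<^sub>s D = (\<chi> i. mvar i)" and D0: "sys_eval D 0 = 0"
    using steps(4) by (rule step4_inverse)
  have B: "invertible ?B" using steps(2) by (rule invertible_mconst_matrix)
  have H: "H = (C *v (?B *v (G \<circ>\<^sub>s A))) \<circ>\<^sub>s D \<circ>\<^sub>s ?S"
    by (simp add: H_def pre_inflation_output_def apply_const_def)
  have S0: "sys_eval ?S y = 0 \<longleftrightarrow> y = 0" for y
    using d by (auto simp: vec_eq_iff inflation_def split: if_splits)

  obtain X :: "'n monomial set" and e where "local_basis G z X e" and card: "card X = d ^ \<kappa>"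
    using regular_zero_local_basis[OF lt reg] by blast
  then have "local_basis (G \<circ>\<^sub>s A) 0 X (\<lambda>x. msubst (e x) A)"
    by (intro local_basis_msubst[OF A']) (simp add: A0)
  then have "local_basis (C *v (?B *v (G \<circ>\<^sub>s A))) 0 X (\<lambda>x. msubst (e x) A)"
    by (rule local_basis_cong[rotated]) (simp add: local_ideal_matrix B steps(3))
  then have "local_basis (C *v (?B *v (G \<circ>\<^sub>s A)) \<circ>\<^sub>s D) 0 X (\<lambda>x. msubst (msubst (e x) A) D)"
    by (intro local_basis_msubst[OF D']) (simp add: D0)
  from local_basis_partial_power[OF d this, of "firsts \<kappa>"]
  have "zero_mult H 0 = enat (card (remainders (firsts \<kappa> :: 'n set) d \<times> X))"
    unfolding H S by (rule zero_mult_eq_card)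
  also have "card (remainders (firsts \<kappa> :: 'n set) d \<times> X) = d ^ (CARD('n) - \<kappa>) * d ^ \<kappa>"
    using breadth_le[of G z] \<kappa> by (simp add: card_cartesian_product card_remainders card Compl_eq_Diff_UNIV card_Diff_subset card_firsts)
  also have "\<dots> = d ^ CARD('n)" using breadth_le[of G z] \<kappa> by (simp flip: power_add)
  finally show "zero_mult H 0 = enat (d ^ CARD('n))" .

  show "y \<in> zeros H \<longleftrightarrow> \<phi> y \<in> zeros G"
    by (simp add: H \<phi>_def zeros_comp zeros_matrix B steps(3))
  have "sys_eval A x = sys_eval A y \<longleftrightarrow> x = y" "sys_eval D x = sys_eval D y \<longleftrightarrow> x = y" for x y
    using sys_eval_inverse[OF A'(2)] sys_eval_inverse[OF D'(2)] by metis+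
  from this(1)[of _ 0] this(2)[of _ 0] show "\<phi> y = z \<longleftrightarrow> y = 0"
    by (simp add: \<phi>_def A0 D0 S0)
qed

theorem theorem2p2:
  fixes G :: "'n::{finite,linorder} system" and z :: "'n cvec" and \<kappa> d :: nat
    and lt :: "'n monomial \<Rightarrow> 'n monomial \<Rightarrow> bool"
  assumes "graded_local_order lt"
    and "regular_zero lt G z \<kappa> d"
  shows "pre_inflation_executable \<kappa> d d G z
    \<and> (\<forall>A B C D. pre_inflation_choices \<kappa> d d G z A B C D \<longrightarrow>
         (\<exists>\<epsilon>. inflation_radius \<kappa> d (pre_inflation_output G A B C D) \<epsilon>) \<and>
         (\<forall>\<epsilon>. inflation_radius \<kappa> d (pre_inflation_output G A B C D) \<epsilon> \<longrightarrow>
            z \<in> region_plus \<kappa> d A D \<epsilon> \<and> zeros G \<inter> region_plus \<kappa> d A D \<epsilon> = {z}))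
    \<and> zero_mult G z = enat (d ^ \<kappa>)"
proof (intro conjI allI impI)
  have z: "z \<in> zeros G" and isolated: "z isolated_in zeros G" and \<kappa>: "breadth G z = \<kappa>"
    using assms(2) by (auto simp: regular_zero_def isolated_in_def)
  show "pre_inflation_executable \<kappa> d d G z" using \<kappa> z by (rule pre_inflation_executable)
  obtain X :: "'n monomial set" and e where "local_basis G z X e" "card X = d ^ \<kappa>"
    using regular_zero_local_basis[OF assms] by blast
  then show "zero_mult G z = enat (d ^ \<kappa>)" using zero_mult_eq_card by metis

next
  fix A :: "'n system" and B :: "'n cmat" and C :: "'n pmat" and D :: "'n system"
  assume choices: "pre_inflation_choices \<kappa> d d G z A B C D"
  let ?P = "pre_inflation_output G A B C D"
  let ?H = "?P \<circ>\<^sub>s inflation \<kappa> d"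
  let ?\<phi> = "sys_eval A \<circ> sys_eval D \<circ> sys_eval (inflation \<kappa> d)"
  have z: "z \<in> zeros G" and isolated: "z isolated_in zeros G"
    using assms(2) by (auto simp: regular_zero_def isolated_in_def)
  note mult_H = pre_inflation_regular(1)[OF assms choices]
    and zeros_H = pre_inflation_regular(2)[OF assms choices]
    and \<phi>_eq = pre_inflation_regular(3)[OF assms choices]
  have zero_H: "0 \<in> zeros ?H" using zeros_H[of 0] \<phi>_eq[of 0] z by simp
  show "\<exists>\<epsilon>. inflation_radius \<kappa> d ?P \<epsilon>"
  proof -
    obtain e where e: "e > 0" "\<And>y. y \<in> zeros G \<Longrightarrow> dist z y < e \<Longrightarrow> y = z"
      using isolated unfolding isolated_in_dist_Ex_iff by blast
    have "continuous_on UNIV ?\<phi>"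
      by (intro continuous_on_compose continuous_on_sys_eval)
    then obtain \<delta> where \<delta>: "\<delta> > 0" "\<And>y. dist y 0 < \<delta> \<Longrightarrow> dist (?\<phi> y) (?\<phi> 0) < e"
      using e(1) unfolding continuous_on_iff by blast
    \<comment> \<open>Half of \<open>\<delta>\<close>, because the ball is closed while the
      continuity estimate needs a strict inequality.\<close>
    have "y = 0" if y: "y \<in> zeros ?H" "y \<in> cball 0 (\<delta> / 2)" for y
    proof -
      have "dist y 0 < \<delta>" using y(2) \<delta>(1) by (simp add: dist_commute)
      then have "dist z (?\<phi> y) < e" using \<delta>(2) \<phi>_eq[of 0] by (metis dist_commute)
      then have "?\<phi> y = z" using e(2) zeros_H[of y] y(1) by blast
      then show ?thesis by (simp only: \<phi>_eq)
    qed
    then have "zeros ?H \<inter> cball 0 (\<delta> / 2) = {0}" using zero_H \<delta>(1) by auto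
    then have "inflation_radius \<kappa> d ?P (\<delta> / 2)"
      using \<delta>(1) mult_H by (simp add: inflation_radius_def num_zeros_eq_def)
    then show ?thesis ..
  qed
  fix \<epsilon> assume "inflation_radius \<kappa> d ?P \<epsilon>"
  then have \<epsilon>: "\<epsilon> > 0" and fin: "finite (zeros ?H \<inter> cball 0 \<epsilon>)"
    and sum: "(\<Sum>y\<in>zeros ?H \<inter> cball 0 \<epsilon>. zero_mult ?H y) = enat (d ^ CARD('n))"
    by (auto simp: inflation_radius_def num_zeros_eq_def)
  \<comment> \<open>A second zero would raise the count above the finite number contributed by the
    origin; its own multiplicity might be infinite, hence the comparison in
    \<open>enat\<close>.\<close>
  have only: "y = 0" if y: "y \<in> zeros ?H" "y \<in> cball 0 \<epsilon>" for y
  proof (rule ccontr)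
    assume "y \<noteq> 0"
    have "zero_mult ?H 0 + zero_mult ?H y = (\<Sum>y\<in>{0, y}. zero_mult ?H y)" using \<open>y \<noteq> 0\<close> by simp
    also have "\<dots> \<le> enat (d ^ CARD('n))"
      unfolding sum[symmetric] using fin y zero_H \<epsilon> by (intro sum_mono2) auto
    finally have "enat (d ^ CARD('n)) + zero_mult ?H y \<le> enat (d ^ CARD('n))" by (simp only: mult_H)
    moreover have "1 \<le> zero_mult ?H y" using y(1) by (rule zero_mult_ge_1)
    ultimately show False by (cases "zero_mult ?H y") (auto simp: one_enat_def)
  qed
  show "z \<in> region_plus \<kappa> d A D \<epsilon>"
    unfolding region_plus_def using \<phi>_eq[of 0] \<epsilon> by (intro image_eqI[of _ _ 0]) auto
  moreover have "x = z" if x: "x \<in> zeros G" "x \<in> region_plus \<kappa> d A D \<epsilon>" for x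
  proof -
    obtain y where y: "y \<in> cball 0 \<epsilon>" "x = ?\<phi> y" using x(2) unfolding region_plus_def by blast
    with x(1) have "y \<in> zeros ?H" by (simp only: zeros_H)
    then have "y = 0" using y(1) by (rule only)
    then show ?thesis using y(2) \<phi>_eq[of 0] by simp
  qed
  ultimately show "zeros G \<inter> region_plus \<kappa> d A D \<epsilon> = {z}" using z by blast
qed

end
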